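(* Let $\mathbf{k}=(k_0,\dots,k_n)$ and $\mathbf{r}=(r_1,\dots,r_n)$ be sequences of positive integers, $r_0=r_{n+1}=1$, with $r_i\le r_{i-1}k_{i-1}$ and $r_i\le r_{i+1}k_i$ for $i=1,\dots,n$, and let $$\mathcal Z=\mathrm{Gr}(r_1,k_0)\times\mathrm{Gr}(r_2,r_1k_1)\times\cdots\times\mathrm{Gr}(r_n,r_{n-1}k_{n-1})\times\mathbb{P}(\mathbb{C}^{r_n\times k_n}).$$ The decompression algorithm (with inputs in the open set $\mathcal W\subseteq\mathcal Z$ and outputs in the set $\mathcal U\subseteq V^=_{\mathbf{k},\mathbf{r}}$) defines a one-to-one parametrization from $\mathcal Z$ to the tensor train manifold $V^=_{\mathbf{k},\mathbf{r}}$. The restriction $\mathcal Z_{\mathbb{R}}\to V_{\mathbf{k},\mathbf{r},\mathbb{R}}$ to the real points is birational.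
   Context: For a tensor $\psi\in\bigotimes_{i=0}^n\mathbb{C}^{k_i}$, the $i$-th flattening is the $(k_0\cdots k_i)\times(k_{i+1}\cdots k_n)$ matrix obtained by grouping the indices $0,\dots,i$ and $i+1,\dots,n$. The tensor train variety $V_{\mathbf{k},\mathbf{r}}\subseteq\mathbb{P}(\bigotimes_i\mathbb{C}^{k_i})$ is the set of tensors whose $i$-th flattening has rank at most $r_{i+1}$ for $i=0,\dots,n-1$; the tensor train manifold $V^=_{\mathbf{k},\mathbf{r}}$ is the subset where these ranks are exactly $r_{i+1}$ for all $i=0,\dots,n-1$. The open set $\mathcal W$: $\mathcal W=W_1\times\cdots\times W_n\times\mathbb{C}_*^{r_n\times k_n}$, where $W_i\subseteq\mathrm{Gr}(r_i,r_{i-1}k_{i-1})$ is the set of column spans of matrices $A\in\mathbb{C}^{r_{i-1}k_{i-1}\times r_i}$ whose first $r_i$ rows are linearly independent, and $\mathbb{C}_*^{r_n\times k_n}$ is the set of full rank matrices. A point of $W_{i+1}$ is represented uniquely by a matrix $X_i\in\mathbb{C}^{r_ik_i\times r_{i+1}}$ whose top block is the identity $\mathrm{Id}_{r_{i+1}}$ ($0\le i\le n-1$). Decompression algorithm: on input $(X_0,\dots,X_n)\in\mathcal W$, set $\psi:=X_n$. For $i=n-1,\dots,0$: unfold $\psi$ to the matrix $R_i$ of size $r_{i+1}\times(k_{i+1}\cdots k_n)$, set $\psi^i=X_iR_i$, and tensorize $\psi^i$ to a tensor $\psi$ of format $r_i\times k_i\times\cdots\times k_n$. Return $\psi$. The set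 $\mathcal U$: the tensors in $V^=_{\mathbf{k},\mathbf{r}}$ for which, in each step of the following factorization algorithm, the first $r_{i+1}$ rows of $\psi^i$ are linearly independent. Factorization algorithm: set $\phi=\psi$; for $i=0,\dots,n-1$, unfold $\phi$ to the matrix $\psi^i$ of size $r_ik_i\times(k_{i+1}\cdots k_n)$, let $R_i$ be its first $r_{i+1}$ rows and $X_i$ the matrix with $\psi^i=X_iR_i$ (so $X_i$ has top block $\mathrm{Id}_{r_{i+1}}$), and tensorize $R_i$ to a tensor $\phi$ of format $r_{i+1}\times k_{i+1}\times\cdots\times k_n$; finally $X_n=\phi/\phi_{11}$. $\mathcal Z_{\mathbb{R}}$ and $V_{\mathbf{k},\mathbf{r},\mathbb{R}}$ denote the real points.
   Formalization: Not every input in W has output in U (e.g. k=(2,2,2), r=(2,1), X_0=Id, X_1=e_1), so the parametrization is taken on the inputs in W whose output lies in U, shown to be dense open in Z and to map bijectively onto U, itself dense open in the tensor train manifold. *)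

theory Defs
  imports
    "HOL-Analysis.Abstract_Topology"
    "Jordan_Normal_Form.DL_Rank"
begin

section \<open>Spaces with homogeneous coordinates, over the complex and over the real numbers\<close>

text \<open>
  Projective spaces and Grassmannians (and products of them) are quotients of subsets of an affine
  space: \<open>reps\<close> is the set of representatives (nonzero vectors, matrices of full column rank),
  \<open>coords\<close> are the affine coordinate functions on representatives, and \<open>pt\<close> sends a representative
  to the point it represents.
\<close>

record ('p, 'q) coord_space =
  coords :: "('p \<Rightarrow> complex) set"
  reps :: "'p set"
  pt :: "'p \<Rightarrow> 'q"

text \<open>The set \<open>K\<close> of scalars will be \<open>UNIV\<close> or \<open>\<real>\<close>, viewed as subfields of the complex numbers.\<close>

definition reps_over :: "complex set \<Rightarrow> ('p, 'q) coord_space \<Rightarrow> 'p set" where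
  "reps_over K X = {x \<in> reps X. \<forall>c\<in>coords X. c x \<in> K}"

definition points_over :: "complex set \<Rightarrow> ('p, 'q) coord_space \<Rightarrow> 'q set" where
  "points_over K X = pt X ` reps_over K X"

inductive_set polyfun :: "complex set \<Rightarrow> ('p \<Rightarrow> complex) set \<Rightarrow> ('p \<Rightarrow> complex) set"
  for K :: "complex set" and C :: "('p \<Rightarrow> complex) set" where
  const: "a \<in> K \<Longrightarrow> (\<lambda>_. a) \<in> polyfun K C"
| coord: "c \<in> C \<Longrightarrow> c \<in> polyfun K C"
| add: "\<lbrakk>p \<in> polyfun K C; q \<in> polyfun K C\<rbrakk> \<Longrightarrow> (\<lambda>x. p x + q x) \<in> polyfun K C"
| mult: "\<lbrakk>p \<in> polyfun K C; q \<in> polyfun K C\<rbrakk> \<Longrightarrow> (\<lambda>x. p x * q x) \<in> polyfun K C"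

text \<open>
  The Zariski topology on the \<open>K\<close>-points: a set is open iff the set of its representatives
  over \<open>K\<close> is the non-vanishing locus of a family of polynomials with coefficients in \<open>K\<close>. For
  projective space and for Grassmannians this quotient topology is the one induced by the usual
  projective (Pluecker) embedding.
\<close>

definition is_zariski_open :: "complex set \<Rightarrow> ('p, 'q) coord_space \<Rightarrow> 'q set \<Rightarrow> bool" where
  "is_zariski_open K X U \<longleftrightarrow>
     U \<subseteq> points_over K X \<and>
     (\<exists>P \<subseteq> polyfun K (coords X).
        {x \<in> reps_over K X. pt X x \<in> U} = {x \<in> reps_over K X. \<exists>p\<in>P. p x \<noteq> 0})"

definition zariski :: "complex set \<Rightarrow> ('p, 'q) coord_space \<Rightarrow> 'q topology" where
  "zariski K X = topology (is_zariski_open K X)"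

definition dense_open_in :: "'q topology \<Rightarrow> 'q set \<Rightarrow> 'q set \<Rightarrow> bool" where
  "dense_open_in T S A \<longleftrightarrow>
     openin (subtopology T S) A \<and> (subtopology T S) closure_of A = S"

text \<open>
  Regular maps, defined over \<open>K\<close>, on a (locally closed) set \<open>S\<close> of \<open>K\<close>-points: Zariski-locally on
  \<open>S\<close>, the coordinates of a representative of the image are polynomials in the coordinates
  of a representative of the argument. (Coordinates on the target are homogeneous, so that
  denominators can be cleared.)
\<close>

definition regular_map ::
  "complex set \<Rightarrow> ('p, 'q) coord_space \<Rightarrow> 'q set \<Rightarrow> ('r, 's) coord_space \<Rightarrow> ('q \<Rightarrow> 's) \<Rightarrow> bool" where
  "regular_map K X S Y f \<longleftrightarrow>
     (\<forall>z\<in>S. \<exists>N P.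
        openin (subtopology (zariski K X) S) N \<and> z \<in> N \<and>
        (\<forall>c\<in>coords Y. (\<lambda>x. c (P x)) \<in> polyfun K (coords X)) \<and>
        (\<forall>x\<in>reps_over K X. pt X x \<in> N \<longrightarrow> P x \<in> reps Y \<and> f (pt X x) = pt Y (P x)))"

text \<open>\<open>rational_map K X S Y T D f\<close>: the function \<open>f\<close>, used only on the dense open subset \<open>D\<close>
  of \<open>S\<close>, represents a rational map from \<open>S\<close> to \<open>T\<close>.\<close>

definition rational_map ::
  "complex set \<Rightarrow> ('p, 'q) coord_space \<Rightarrow> 'q set \<Rightarrow> ('r, 's) coord_space \<Rightarrow> 's set \<Rightarrow>
   'q set \<Rightarrow> ('q \<Rightarrow> 's) \<Rightarrow> bool" where
  "rational_map K X S Y T D f \<longleftrightarrow>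
     dense_open_in (zariski K X) S D \<and> f ` D \<subseteq> T \<and> regular_map K X D Y f"

definition birational_map ::
  "complex set \<Rightarrow> ('p, 'q) coord_space \<Rightarrow> 'q set \<Rightarrow> ('r, 's) coord_space \<Rightarrow> 's set \<Rightarrow>
   'q set \<Rightarrow> ('q \<Rightarrow> 's) \<Rightarrow> bool" where
  "birational_map K X S Y T D f \<longleftrightarrow>
     rational_map K X S Y T D f \<and>
     (\<exists>A B. A \<subseteq> D \<and> dense_open_in (zariski K X) S A \<and> dense_open_in (zariski K Y) T B \<and>
        bij_betw f A B \<and> regular_map K Y B X (inv_into A f))"


section \<open>Projective spaces and Grassmannians\<close>

definition proj_vec :: "complex vec \<Rightarrow> complex vec set" where
  "proj_vec v = {c \<cdot>\<^sub>v v | c. c \<noteq> 0}"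

definition proj_mat :: "complex mat \<Rightarrow> complex mat set" where
  "proj_mat B = {c \<cdot>\<^sub>m B | c. c \<noteq> 0}"

definition grassmannian :: "nat \<Rightarrow> nat \<Rightarrow> complex vec set set" where
  "grassmannian q m =
     {S. VectorSpace.subspace class_ring S (module_vec TYPE(complex) m) \<and>
         vectorspace.dim class_ring (module_vec TYPE(complex) m\<lparr>carrier := S\<rparr>) = q}"

definition lin_indpt_first_rows :: "nat \<Rightarrow> complex mat \<Rightarrow> bool" where
  "lin_indpt_first_rows m A \<longleftrightarrow>
     distinct (take m (rows A)) \<and>
     \<not> module.lin_dep class_ring (module_vec TYPE(complex) (dim_col A)) (set (take m (rows A)))"

text \<open>The chart of the Grassmannian in which the first \<open>q\<close> coordinates are independent, and the
  matrix with top block the identity that represents a point of this chart.\<close>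

definition grass_chart :: "nat \<Rightarrow> nat \<Rightarrow> complex vec set set" where
  "grass_chart q m =
     {vec_space.col_space m A | A. A \<in> carrier_mat m q \<and> lin_indpt_first_rows q A}"

definition normal_form :: "nat \<Rightarrow> nat \<Rightarrow> complex vec set \<Rightarrow> complex mat" where
  "normal_form q m S =
     (THE A. A \<in> carrier_mat m q \<and> vec_space.col_space m A = S \<and>
        (\<forall>a<q. \<forall>b<q. A $$ (a, b) = (if a = b then 1 else 0)))"


section \<open>Tensors\<close>

text \<open>
  A tensor of format \<open>d\<^sub>0 \<times> \<dots> \<times> d\<^sub>m\<close> is given by the vector of its coordinates, the multi-indices
  being ordered lexicographically. Grouping indices and splitting them again are
  then the operations \<open>unfold_vec\<close> and \<open>flat_mat\<close>; the lemma \<open>flattening_entry\<close> below spells out the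
  flattenings in terms of multi-indices.
\<close>

definition unfold_vec :: "nat \<Rightarrow> nat \<Rightarrow> complex vec \<Rightarrow> complex mat" where
  "unfold_vec a b v = mat a b (\<lambda>(i, j). v $ (i * b + j))"

definition flat_mat :: "complex mat \<Rightarrow> complex vec" where
  "flat_mat A = vec (dim_row A * dim_col A) (\<lambda>l. A $$ (l div dim_col A, l mod dim_col A))"

definition flattening :: "nat \<Rightarrow> (nat \<Rightarrow> nat) \<Rightarrow> nat \<Rightarrow> complex vec \<Rightarrow> complex mat" where
  "flattening n k i \<psi> = unfold_vec (\<Prod>j=0..i. k j) (\<Prod>j=Suc i..n. k j) \<psi>"

fun lex_pos :: "nat list \<Rightarrow> nat list \<Rightarrow> nat" where
  "lex_pos (d # ds) (i # is) = i * prod_list ds + lex_pos ds is"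
| "lex_pos _ _ = 0"

text \<open>The projective space of tensors of format \<open>k\<^sub>0 \<times> \<dots> \<times> k\<^sub>n\<close>.\<close>

definition tensor_space :: "nat \<Rightarrow> (nat \<Rightarrow> nat) \<Rightarrow> (complex vec, complex vec set) coord_space" where
  "tensor_space n k =
     \<lparr> coords = {\<lambda>v. v $ j | j. j < (\<Prod>i=0..n. k i)},
       reps = carrier_vec (\<Prod>i=0..n. k i) - {0\<^sub>v (\<Prod>i=0..n. k i)},
       pt = proj_vec \<rparr>"

definition tt_variety :: "nat \<Rightarrow> (nat \<Rightarrow> nat) \<Rightarrow> (nat \<Rightarrow> nat) \<Rightarrow> complex vec set set" where
  "tt_variety n k r =
     {proj_vec \<psi> | \<psi>. \<psi> \<in> reps (tensor_space n k) \<and>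
        (\<forall>i<n. vec_space.rank (\<Prod>j=0..i. k j) (flattening n k i \<psi>) \<le> r (Suc i))}"

definition tt_manifold :: "nat \<Rightarrow> (nat \<Rightarrow> nat) \<Rightarrow> (nat \<Rightarrow> nat) \<Rightarrow> complex vec set set" where
  "tt_manifold n k r =
     {proj_vec \<psi> | \<psi>. \<psi> \<in> reps (tensor_space n k) \<and>
        (\<forall>i<n. vec_space.rank (\<Prod>j=0..i. k j) (flattening n k i \<psi>) = r (Suc i))}"


section \<open>The parameter space\<close>

text \<open>A point of the parameter space is a pair \<open>(S, L)\<close>, where \<open>S i\<close> is the point of the \<open>i\<close>-th
  Grassmannian for \<open>1 \<le> i \<le> n\<close> and \<open>L\<close> is the point of the projective space of matrices.\<close>

definition tt_parameters ::
  "nat \<Rightarrow> (nat \<Rightarrow> nat) \<Rightarrow> (nat \<Rightarrow> nat) \<Rightarrow> ((nat \<Rightarrow> complex vec set) \<times> complex mat set) set" where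
  "tt_parameters n k r =
     (\<Pi>\<^sub>E i\<in>{1..n}. grassmannian (r i) (r (i - 1) * k (i - 1))) \<times>
     proj_mat ` (carrier_mat (r n) (k n) - {0\<^sub>m (r n) (k n)})"

definition tt_chart ::
  "nat \<Rightarrow> (nat \<Rightarrow> nat) \<Rightarrow> (nat \<Rightarrow> nat) \<Rightarrow> ((nat \<Rightarrow> complex vec set) \<times> complex mat set) set" where
  "tt_chart n k r =
     (\<Pi>\<^sub>E i\<in>{1..n}. grass_chart (r i) (r (i - 1) * k (i - 1))) \<times>
     proj_mat ` {B \<in> carrier_mat (r n) (k n). vec_space.rank (r n) B = min (r n) (k n)}"

text \<open>Representatives are families \<open>(A\<^sub>0, \<dots>, A\<^sub>n)\<close>, where \<open>A\<^sub>i\<close> for \<open>i < n\<close> is a basis matrix of the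
  subspace with index \<open>i + 1\<close>, and \<open>A\<^sub>n\<close> is a nonzero matrix.\<close>

definition param_space :: "nat \<Rightarrow> (nat \<Rightarrow> nat) \<Rightarrow> (nat \<Rightarrow> nat) \<Rightarrow>
    (nat \<Rightarrow> complex mat, (nat \<Rightarrow> complex vec set) \<times> complex mat set) coord_space" where
  "param_space n k r =
     \<lparr> coords =
         {\<lambda>A. A i $$ (a, b) | i a b. i < n \<and> a < r i * k i \<and> b < r (Suc i)} \<union>
         {\<lambda>A. A n $$ (a, b) | a b. a < r n \<and> b < k n},
       reps =
         {A. (\<forall>i<n. A i \<in> carrier_mat (r i * k i) (r (Suc i)) \<and>
                    vec_space.rank (r i * k i) (A i) = r (Suc i)) \<and>
             A n \<in> carrier_mat (r n) (k n) - {0\<^sub>m (r n) (k n)}},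
       pt = (\<lambda>A. (\<lambda>i\<in>{1..n}. vec_space.col_space (r (i - 1) * k (i - 1)) (A (i - 1)),
                  proj_mat (A n))) \<rparr>"


section \<open>Decompression and factorization\<close>

text \<open>The tensor of format \<open>r\<^sub>i \<times> k\<^sub>i \<times> \<dots> \<times> k\<^sub>n\<close>, where \<open>i = n - m\<close>, that the decompression
  algorithm has produced after \<open>m\<close> steps.\<close>

primrec decompress_steps ::
  "nat \<Rightarrow> (nat \<Rightarrow> nat) \<Rightarrow> (nat \<Rightarrow> nat) \<Rightarrow> (nat \<Rightarrow> complex mat) \<Rightarrow> nat \<Rightarrow> complex vec" where
  "decompress_steps n k r X 0 = flat_mat (X n)"
| "decompress_steps n k r X (Suc m) =
     (let i = n - Suc m;
          R = unfold_vec (r (Suc i)) (\<Prod>j=Suc i..n. k j) (decompress_steps n k r X m)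
      in flat_mat (X i * R))"

definition decompress ::
  "nat \<Rightarrow> (nat \<Rightarrow> nat) \<Rightarrow> (nat \<Rightarrow> nat) \<Rightarrow> (nat \<Rightarrow> complex mat) \<Rightarrow> complex vec" where
  "decompress n k r X = decompress_steps n k r X n"

text \<open>The map given by the decompression algorithm. Since the output is linear in
  the last matrix, the image of the projective point \<open>L\<close> is again a projective point. On all of
  \<open>tt_chart\<close> the output lies in \<open>tt_variety\<close>, but not always in \<open>tt_manifold\<close>: for \<open>k = (2, 2, 2)\<close>
  and \<open>r = (2, 1)\<close> the parameters \<open>X\<^sub>0 = Id\<close> and \<open>X\<^sub>1\<close> the first unit vector yield a tensor whose
  flattening with index 0 has rank 1.\<close>

definition tt_map :: "nat \<Rightarrow> (nat \<Rightarrow> nat) \<Rightarrow> (nat \<Rightarrow> nat) \<Rightarrow>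
    (nat \<Rightarrow> complex vec set) \<times> complex mat set \<Rightarrow> complex vec set" where
  "tt_map n k r = (\<lambda>(S, L).
     (\<lambda>B. decompress n k r
            (\<lambda>i. if i < n then normal_form (r (Suc i)) (r i * k i) (S (Suc i)) else B)) ` L)"

text \<open>\<open>fact_tensor n k r \<psi> i\<close> is the tensor of format \<open>r\<^sub>i \<times> k\<^sub>i \<times> \<dots> \<times> k\<^sub>n\<close> at the beginning of step \<open>i\<close>
  of the factorization algorithm, and \<open>fact_unfolding n k r \<psi> i\<close> is its unfolding, the first
  \<open>r\<^bsub>i+1\<^esub>\<close> rows \<open>R\<^sub>i\<close> of which become the tensor for the next step. The factors \<open>X\<^sub>i\<close> computed by the
  algorithm do not influence the later steps.\<close>

primrec fact_tensor ::
  "nat \<Rightarrow> (nat \<Rightarrow> nat) \<Rightarrow> (nat \<Rightarrow> nat) \<Rightarrow> complex vec \<Rightarrow> nat \<Rightarrow> complex vec" where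
  "fact_tensor n k r \<psi> 0 = \<psi>"
| "fact_tensor n k r \<psi> (Suc i) =
     (let \<psi>i = unfold_vec (r i * k i) (\<Prod>j=Suc i..n. k j) (fact_tensor n k r \<psi> i)
      in flat_mat (mat (r (Suc i)) (dim_col \<psi>i) (\<lambda>ab. \<psi>i $$ ab)))"

definition fact_unfolding ::
  "nat \<Rightarrow> (nat \<Rightarrow> nat) \<Rightarrow> (nat \<Rightarrow> nat) \<Rightarrow> complex vec \<Rightarrow> nat \<Rightarrow> complex mat" where
  "fact_unfolding n k r \<psi> i =
     unfold_vec (r i * k i) (\<Prod>j=Suc i..n. k j) (fact_tensor n k r \<psi> i)"

definition tt_open :: "nat \<Rightarrow> (nat \<Rightarrow> nat) \<Rightarrow> (nat \<Rightarrow> nat) \<Rightarrow> complex vec set set" where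
  "tt_open n k r =
     {proj_vec \<psi> | \<psi>. \<psi> \<in> reps (tensor_space n k) \<and> proj_vec \<psi> \<in> tt_manifold n k r \<and>
        (\<forall>i<n. lin_indpt_first_rows (r (Suc i)) (fact_unfolding n k r \<psi> i))}"


section \<open>Basic facts\<close>

lemma istopology_zariski: "istopology (is_zariski_open K X)"
proof -
  have inter: "is_zariski_open K X (U \<inter> U')"
    if U: "is_zariski_open K X U" and U': "is_zariski_open K X U'" for U U'
  proof -
    obtain P where P: "P \<subseteq> polyfun K (coords X)"
      "{x \<in> reps_over K X. pt X x \<in> U} = {x \<in> reps_over K X. \<exists>p\<in>P. p x \<noteq> 0}"
      using U unfolding is_zariski_open_def by blast
    obtain P' where P': "P' \<subseteq> polyfun K (coords X)"
      "{x \<in> reps_over K X. pt X x \<in> U'} = {x \<in> reps_over K X. \<exists>p\<in>P'. p x \<noteq> 0}"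
      using U' unfolding is_zariski_open_def by blast
    define Q where "Q = {\<lambda>x. p x * q x | p q. p \<in> P \<and> q \<in> P'}"
    have "Q \<subseteq> polyfun K (coords X)"
      using P(1) P'(1) by (auto simp: Q_def intro!: polyfun.mult)
    moreover have "{x \<in> reps_over K X. pt X x \<in> U \<inter> U'} =
        {x \<in> reps_over K X. \<exists>q\<in>Q. q x \<noteq> 0}" (is "?L = ?R")
    proof (rule Set.set_eqI)
      fix x
      have "x \<in> ?L \<longleftrightarrow> x \<in> {x \<in> reps_over K X. pt X x \<in> U} \<and> x \<in> {x \<in> reps_over K X. pt X x \<in> U'}"
        by auto
      also have "\<dots> \<longleftrightarrow> x \<in> reps_over K X \<and> (\<exists>p\<in>P. p x \<noteq> 0) \<and> (\<exists>p\<in>P'. p x \<noteq> 0)"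
        unfolding P(2) P'(2) by auto
      also have "\<dots> \<longleftrightarrow> x \<in> ?R"
        by (fastforce simp: Q_def)
      finally show "x \<in> ?L \<longleftrightarrow> x \<in> ?R" .
    qed
    moreover have "U \<inter> U' \<subseteq> points_over K X"
      using U unfolding is_zariski_open_def by blast
    ultimately show ?thesis unfolding is_zariski_open_def by blast
  qed
  have union: "is_zariski_open K X (\<Union>\<U>)" if "\<forall>U\<in>\<U>. is_zariski_open K X U" for \<U>
  proof -
    have "\<forall>U\<in>\<U>. \<exists>P. P \<subseteq> polyfun K (coords X) \<and>
        {x \<in> reps_over K X. pt X x \<in> U} = {x \<in> reps_over K X. \<exists>p\<in>P. p x \<noteq> 0}"
      using that unfolding is_zariski_open_def by blast
    from bchoice[OF this] obtain P where P': "\<forall>U\<in>\<U>. P U \<subseteq> polyfun K (coords X) \<and>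
        {x \<in> reps_over K X. pt X x \<in> U} = {x \<in> reps_over K X. \<exists>p\<in>P U. p x \<noteq> 0}" ..
    have P: "P U \<subseteq> polyfun K (coords X)"
      "{x \<in> reps_over K X. pt X x \<in> U} = {x \<in> reps_over K X. \<exists>p\<in>P U. p x \<noteq> 0}"
      if "U \<in> \<U>" for U
      using bspec[OF P' that] by simp_all
    have "{x \<in> reps_over K X. pt X x \<in> \<Union>\<U>} = (\<Union>U\<in>\<U>. {x \<in> reps_over K X. pt X x \<in> U})"
      by auto
    also have "\<dots> = (\<Union>U\<in>\<U>. {x \<in> reps_over K X. \<exists>p\<in>P U. p x \<noteq> 0})"
      using P(2) by simp
    also have "\<dots> = {x \<in> reps_over K X. \<exists>p\<in>(\<Union>U\<in>\<U>. P U). p x \<noteq> 0}"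
      by auto
    finally have "{x \<in> reps_over K X. pt X x \<in> \<Union>\<U>} =
        {x \<in> reps_over K X. \<exists>p\<in>(\<Union>U\<in>\<U>. P U). p x \<noteq> 0}" .
    moreover have "(\<Union>U\<in>\<U>. P U) \<subseteq> polyfun K (coords X)" using P(1) by auto
    moreover have "\<Union>\<U> \<subseteq> points_over K X"
      using that unfolding is_zariski_open_def by blast
    ultimately show ?thesis unfolding is_zariski_open_def by blast
  qed
  show ?thesis unfolding istopology_def using inter union by blast
qed

lemma openin_zariski: "openin (zariski K X) U \<longleftrightarrow> is_zariski_open K X U"
  by (simp add: zariski_def istopology_zariski)

lemma topspace_zariski:
  assumes "1 \<in> K" shows "topspace (zariski K X) = points_over K X"
proof
  show "topspace (zariski K X) \<subseteq> points_over K X"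
    using openin_topspace[of "zariski K X"] unfolding openin_zariski is_zariski_open_def by blast
  have "{x \<in> reps_over K X. pt X x \<in> points_over K X} =
      {x \<in> reps_over K X. \<exists>p\<in>{\<lambda>_. 1 :: complex}. p x \<noteq> 0}"
    by (auto simp: points_over_def)
  moreover have "{\<lambda>_. 1 :: complex} \<subseteq> polyfun K (coords X)" using assms by (auto intro: polyfun.const)
  ultimately have "is_zariski_open K X (points_over K X)"
    unfolding is_zariski_open_def by blast
  then show "points_over K X \<subseteq> topspace (zariski K X)"
    by (intro openin_subset) (simp add: openin_zariski)
qed

lemma lex_pos_append:
  "length ds = length is \<Longrightarrow>
   lex_pos (ds @ es) (is @ js) = lex_pos ds is * prod_list es + lex_pos es js"
  by (induction ds "is" rule: lex_pos.induct) (auto simp: algebra_simps)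

lemma lex_pos_less:
  "list_all2 (<) is ds \<Longrightarrow> lex_pos ds is < prod_list ds"
proof (induction rule: list_all2_induct)
  case (Cons i "is" d ds)
  have "lex_pos (d # ds) (i # is) < Suc i * prod_list ds" using Cons by simp
  also have "\<dots> \<le> d * prod_list ds" using Cons by (intro mult_right_mono) auto
  finally show ?case by simp
qed auto

lemma flattening_entry:
  assumes "i < n" "list_all2 (<) is (map k [0..<Suc i])" "list_all2 (<) js (map k [Suc i..<Suc n])"
  shows "flattening n k i \<psi> $$ (lex_pos (map k [0..<Suc i]) is, lex_pos (map k [Suc i..<Suc n]) js)
         = \<psi> $ lex_pos (map k [0..<Suc n]) (is @ js)"
proof -
  have prod: "prod_list (map k [a..<Suc b]) = (\<Prod>j=a..b. k j)" for a b
    using prod.distinct_set_conv_list[of "[a..<Suc b]" k]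
    by (simp only: distinct_upt set_upt atLeastLessThanSuc_atLeastAtMost)
  have "[0..<Suc n] = [0..<Suc i] @ [Suc i..<Suc n]"
    using upt_add_eq_append[of 0 "Suc i" "n - i"] assms(1) by simp
  then have eq: "map k [0..<Suc n] = map k [0..<Suc i] @ map k [Suc i..<Suc n]"
    by (simp only: map_append)
  have len: "length (map k [0..<Suc i]) = length is"
    using list_all2_lengthD[OF assms(2)] by simp
  show ?thesis
    using lex_pos_less[OF assms(2)] lex_pos_less[OF assms(3)]
    unfolding eq lex_pos_append[OF len] flattening_def unfold_vec_def prod by simp
qed

lemma col_space_in_grassmannian:
  assumes "A \<in> carrier_mat m q" "vec_space.rank m A = q"
  shows "vec_space.col_space m A \<in> grassmannian q m"
proof -
  interpret vec_space "TYPE(complex)" m .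
  have "set (cols A) \<subseteq> carrier_vec m" using assms(1) cols_dim by blast
  then show ?thesis
    using assms(2) span_is_subspace[of "set (cols A)"]
    by (simp add: grassmannian_def col_space_def rank_def)
qed

lemma grassmannian_basis:
  assumes "S \<in> grassmannian q m"
  shows "\<exists>A \<in> carrier_mat m q. vec_space.rank m A = q \<and> vec_space.col_space m A = S"
proof -
  interpret vec_space "TYPE(complex)" m .
  have sub: "VectorSpace.subspace class_ring S V"
    and dim: "vectorspace.dim class_ring (vs S) = q"
    using assms by (auto simp: grassmannian_def)
  have subm: "submodule class_ring S V" using sub by (simp add: VectorSpace.subspace_def)
  have SV: "S \<subseteq> carrier_vec m" using subm by (auto simp: submodule_def)
  have "\<exists>B. finite B \<and> maximal B (\<lambda>T. T \<subseteq> S \<and> lin_indpt T)"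
  proof (rule maximal_exists)
    fix T assume "T \<subseteq> S \<and> lin_indpt T"
    then show "finite T \<and> card T \<le> m"
      using SV fin_dim_li_fin[of T] li_le_dim[of T] fin_dim dim_is_n by auto
  next
    show "{} \<subseteq> S \<and> lin_indpt {}" by (simp add: lin_dep_def)
  qed
  then obtain B where fin: "finite B" and max: "maximal B (\<lambda>T. T \<subseteq> S \<and> lin_indpt T)" by blast
  have BS: "B \<subseteq> S" and indpt: "lin_indpt B" using max by (auto simp: maximal_def)
  have BV: "B \<subseteq> carrier_vec m" using BS SV by blast
  have "S \<subseteq> span B"
  proof
    fix v assume v: "v \<in> S"
    show "v \<in> span B"
    proof (cases "v \<in> B")
      case True then show ?thesis using BV by (simp add: span_mem)
    next
      case False
      have "lin_dep (B \<union> {v})"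
      proof (rule ccontr)
        assume "\<not> lin_dep (B \<union> {v})"
        then have "B \<union> {v} = B" using max v BS unfolding maximal_def by blast
        then show False using False by blast
      qed
      then show ?thesis using lin_dep_iff_in_span[of B v] BV indpt v SV False by auto
    qed
  qed
  moreover have "span B \<subseteq> S" using span_is_subset[OF BS subm] by simp
  ultimately have spanB: "span B = S" by blast
  obtain ws where ws: "set ws = B" "distinct ws" using finite_distinct_list[OF fin] by blast
  define A where "A = mat_of_cols m ws"
  have cols: "cols A = ws" using ws BV by (simp add: A_def)
  have A: "A \<in> carrier_mat m (length ws)" by (simp add: A_def)
  have "rank A = length ws" using lin_indpt_full_rank[OF A] cols ws indpt by simp
  moreover have "rank A = q" using dim by (simp add: rank_def cols ws spanB)
  moreover have "col_space A = S" by (simp add: col_space_def cols ws spanB)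
  ultimately show ?thesis using A by auto
qed

lemma points_over_param_space: "points_over UNIV (param_space n k r) = tt_parameters n k r"
proof
  show "points_over UNIV (param_space n k r) \<subseteq> tt_parameters n k r"
  proof
    fix z assume "z \<in> points_over UNIV (param_space n k r)"
    then obtain A where A: "A \<in> reps (param_space n k r)" and z: "z = pt (param_space n k r) A"
      by (auto simp: points_over_def reps_over_def)
    have "vec_space.col_space (r (i - 1) * k (i - 1)) (A (i - 1))
        \<in> grassmannian (r i) (r (i - 1) * k (i - 1))" if "i \<in> {1..n}" for i
    proof -
      have "i - 1 < n" "Suc (i - 1) = i" using that by auto
      then have "A (i - 1) \<in> carrier_mat (r (i - 1) * k (i - 1)) (r i)"
        "vec_space.rank (r (i - 1) * k (i - 1)) (A (i - 1)) = r i"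
        using A unfolding param_space_def by (auto dest: spec[of _ "i - 1"])
      then show ?thesis by (rule col_space_in_grassmannian)
    qed
    then show "z \<in> tt_parameters n k r"
      using A by (auto simp: z param_space_def tt_parameters_def)
  qed
  show "tt_parameters n k r \<subseteq> points_over UNIV (param_space n k r)"
  proof
    fix z assume "z \<in> tt_parameters n k r"
    then obtain S B where z: "z = (S, proj_mat B)"
      and S: "S \<in> (\<Pi>\<^sub>E i\<in>{1..n}. grassmannian (r i) (r (i - 1) * k (i - 1)))"
      and B: "B \<in> carrier_mat (r n) (k n) - {0\<^sub>m (r n) (k n)}"
      by (auto simp: tt_parameters_def)
    have "\<forall>i. \<exists>A. i < n \<longrightarrow> A \<in> carrier_mat (r i * k i) (r (Suc i)) \<and>
        vec_space.rank (r i * k i) A = r (Suc i) \<and> vec_space.col_space (r i * k i) A = S (Suc i)"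
    proof
      fix i
      show "\<exists>A. i < n \<longrightarrow> A \<in> carrier_mat (r i * k i) (r (Suc i)) \<and>
        vec_space.rank (r i * k i) A = r (Suc i) \<and> vec_space.col_space (r i * k i) A = S (Suc i)"
      proof (cases "i < n")
        case True
        then have "S (Suc i) \<in> grassmannian (r (Suc i)) (r i * k i)"
          using PiE_mem[OF S, of "Suc i"] by simp
        then show ?thesis using grassmannian_basis by blast
      qed simp
    qed
    from choice[OF this] obtain A where A: "\<And>i. i < n \<Longrightarrow> A i \<in> carrier_mat (r i * k i) (r (Suc i)) \<and>
        vec_space.rank (r i * k i) (A i) = r (Suc i) \<and> vec_space.col_space (r i * k i) (A i) = S (Suc i)"
      by blast
    have "(\<lambda>i\<in>{1..n}. vec_space.col_space (r (i - 1) * k (i - 1)) ((A(n := B)) (i - 1))) = S"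
    proof
      fix i
      show "(\<lambda>i\<in>{1..n}. vec_space.col_space (r (i - 1) * k (i - 1)) ((A(n := B)) (i - 1))) i = S i"
      proof (cases "i \<in> {1..n}")
        case True
        then have "i - 1 < n" "Suc (i - 1) = i" by auto
        then show ?thesis using True A[of "i - 1"] by auto
      next
        case False
        then show ?thesis using PiE_arb[OF S False] by (simp only: restrict_apply if_False)
      qed
    qed
    then have "z = pt (param_space n k r) (A(n := B))"
      by (simp add: z param_space_def)
    moreover have "A(n := B) \<in> reps_over UNIV (param_space n k r)"
      using A B by (auto simp: reps_over_def param_space_def)
    ultimately show "z \<in> points_over UNIV (param_space n k r)"
      by (auto simp: points_over_def)
  qed
qed

end

theory Submission
  imports Defs "Jordan_Normal_Form.Schur_Decomposition"
begin

text \<open>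
  The matrices \<open>R\<^sub>i\<close> of the factorization algorithm consist of rows of the flattenings of \<open>\<psi>\<close>. Hence a
  tensor of the variety lies in \<open>tt_open\<close> iff all \<open>R\<^sub>i\<close> have full row rank, which is an open condition in
  the coordinates of \<open>\<psi>\<close>. If the top blocks of the \<open>X\<^sub>i\<close> are identity matrices, the factorization
  algorithm recovers the \<open>R\<^sub>i\<close> of the decompression algorithm, and full row rank of \<open>R\<^sub>i\<close> allows one to
  solve \<open>\<psi>\<^sup>i = X\<^sub>i R\<^sub>i\<close> for \<open>X\<^sub>i\<close>; this gives bijectivity. If \<open>R\<^sub>i Q\<close> is invertible, then \<open>\<psi>\<^sup>i Q\<close> has the same
  column space as \<open>X\<^sub>i\<close>, so that the inverse map is regular.

  For the density statements, every tensor of the variety is the decompression of some matrices of the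
  right sizes with entries in the same field, by rank factorizations of its flattenings. So both the
  parameter space and the variety are dominated by an affine space, and there two polynomials that do not vanish
  identically have a common point of nonvanishing on a line. Generic matrices decompress to points of
  \<open>tt_open\<close>: the inequalities \<open>r\<^sub>i \<le> r\<^bsub>i+1\<^esub> k\<^sub>i\<close> make the side unfoldings of the \<open>X\<^sub>i\<close>, and hence the \<open>R\<^sub>i\<close>, of
  full row rank.
\<close>

section \<open>Matrices over subfields of the complex numbers\<close>

text \<open>One argument has to serve two fields. Everything takes place among complex matrices,
  with a set \<open>K\<close> of allowed entries that is \<open>UNIV\<close> or
  \<open>\<real>\<close>; ranks remain complex ranks, and witnesses with entries in \<open>K\<close>
  are produced by taking real parts. Full row rank is handled as existence of a right inverse,
  because it then reads \<open>det (M * Q) \<noteq> 0\<close> for some constant \<open>Q\<close>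
  over \<open>K\<close>: such determinants describe the open sets, and the same \<open>Q\<close>
  supplies the formula for the inverse map on each of them.

  Polynomial functions are functions on a whole type, where matrices of wrong sizes occur, and they
  have no denominators. Hence tuples and vectors are cut to size before use, and normal forms are
  replaced by multiples that are obtained from adjugates; the scalars disappear in projective space.

  The affine space in the density arguments consists of all tuples of matrices of the right sizes. A
  line between two representatives may leave the representatives, and decompositions of tensors
  whose flattenings drop rank need not be normalized.\<close>

definition mat_over :: "complex set \<Rightarrow> complex mat \<Rightarrow> bool" where
  "mat_over K M \<longleftrightarrow> (\<forall>i<dim_row M. \<forall>j<dim_col M. M $$ (i, j) \<in> K)"

text \<open>Beyond closure under the field operations, the two cases matter in
  \<open>solve_over\<close>, where the real part serves as a retraction onto the real
  numbers.\<close>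

locale scalars =
  fixes K :: "complex set"
  assumes K: "K = UNIV \<or> K = \<real>"
begin

lemma K_simps [simp, intro]:
  "0 \<in> K" "1 \<in> K" "of_nat m \<in> K" "x \<in> K \<Longrightarrow> y \<in> K \<Longrightarrow> x + y \<in> K"
  "x \<in> K \<Longrightarrow> y \<in> K \<Longrightarrow> x * y \<in> K" "x \<in> K \<Longrightarrow> - x \<in> K"
  "x \<in> K \<Longrightarrow> y \<in> K \<Longrightarrow> x - y \<in> K" "x \<in> K \<Longrightarrow> inverse x \<in> K"
  using K by auto

lemma K_sum: "(\<And>i. i \<in> I \<Longrightarrow> f i \<in> K) \<Longrightarrow> sum f I \<in> K"
  using K by (auto intro: sum_in_Reals)

lemma mat_over_one [simp, intro]: "mat_over K (1\<^sub>m q)"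
  by (simp add: mat_over_def)

lemma mat_over_mult:
  assumes "mat_over K A" "mat_over K B" "dim_col A = dim_row B"
  shows "mat_over K (A * B)"
  using assms by (auto simp: mat_over_def scalar_prod_def intro!: K_sum)

text \<open>The real part is linear over the real numbers and fixes them. If \<open>M\<close> and
  \<open>N\<close> are real, taking real parts of all entries therefore turns a complex solution
  into a real one.\<close>

lemma solve_over:
  assumes M: "M \<in> carrier_mat a b" "mat_over K M" and N: "N \<in> carrier_mat a c" "mat_over K N"
    and Q: "Q \<in> carrier_mat b c" and eq: "M * Q = N"
  shows "\<exists>Q'\<in>carrier_mat b c. mat_over K Q' \<and> M * Q' = N"
  using K
proof
  assume "K = UNIV" then show ?thesis using Q eq by (auto simp: mat_over_def)
next
  assume KR: "K = \<real>"
  define Q' where "Q' = map_mat (\<lambda>z. complex_of_real (Re z)) Q"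
  have "M * Q' = N"
  proof (rule eq_matI)
    fix i j assume "i < dim_row N" "j < dim_col N"
    then have ij: "i < a" "j < c" using N by auto
    have real: "M $$ (i, l) = of_real (Re (M $$ (i, l)))" if "l < b" for l
      using M ij that KR by (auto simp: mat_over_def)
    have "N $$ (i, j) = (\<Sum>l = 0..<b. M $$ (i, l) * Q $$ (l, j))"
      using M Q ij unfolding eq[symmetric] by (simp add: scalar_prod_def)
    also have "\<dots> = (\<Sum>l = 0..<b. of_real (Re (M $$ (i, l))) * Q $$ (l, j))"
      using real by (intro sum.cong) auto
    finally have sum: "N $$ (i, j) = (\<Sum>l = 0..<b. of_real (Re (M $$ (i, l))) * Q $$ (l, j))" .
    have "N $$ (i, j) \<in> \<real>" using N ij KR by (auto simp: mat_over_def)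
    then have "N $$ (i, j) = of_real (Re (N $$ (i, j)))" by simp
    also have "\<dots> = (\<Sum>l = 0..<b. of_real (Re (M $$ (i, l))) * of_real (Re (Q $$ (l, j))))"
      unfolding sum by simp
    also have "\<dots> = (\<Sum>l = 0..<b. M $$ (i, l) * of_real (Re (Q $$ (l, j))))"
      using real by (intro sum.cong) auto
    also have "\<dots> = (M * Q') $$ (i, j)"
      using M Q ij by (simp add: scalar_prod_def Q'_def)
    finally show "(M * Q') $$ (i, j) = N $$ (i, j)" by simp
  qed (use M N Q in \<open>auto simp: Q'_def\<close>)
  then show ?thesis using Q by (auto simp: Q'_def KR mat_over_def intro!: bexI[of _ Q'])
qed

lemma solve_over_left:
  assumes M: "M \<in> carrier_mat a b" "mat_over K M" and N: "N \<in> carrier_mat c b" "mat_over K N"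
    and Q: "Q \<in> carrier_mat c a" and eq: "Q * M = N"
  shows "\<exists>Q'\<in>carrier_mat c a. mat_over K Q' \<and> Q' * M = N"
proof -
  have MT: "transpose_mat M \<in> carrier_mat b a" "mat_over K (transpose_mat M)"
    and NT: "transpose_mat N \<in> carrier_mat b c" "mat_over K (transpose_mat N)"
    using M N by (simp_all add: mat_over_def)
  have "\<exists>Q'\<in>carrier_mat a c. mat_over K Q' \<and> transpose_mat M * Q' = transpose_mat N"
    by (rule solve_over[OF MT NT, of "transpose_mat Q"])
      (use Q transpose_mult[OF Q M(1)] eq in simp_all)
  then obtain Q' where Q': "Q' \<in> carrier_mat a c" "mat_over K Q'" "transpose_mat M * Q' = transpose_mat N"
    by blast
  have "transpose_mat Q' * M = N"
    using transpose_mult[OF MT(1) Q'(1)] Q'(3) by simp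
  then show ?thesis using Q' by (intro bexI[of _ "transpose_mat Q'"]) (auto simp: mat_over_def)
qed

end

section \<open>Rank of complex matrices through one-sided inverses\<close>

lemma left_inverse_of_inj:
  fixes C :: "complex mat"
  assumes C: "C \<in> carrier_mat m q"
    and inj: "\<And>v. v \<in> carrier_vec q \<Longrightarrow> C *\<^sub>v v = 0\<^sub>v m \<Longrightarrow> v = 0\<^sub>v q"
  shows "\<exists>L\<in>carrier_mat q m. L * C = 1\<^sub>m q"
proof -
  \<comment> \<open>Gram matrix argument: if \<open>H * C\<close> kills \<open>v\<close>, then
    \<open>w = C *\<^sub>v v\<close> satisfies \<open>w \<bullet>c w = 0\<close>, so already
    \<open>C\<close> kills \<open>v\<close>. The inverse of \<open>H * C\<close>, multiplied by
    \<open>H\<close>, is the left inverse sought.\<close>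
  define H where "H = mat_adjoint C"
  have H: "H \<in> carrier_mat q m" using C by (auto simp: H_def mat_adjoint_def)
  have HC: "H * C \<in> carrier_mat q q" using H C by auto
  have "det (H * C) \<noteq> 0"
  proof
    assume "det (H * C) = 0"
    then obtain v where v: "v \<in> carrier_vec q" "v \<noteq> 0\<^sub>v q" "(H * C) *\<^sub>v v = 0\<^sub>v q"
      using det_0_iff_vec_prod_zero_field[OF HC] by blast
    define w where "w = C *\<^sub>v v"
    have w: "w \<in> carrier_vec m" using C v by (auto simp: w_def)
    have Hw: "H *\<^sub>v w = 0\<^sub>v q" using v H C by (simp add: w_def)
    have "w \<bullet>c w = 0"
    proof -
      have "w \<bullet>c w = (\<Sum>i=0..<m. (\<Sum>j=0..<q. C $$ (i,j) * v $ j) * conjugate (w $ i))"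
        using w C v by (simp add: scalar_prod_def w_def)
      also have "\<dots> = (\<Sum>i=0..<m. \<Sum>j=0..<q. v $ j * (C $$ (i,j) * conjugate (w $ i)))"
        by (simp add: sum_distrib_left sum_distrib_right mult_ac)
      also have "\<dots> = (\<Sum>j=0..<q. v $ j * (\<Sum>i=0..<m. C $$ (i,j) * conjugate (w $ i)))"
        by (subst sum.swap) (simp add: sum_distrib_left)
      also have "\<dots> = (\<Sum>j=0..<q. v $ j * conjugate ((H *\<^sub>v w) $ j))"
      proof (rule sum.cong)
        fix j assume "j \<in> {0..<q}"
        then have "(H *\<^sub>v w) $ j = (\<Sum>i=0..<m. conjugate (C $$ (i,j)) * w $ i)"
          using H C w by (simp add: scalar_prod_def H_def mat_adjoint_def mat_of_rows_index)
        then show "v $ j * (\<Sum>i=0..<m. C $$ (i,j) * conjugate (w $ i)) = v $ j * conjugate ((H *\<^sub>v w) $ j)"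
          by simp
      qed simp
      also have "\<dots> = 0" unfolding Hw by simp
      finally show ?thesis .
    qed
    then have "w = 0\<^sub>v m" using conjugate_square_eq_0_vec[OF w] by simp
    then show False using inj[OF v(1)] v(2) by (simp add: w_def)
  qed
  then obtain Z where Z: "Z \<in> carrier_mat q q" "Z * (H * C) = 1\<^sub>m q"
    using det_non_zero_imp_unit[OF HC, of undefined] 
    by (auto simp: Units_def ring_mat_def)
  have "(Z * H) * C = 1\<^sub>m q" using Z H C by (simp add: assoc_mult_mat[of _ q q _ m _ q])
  then show ?thesis using Z H by (intro bexI[of _ "Z * H"]) auto
qed

lemma factor_through_col_space:
  fixes A B :: "complex mat"
  assumes A: "A \<in> carrier_mat m q" and B: "B \<in> carrier_mat m c"
    and sub: "set (cols B) \<subseteq> vec_space.col_space m A"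
  shows "\<exists>T\<in>carrier_mat q c. B = A * T"
proof -
  have "\<exists>x\<in>carrier_vec q. A *\<^sub>v x = col B j" if "j < c" for j
  proof -
    have "col B j \<in> set (cols B)" using that B by (simp add: cols_def)
    then show ?thesis using sub A by (auto simp: vec_space.col_space_eq[OF A])
  qed
  then obtain x where x: "\<And>j. j < c \<Longrightarrow> x j \<in> carrier_vec q \<and> A *\<^sub>v x j = col B j" by metis
  define T where "T = mat q c (\<lambda>(i, j). x j $ i)"
  have "B = A * T"
  proof (rule mat_col_eqI)
    fix j assume "j < dim_col (A * T)"
    then have j: "j < c" by (simp add: T_def)
    then have "col T j = x j" using x[OF j] by (auto simp: T_def)
    then have "col (A * T) j = A *\<^sub>v x j" using A j by (subst col_mult2[of _ m q _ c]) (auto simp: T_def)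
    then show "col B j = col (A * T) j" using x[OF j] by simp
  qed (use A B in \<open>auto simp: T_def\<close>)
  then show ?thesis by (auto simp: T_def intro!: bexI[of _ T])
qed

lemma col_space_mult_subset:
  fixes A T :: "complex mat"
  assumes A: "A \<in> carrier_mat m q" and T: "T \<in> carrier_mat q c"
  shows "vec_space.col_space m (A * T) \<subseteq> vec_space.col_space m A"
proof -
  have AT: "A * T \<in> carrier_mat m c" using A T by auto
  show ?thesis unfolding vec_space.col_space_eq[OF A] vec_space.col_space_eq[OF AT]
    using A T by (auto intro!: bexI[of _ "T *\<^sub>v _"] simp: assoc_mult_mat_vec[OF A T])
qed

lemma cols_subset_col_space:
  fixes A :: "complex mat"
  assumes A: "A \<in> carrier_mat m q"
  shows "set (cols A) \<subseteq> vec_space.col_space m A"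
proof -
  interpret vec_space "TYPE(complex)" m .
  show ?thesis using A cols_dim[of A] unfolding col_space_def
    by (metis in_own_span carrier_matD(1) module_vec_simps(3))
qed

text \<open>Padded with zeros to size \<open>d\<close>, the factors would still be one-sided
  inverses if \<open>q < d\<close>, and for square matrices one-sided inverses are two-sided. But
  the padded \<open>V\<close> has a zero row, which the product in the other order inherits.\<close>

lemma left_inverse_card_le:
  fixes U V :: "complex mat"
  assumes U: "U \<in> carrier_mat d q" and V: "V \<in> carrier_mat q d" and UV: "U * V = 1\<^sub>m d"
  shows "d \<le> q"
proof (rule ccontr)
  assume "\<not> d \<le> q"
  then have q: "q < d" by simp
  define U' where "U' = mat d d (\<lambda>(i,j). if j < q then U $$ (i,j) else 0)"
  define V' where "V' = mat d d (\<lambda>(i,j). if i < q then V $$ (i,j) else 0)"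
  have "U' * V' = 1\<^sub>m d"
  proof (rule eq_matI)
    fix i j assume "i < dim_row (1\<^sub>m d :: complex mat)" "j < dim_col (1\<^sub>m d :: complex mat)"
    then have ij: "i < d" "j < d" by auto
    have "(U' * V') $$ (i, j) = (\<Sum>l=0..<d. if l < q then U $$ (i,l) * V $$ (l,j) else 0)"
      using ij by (auto simp: U'_def V'_def scalar_prod_def intro!: sum.cong)
    also have "\<dots> = (\<Sum>l=0..<q. U $$ (i,l) * V $$ (l,j))"
      using q by (intro sum.mono_neutral_cong_right) auto
    also have "\<dots> = (U * V) $$ (i, j)" using ij U V by (simp add: scalar_prod_def)
    finally show "(U' * V') $$ (i, j) = 1\<^sub>m d $$ (i, j)" by (simp add: UV)
  qed (auto simp: U'_def V'_def)
  then have "V' * U' = 1\<^sub>m d" by (rule mat_mult_left_right_inverse[rotated 2]) (auto simp: U'_def V'_def)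
  then have "(V' * U') $$ (q, q) = 1" using q by simp
  moreover have "(V' * U') $$ (q, q) = 0" using q by (simp add: scalar_prod_def U'_def V'_def)
  ultimately show False by simp
qed

context scalars
begin

text \<open>\<open>S\<close> selects a maximal independent set of columns of \<open>M\<close>, and
  \<open>P\<close> is a left inverse of the selected block \<open>M * S\<close>, which has entries
  in \<open>K\<close> because it consists of columns of \<open>M\<close>. All columns are
  combinations of the selected ones, say \<open>M = (M * S) * R\<close>, and multiplication by
  \<open>P\<close> identifies \<open>R\<close> as \<open>P * M\<close>. The last equation is thus a
  factorization whose inner dimension is the rank.\<close>

lemma rank_decomposition:
  assumes M: "M \<in> carrier_mat a b" "mat_over K M" and d: "d = vec_space.rank a M"
  shows "\<exists>P\<in>carrier_mat d a. \<exists>S\<in>carrier_mat b d. mat_over K P \<and> mat_over K S \<and>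
    P * M * S = 1\<^sub>m d \<and> M * S * (P * M) = M"
proof -
  interpret vec_space "TYPE(complex)" a .
  have colsM: "set (cols M) \<subseteq> carrier_vec a" using M cols_dim by blast
  obtain W where W: "finite W" "maximal W (\<lambda>T. T \<subseteq> set (cols M) \<and> lin_indpt T)"
    using maximal_exists_superset[of "set (cols M)" "\<lambda>T. T \<subseteq> set (cols M) \<and> lin_indpt T" "{}"]
    by (auto simp: lin_dep_def)
  have sub: "W \<subseteq> set (cols M)" and indpt: "lin_indpt W" using W by (auto simp: maximal_def)
  have WV: "W \<subseteq> carrier_vec a" using sub colsM by blast
  have cardW: "card W = d" using rank_card_indpt[OF M(1) W(2)] d by simp
  obtain ws where ws: "set ws = W" "distinct ws" using finite_distinct_list[OF W(1)] by blast
  have len: "length ws = d" using ws cardW distinct_card by fastforce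
  define C where "C = mat_of_cols a ws"
  have C: "C \<in> carrier_mat a d" using len by (simp add: C_def carrier_matI)
  have colsC: "cols C = ws" using ws WV by (simp add: C_def)
  have spanC: "col_space C = span W" by (simp add: col_space_def colsC ws)
  have "set (cols M) \<subseteq> col_space C"
  proof
    fix v assume v: "v \<in> set (cols M)"
    show "v \<in> col_space C"
    proof (cases "v \<in> W")
      case True then show ?thesis using WV by (simp add: span_mem spanC)
    next
      case False
      have "lin_dep (W \<union> {v})"
      proof (rule ccontr)
        assume "\<not> lin_dep (W \<union> {v})"
        then have "W \<union> {v} = W" using W(2) v sub unfolding maximal_def by blast
        then show False using False by blast
      qed
      then show ?thesis using lin_dep_iff_in_span[of W v] WV indpt v colsM False spanC by auto
    qed
  qed
  then obtain R where R: "R \<in> carrier_mat d b" "M = C * R"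
    using factor_through_col_space[OF C M(1)] by blast
  have "\<forall>j<d. \<exists>i<b. ws ! j = col M i"
    using sub ws len M by (metis carrier_matD(2) cols_length cols_nth in_set_conv_nth nth_mem subsetD)
  then obtain f where f: "\<And>j. j < d \<Longrightarrow> f j < b \<and> ws ! j = col M (f j)" by metis
  define S where "S = mat b d (\<lambda>(i, j). if i = f j then 1 else 0 :: complex)"
  have S: "S \<in> carrier_mat b d" "mat_over K S" by (auto simp: S_def mat_over_def)
  have CS: "C = M * S"
  proof (rule eq_matI)
    fix i j assume "i < dim_row (M * S)" "j < dim_col (M * S)"
    then have ij: "i < a" "j < d" using M by (auto simp: S_def)
    have "(M * S) $$ (i, j) = (\<Sum>l=0..<b. M $$ (i, l) * (if l = f j then 1 else 0))"
      using ij M by (simp add: scalar_prod_def S_def)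
    also have "\<dots> = M $$ (i, f j)" using f[OF ij(2)] by (simp add: if_distrib cong: if_cong)
    also have "\<dots> = C $$ (i, j)" using f[OF ij(2)] ij M len by (simp add: C_def mat_of_cols_index)
    finally show "C $$ (i, j) = (M * S) $$ (i, j)" ..
  qed (use C M S in auto)
  have "\<exists>L\<in>carrier_mat d a. L * C = 1\<^sub>m d"
  proof (rule left_inverse_of_inj[OF C])
    fix v :: "complex vec" assume v: "v \<in> carrier_vec d" "C *\<^sub>v v = 0\<^sub>v a"
    show "v = 0\<^sub>v d"
      using lin_depI[OF C v(1) _ v(2)] colsC ws indpt by auto
  qed
  moreover have "mat_over K C" unfolding CS by (rule mat_over_mult) (use M S in auto)
  ultimately obtain P where P: "P \<in> carrier_mat d a" "mat_over K P" "P * C = 1\<^sub>m d"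
    using solve_over_left[OF C _ one_carrier_mat mat_over_one] by blast
  have "P * M = R"
    unfolding R(2) using P(3) R(1) assoc_mult_mat[OF P(1) C R(1)] by simp
  moreover have "P * M * S = 1\<^sub>m d"
    using P(3) unfolding CS using assoc_mult_mat[OF P(1) M(1) S(1)] by simp
  moreover have "M * S * (P * M) = M" 
    unfolding \<open>P * M = R\<close> CS[symmetric] by (rule R(2)[symmetric])
  ultimately show ?thesis using P S by blast
qed

end

lemma rank_decomp:
  fixes M :: "complex mat"
  assumes "M \<in> carrier_mat a b"
  shows "\<exists>P\<in>carrier_mat (vec_space.rank a M) a. \<exists>S\<in>carrier_mat b (vec_space.rank a M).
    P * M * S = 1\<^sub>m (vec_space.rank a M) \<and> M * S * (P * M) = M"
proof -
  interpret scalars UNIV by unfold_locales simp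
  show ?thesis using rank_decomposition[OF assms _ refl] by (auto simp: mat_over_def)
qed

text \<open>The identity whose size is the rank of \<open>C * R\<close> factors through dimension
  \<open>q\<close>.\<close>

lemma rank_le_factor:
  fixes C R :: "complex mat"
  assumes C: "C \<in> carrier_mat a q" and R: "R \<in> carrier_mat q b"
  shows "vec_space.rank a (C * R) \<le> q"
proof -
  let ?d = "vec_space.rank a (C * R)"
  obtain P S where P: "P \<in> carrier_mat ?d a" and S: "S \<in> carrier_mat b ?d"
    and eq: "P * (C * R) * S = 1\<^sub>m ?d"
    using rank_decomp[of "C * R" a b] C R by auto
  have "(P * C) * (R * S) = 1\<^sub>m ?d"
    using eq assoc_mult_mat[OF P C R] assoc_mult_mat[of "P * C" ?d q R b S ?d] P C R S by simp
  then show ?thesis by (rule left_inverse_card_le[rotated 2]) (use P C R S in auto)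
qed

text \<open>\<open>M\<close> factors through a space whose dimension is its rank, and so does the
  identity of size \<open>q\<close>.\<close>

lemma rank_ge_unit:
  fixes M :: "complex mat"
  assumes M: "M \<in> carrier_mat a b" and P: "P \<in> carrier_mat q a" and S: "S \<in> carrier_mat b q"
    and eq: "P * M * S = 1\<^sub>m q"
  shows "q \<le> vec_space.rank a M"
proof -
  let ?d = "vec_space.rank a M"
  obtain P' S' where P': "P' \<in> carrier_mat ?d a" and S': "S' \<in> carrier_mat b ?d"
    and eq': "M * S' * (P' * M) = M"
    using rank_decomp[OF M] by auto
  have "(P * (M * S')) * (P' * M * S) = P * (M * S') * (P' * M) * S"
    using P P' S S' M by (intro assoc_mult_mat[symmetric]) auto
  also have "P * (M * S') * (P' * M) = P * (M * S' * (P' * M))"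
    using P P' S S' M by (intro assoc_mult_mat) auto
  finally have "(P * (M * S')) * (P' * M * S) = P * (M * S' * (P' * M)) * S" .
  then have "(P * (M * S')) * (P' * M * S) = 1\<^sub>m q" using eq eq' by simp
  then show ?thesis by (rule left_inverse_card_le[rotated 2]) (use P P' S S' M in auto)
qed

lemma full_rank_iff_left_inverse:
  fixes M :: "complex mat"
  assumes M: "M \<in> carrier_mat m q"
  shows "vec_space.rank m M = q \<longleftrightarrow> (\<exists>L\<in>carrier_mat q m. L * M = 1\<^sub>m q)"
proof
  assume rk: "vec_space.rank m M = q"
  obtain P S where P: "P \<in> carrier_mat q m" and S: "S \<in> carrier_mat q q" and eq: "(P * M) * S = 1\<^sub>m q"
    using rank_decomp[OF M] unfolding rk by blast
  have "S * (P * M) = 1\<^sub>m q" by (rule mat_mult_left_right_inverse[OF _ S eq]) (use P M in auto)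
  then show "\<exists>L\<in>carrier_mat q m. L * M = 1\<^sub>m q"
    using P S M by (intro bexI[of _ "S * P"]) (auto simp: assoc_mult_mat[of _ q q _ m _ q])
next
  assume "\<exists>L\<in>carrier_mat q m. L * M = 1\<^sub>m q"
  then obtain L where L: "L \<in> carrier_mat q m" "L * M = 1\<^sub>m q" by blast
  have "q \<le> vec_space.rank m M"
    using rank_ge_unit[OF M L(1), of "1\<^sub>m q"] L M by simp
  moreover have "vec_space.rank m M \<le> q" using M by (rule vec_space.rank_le_nc)
  ultimately show "vec_space.rank m M = q" by simp
qed

section \<open>Full row rank, first rows, and normal forms in the chart of the Grassmannian\<close>

definition right_invertible :: "complex mat \<Rightarrow> bool" where
  "right_invertible M \<longleftrightarrow> (\<exists>Q\<in>carrier_mat (dim_col M) (dim_row M). M * Q = 1\<^sub>m (dim_row M))"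

lemma right_invertible_iff:
  assumes "M \<in> carrier_mat q m"
  shows "right_invertible M \<longleftrightarrow> (\<exists>Q\<in>carrier_mat m q. M * Q = 1\<^sub>m q)"
  using assms by (auto simp: right_invertible_def)

lemma full_row_rank_iff_right_invertible:
  assumes M: "M \<in> carrier_mat q m"
  shows "vec_space.rank q M = q \<longleftrightarrow> right_invertible M"
proof
  assume rk: "vec_space.rank q M = q"
  obtain P S where P: "P \<in> carrier_mat q q" and S: "S \<in> carrier_mat m q" and eq: "P * M * S = 1\<^sub>m q"
    using rank_decomp[OF M] unfolding rk by blast
  have "P * (M * S) = 1\<^sub>m q" using eq P S M by (simp add: assoc_mult_mat[of _ q q _ m _ q])
  then have "(M * S) * P = 1\<^sub>m q" by (rule mat_mult_left_right_inverse[rotated 2]) (use P S M in auto)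
  then show "right_invertible M"
    unfolding right_invertible_iff[OF M] using P S M
    by (intro bexI[of _ "S * P"]) (auto simp: assoc_mult_mat[of _ q m _ q _ q])
next
  assume "right_invertible M"
  then obtain Q where Q: "Q \<in> carrier_mat m q" "M * Q = 1\<^sub>m q" using right_invertible_iff[OF M] by blast
  have "q \<le> vec_space.rank q M"
    using rank_ge_unit[OF M one_carrier_mat Q(1)] Q M by simp
  moreover have "vec_space.rank q M \<le> q"
    using rank_le_factor[OF one_carrier_mat M] M by simp
  ultimately show "vec_space.rank q M = q" by simp
qed

definition top_rows :: "nat \<Rightarrow> complex mat \<Rightarrow> complex mat" where
  "top_rows q M = mat q (dim_col M) (\<lambda>ab. M $$ ab)"

lemma top_rows_carrier [simp]: "M \<in> carrier_mat m c \<Longrightarrow> top_rows q M \<in> carrier_mat q c"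
  by (auto simp: top_rows_def)

lemma top_rows_mult:
  assumes "A \<in> carrier_mat m q" "B \<in> carrier_mat q c" "p \<le> m"
  shows "top_rows p (A * B) = top_rows p A * B"
  using assms by (intro eq_matI) (auto simp: top_rows_def scalar_prod_def)

text \<open>Transposition turns rows into columns: the transpose has rank \<open>q\<close> iff its
  \<open>q\<close> columns are distinct and independent, and its left inverses are the transposes of
  right inverses.\<close>

lemma lin_indpt_first_rows_iff:
  assumes M: "M \<in> carrier_mat m c" and q: "q \<le> m"
  shows "lin_indpt_first_rows q M \<longleftrightarrow> right_invertible (top_rows q M)"
proof -
  interpret vec_space "TYPE(complex)" c .
  define N where "N = transpose_mat (top_rows q M)"
  have top: "top_rows q M \<in> carrier_mat q c" using M by simp
  have N: "N \<in> carrier_mat c q" using top by (simp add: N_def)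
  have "rows (top_rows q M) = take q (rows M)"
    using M q by (intro nth_equalityI) (auto simp: top_rows_def intro!: eq_vecI)
  then have cols: "cols N = take q (rows M)" by (simp add: N_def)
  have "rank N = q \<longleftrightarrow> distinct (cols N) \<and> lin_indpt (set (cols N))"
  proof
    assume rk: "rank N = q"
    obtain U where U: "maximal U (\<lambda>T. T \<subseteq> set (cols N) \<and> lin_indpt T)"
      using maximal_exists_superset[of "set (cols N)" "\<lambda>T. T \<subseteq> set (cols N) \<and> lin_indpt T" "{}"]
      by (auto simp: lin_dep_def)
    \<comment> \<open>An independent set with \<open>q\<close> elements leaves no room for
      repetitions in a list of \<open>q\<close> columns; independence of the set of columns alone
      would not detect them.\<close>
    have "card U = q" using rank_card_indpt[OF N U] rk by simp
    moreover have "card U \<le> card (set (cols N))" using U by (intro card_mono) (auto simp: maximal_def)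
    moreover have "length (cols N) = q" using N by simp
    ultimately have "distinct (cols N)"
      using card_length[of "cols N"] by (intro card_distinct) simp
    then show "distinct (cols N) \<and> lin_indpt (set (cols N))"
      using full_rank_lin_indpt[OF N rk] by simp
  next
    assume "distinct (cols N) \<and> lin_indpt (set (cols N))"
    then show "rank N = q" using lin_indpt_full_rank[OF N] by simp
  qed
  moreover have "(\<exists>L\<in>carrier_mat q c. L * N = 1\<^sub>m q) \<longleftrightarrow> right_invertible (top_rows q M)"
  proof
    assume "\<exists>L\<in>carrier_mat q c. L * N = 1\<^sub>m q"
    then obtain L where L: "L \<in> carrier_mat q c" "L * N = 1\<^sub>m q" by blast
    have "top_rows q M * transpose_mat L = 1\<^sub>m q"
      using transpose_mult[OF L(1) N] L(2) by (simp add: N_def)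
    then show "right_invertible (top_rows q M)"
      using L unfolding right_invertible_iff[OF top] by (intro bexI[of _ "transpose_mat L"]) auto
  next
    assume "right_invertible (top_rows q M)"
    then obtain Q where Q: "Q \<in> carrier_mat c q" "top_rows q M * Q = 1\<^sub>m q"
      unfolding right_invertible_iff[OF top] by blast
    have "transpose_mat Q * N = 1\<^sub>m q"
      using transpose_mult[OF top Q(1)] Q(2) by (simp add: N_def)
    then show "\<exists>L\<in>carrier_mat q c. L * N = 1\<^sub>m q"
      using Q by (intro bexI[of _ "transpose_mat Q"]) auto
  qed
  ultimately show ?thesis
    using full_rank_iff_left_inverse[OF N] M unfolding lin_indpt_first_rows_def cols by auto
qed

lemma right_invertible_square:
  assumes "M \<in> carrier_mat q q"
  shows "right_invertible M \<longleftrightarrow> det M \<noteq> 0"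
  using full_row_rank_iff_right_invertible[OF assms] vec_space.det_rank_iff[OF assms] by simp

lemma right_invertible_mult:
  assumes A: "A \<in> carrier_mat q m" and B: "B \<in> carrier_mat m c" and "right_invertible (A * B)"
  shows "right_invertible A"
proof -
  have "A * B \<in> carrier_mat q c" using A B by simp
  then obtain Q where Q: "Q \<in> carrier_mat c q" "A * B * Q = 1\<^sub>m q"
    using assms(3) right_invertible_iff by blast
  then show ?thesis unfolding right_invertible_iff[OF A]
    using Q A B assoc_mult_mat[OF A B Q(1)] by (intro bexI[of _ "B * Q"]) simp_all
qed

text \<open>Maximal minors are the case in which \<open>Q\<close> selects columns. Admitting every
  constant \<open>Q\<close> over \<open>K\<close> avoids index bookkeeping, and where one
  determinant does not vanish, its \<open>Q\<close> is a uniform multiplier for the inverse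
  map.\<close>

lemma (in scalars) right_invertible_det:
  assumes M: "M \<in> carrier_mat q m" "mat_over K M"
  shows "right_invertible M \<longleftrightarrow> (\<exists>Q\<in>carrier_mat m q. mat_over K Q \<and> det (M * Q) \<noteq> 0)"
proof
  assume "right_invertible M"
  then obtain Q where "Q \<in> carrier_mat m q" "M * Q = 1\<^sub>m q" using right_invertible_iff[OF M(1)] by blast
  then obtain Q' where "Q' \<in> carrier_mat m q" "mat_over K Q'" "M * Q' = 1\<^sub>m q"
    using solve_over[OF M one_carrier_mat mat_over_one] by blast
  then show "\<exists>Q\<in>carrier_mat m q. mat_over K Q \<and> det (M * Q) \<noteq> 0" by (intro bexI[of _ Q']) auto
next
  assume "\<exists>Q\<in>carrier_mat m q. mat_over K Q \<and> det (M * Q) \<noteq> 0"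
  then obtain Q where Q: "Q \<in> carrier_mat m q" "det (M * Q) \<noteq> 0" by blast
  then have "right_invertible (M * Q)" using M right_invertible_square[of "M * Q" q] by auto
  then show "right_invertible M" by (rule right_invertible_mult[OF M(1) Q(1)])
qed

text \<open>Any other candidate \<open>Y\<close> has the form \<open>X * T\<close> with
  \<open>T\<close> square, and comparing the top blocks, both identities, forces \<open>T\<close> to
  be the identity.\<close>

lemma normal_form_unique:
  assumes A: "A \<in> carrier_mat m q" and X: "X \<in> carrier_mat m q" and q: "q \<le> m"
    and top: "top_rows q X = 1\<^sub>m q" and col: "vec_space.col_space m X = vec_space.col_space m A"
  shows "normal_form q m (vec_space.col_space m A) = X"
  unfolding normal_form_def
proof (rule the_equality)
  have "X $$ (a, b) = (if a = b then 1 else 0)" if "a < q" "b < q" for a b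
  proof -
    have "X $$ (a, b) = top_rows q X $$ (a, b)" using that X by (simp add: top_rows_def)
    then show ?thesis using that by (simp add: top)
  qed
  then show "X \<in> carrier_mat m q \<and> vec_space.col_space m X = vec_space.col_space m A \<and>
    (\<forall>a<q. \<forall>b<q. X $$ (a, b) = (if a = b then 1 else 0))" using X col by blast
next
  fix Y assume Y: "Y \<in> carrier_mat m q \<and> vec_space.col_space m Y = vec_space.col_space m A \<and>
    (\<forall>a<q. \<forall>b<q. Y $$ (a, b) = (if a = b then 1 else 0))"
  then have Yc: "Y \<in> carrier_mat m q" by blast
  have topY: "top_rows q Y = 1\<^sub>m q" using Y by (intro eq_matI) (auto simp: top_rows_def)
  obtain T where T: "T \<in> carrier_mat q q" "Y = X * T"
    using factor_through_col_space[OF X Yc] cols_subset_col_space[OF Yc] Y col by auto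
  have "T = 1\<^sub>m q" using top_rows_mult[OF X T(1) q] T topY top by simp
  then show "Y = X" using T X by simp
qed

lemma col_space_mult_invertible:
  fixes X G :: "complex mat"
  assumes X: "X \<in> carrier_mat m q" and G: "G \<in> carrier_mat q q" "det G \<noteq> 0"
  shows "vec_space.col_space m (X * G) = vec_space.col_space m X"
proof
  show "vec_space.col_space m (X * G) \<subseteq> vec_space.col_space m X"
    by (rule col_space_mult_subset[OF X G(1)])
  obtain Q where Q: "Q \<in> carrier_mat q q" "G * Q = 1\<^sub>m q"
    using right_invertible_square[OF G(1)] G right_invertible_iff by blast
  have "X = X * G * Q" using X G Q by (simp add: assoc_mult_mat[of _ m q _ q _ q])
  then show "vec_space.col_space m X \<subseteq> vec_space.col_space m (X * G)"
    using col_space_mult_subset[of "X * G" m q Q q] X G Q by simp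
qed

section \<open>Unfoldings\<close>

lemma index_less:
  fixes i j a b :: nat
  assumes "i < a" "j < b" shows "i * b + j < a * b"
proof -
  have "i * b + j < Suc i * b" using assms by simp
  also have "\<dots> \<le> a * b" using assms by (intro mult_right_mono) auto
  finally show ?thesis .
qed

lemma index_split:
  fixes i :: nat
  assumes "i < a * b" shows "i div b < a" "i mod b < b" "i div b * b + i mod b = i"
  using assms by (auto simp: less_mult_imp_div_less) (metis mod_less_divisor mult_zero_right not_gr_zero not_less0)

lemma sum_index:
  fixes f :: "nat \<Rightarrow> complex"
  shows "(\<Sum>l=0..<a * b. f l) = (\<Sum>i=0..<a. \<Sum>j=0..<b. f (i * b + j))"
proof -
  have "(\<Sum>l=0..<a * b. f l) = (\<Sum>i<a. sum f {i * b..<i * b + b})"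
    by (simp add: sum.nat_group atLeast0LessThan)
  also have "\<dots> = (\<Sum>i=0..<a. \<Sum>j=0..<b. f (i * b + j))"
  proof (rule sum.cong)
    fix i
    show "sum f {i * b..<i * b + b} = (\<Sum>j=0..<b. f (i * b + j))"
      using sum.shift_bounds_nat_ivl[of f 0 "i * b" b] by (simp add: add.commute)
  qed auto
  finally show ?thesis .
qed

lemma unfold_vec_carrier [simp, intro]: "unfold_vec a b v \<in> carrier_mat a b"
  by (simp add: unfold_vec_def)

lemma unfold_vec_dim [simp]: "dim_row (unfold_vec a b v) = a" "dim_col (unfold_vec a b v) = b"
  by (simp_all add: unfold_vec_def)

lemma unfold_vec_index [simp]: "i < a \<Longrightarrow> j < b \<Longrightarrow> unfold_vec a b v $$ (i, j) = v $ (i * b + j)"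
  by (simp add: unfold_vec_def)

lemma flat_mat_carrier [intro]: "A \<in> carrier_mat a b \<Longrightarrow> flat_mat A \<in> carrier_vec (a * b)"
  by (auto simp: flat_mat_def)

lemma flat_mat_index [simp]:
  assumes "A \<in> carrier_mat a b" "i < a" "j < b"
  shows "flat_mat A $ (i * b + j) = A $$ (i, j)"
  using assms index_less[of i a j b] by (simp add: flat_mat_def)

lemma unfold_flat [simp]: "A \<in> carrier_mat a b \<Longrightarrow> unfold_vec a b (flat_mat A) = A"
  by (intro eq_matI) auto

lemma flat_unfold [simp]:
  assumes "v \<in> carrier_vec (a * b)" shows "flat_mat (unfold_vec a b v) = v"
proof (rule eq_vecI)
  fix i assume "i < dim_vec v"
  then have "i < a * b" using assms by simp
  then show "flat_mat (unfold_vec a b v) $ i = v $ i"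
    using index_split[of i a b] by (simp add: flat_mat_def)
qed (use assms in \<open>auto simp: flat_mat_def\<close>)

lemma flat_mat_smult: "flat_mat (c \<cdot>\<^sub>m A) = c \<cdot>\<^sub>v flat_mat A"
  by (intro eq_vecI)
    (auto simp: flat_mat_def intro!: index_smult_mat(1) index_split less_mult_imp_div_less)

lemma unfold_vec_smult:
  assumes "v \<in> carrier_vec (a * b)"
  shows "unfold_vec a b (c \<cdot>\<^sub>v v) = c \<cdot>\<^sub>m unfold_vec a b v"
  using assms by (intro eq_matI) (auto simp: index_less)

section \<open>Kronecker products with an identity factor, and regrouping of indices in
  lexicographic order\<close>

definition kron_id :: "complex mat \<Rightarrow> nat \<Rightarrow> complex mat" where
  "kron_id P c = mat (dim_row P * c) (dim_col P * c)
     (\<lambda>(i, j). if i mod c = j mod c then P $$ (i div c, j div c) else 0)"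

definition id_kron :: "nat \<Rightarrow> complex mat \<Rightarrow> complex mat" where
  "id_kron c V = mat (c * dim_row V) (c * dim_col V)
     (\<lambda>(i, j). if i div dim_row V = j div dim_col V
        then V $$ (i mod dim_row V, j mod dim_col V) else 0)"

lemma kron_id_carrier [simp, intro]: "P \<in> carrier_mat a b \<Longrightarrow> kron_id P c \<in> carrier_mat (a * c) (b * c)"
  by (auto simp: kron_id_def)

lemma id_kron_carrier [simp, intro]: "V \<in> carrier_mat a b \<Longrightarrow> id_kron c V \<in> carrier_mat (c * a) (c * b)"
  by (auto simp: id_kron_def)

text \<open>\<open>P\<close> acts on the leading index alone. Moving the next index, of range
  \<open>c\<close>, from the columns to the rows leaves this action untouched, so it becomes
  \<open>P\<close> tensored with an identity on the moved index.\<close>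

lemma unfold_mult_left:
  assumes P: "P \<in> carrier_mat a b"
  shows "unfold_vec (a * c) d (flat_mat (P * unfold_vec b (c * d) v)) =
    kron_id P c * unfold_vec (b * c) d v"
proof (rule eq_matI)
  fix i j assume "i < dim_row (kron_id P c * unfold_vec (b * c) d v)"
    "j < dim_col (kron_id P c * unfold_vec (b * c) d v)"
  then have ij: "i < a * c" "j < d" using P by (auto simp: kron_id_def)
  define p q where "p = i div c" and "q = i mod c"
  have pq: "p < a" "q < c" "i = p * c + q" using index_split[OF ij(1)] by (auto simp: p_def q_def)
  have qj: "q * d + j < c * d" using pq ij by (simp add: index_less)
  have PU: "P * unfold_vec b (c * d) v \<in> carrier_mat a (c * d)" using P by auto
  have "i * d + j = p * (c * d) + (q * d + j)" unfolding pq(3) by (simp add: algebra_simps)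
  then have "unfold_vec (a * c) d (flat_mat (P * unfold_vec b (c * d) v)) $$ (i, j)
      = (P * unfold_vec b (c * d) v) $$ (p, q * d + j)"
    using flat_mat_index[OF PU pq(1) qj] ij by (simp only: unfold_vec_index)
  also have "\<dots> = (\<Sum>l=0..<b. P $$ (p, l) * v $ (l * (c * d) + (q * d + j)))"
    using pq qj P by (simp add: scalar_prod_def)
  \<comment> \<open>A sum over \<open>x\<close> with a single surviving term extends the sum over
    the leading index to one over pairs, which are the row indices of the regrouped matrix.\<close>
  also have "\<dots> = (\<Sum>l=0..<b. \<Sum>x=0..<c. (if q = x then P $$ (p, l) else 0) * v $ ((l * c + x) * d + j))"
  proof (rule sum.cong)
    fix l
    have "(\<Sum>x=0..<c. (if q = x then P $$ (p, l) else 0) * v $ ((l * c + x) * d + j))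
        = (\<Sum>x=0..<c. if q = x then P $$ (p, l) * v $ ((l * c + x) * d + j) else 0)"
      by (intro sum.cong) auto
    also have "\<dots> = P $$ (p, l) * v $ ((l * c + q) * d + j)" using pq by simp
    finally show "P $$ (p, l) * v $ (l * (c * d) + (q * d + j)) =
        (\<Sum>x=0..<c. (if q = x then P $$ (p, l) else 0) * v $ ((l * c + x) * d + j))"
      by (simp add: algebra_simps)
  qed simp
  also have "\<dots> = (\<Sum>l=0..<b * c. (if q = l mod c then P $$ (p, l div c) else 0) * v $ (l * d + j))"
    unfolding sum_index by (intro sum.cong) auto
  also have "\<dots> = (kron_id P c * unfold_vec (b * c) d v) $$ (i, j)"
    using ij P unfolding p_def q_def by (simp add: scalar_prod_def kron_id_def)
  finally show "unfold_vec (a * c) d (flat_mat (P * unfold_vec b (c * d) v)) $$ (i, j)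
      = (kron_id P c * unfold_vec (b * c) d v) $$ (i, j)" .
qed (use P in \<open>auto simp: kron_id_def\<close>)

text \<open>\<open>V\<close> acts on the last index alone, so after the middle index, of range
  \<open>p\<close>, has moved from the rows to the columns, it acts as an identity on that index
  tensored with \<open>V\<close>.\<close>

lemma unfold_mult_right:
  assumes A: "A \<in> carrier_mat (a * p) c" and V: "V \<in> carrier_mat c d"
  shows "unfold_vec a (p * d) (flat_mat (A * V)) = unfold_vec a (p * c) (flat_mat A) * id_kron p V"
proof (rule eq_matI)
  fix i j assume "i < dim_row (unfold_vec a (p * c) (flat_mat A) * id_kron p V)"
    "j < dim_col (unfold_vec a (p * c) (flat_mat A) * id_kron p V)"
  then have ij: "i < a" "j < p * d" using V by (auto simp: id_kron_def)
  define x y where "x = j div d" and "y = j mod d"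
  have xy: "x < p" "y < d" "j = x * d + y" using index_split[OF ij(2)] by (auto simp: x_def y_def)
  have ix: "i * p + z < a * p" if "z < p" for z using ij that by (simp add: index_less)
  have "i * (p * d) + j = (i * p + x) * d + y" unfolding xy(3) by (simp add: algebra_simps)
  then have "unfold_vec a (p * d) (flat_mat (A * V)) $$ (i, j) = (A * V) $$ (i * p + x, y)"
    using flat_mat_index[of "A * V" "a * p" d "i * p + x" y] ix[OF xy(1)] xy(2) A V ij
    by (simp only: unfold_vec_index mult_carrier_mat)
  also have "\<dots> = (\<Sum>l=0..<c. A $$ (i * p + x, l) * V $$ (l, y))"
    using A V ix xy by (simp add: scalar_prod_def)
  also have "\<dots> = (\<Sum>z=0..<p. if z = x then (\<Sum>l=0..<c. A $$ (i * p + z, l) * V $$ (l, y)) else 0)"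
    using xy by simp
  also have "\<dots> = (\<Sum>z=0..<p. \<Sum>l=0..<c. flat_mat A $ (i * (p * c) + (z * c + l)) *
      (if (z * c + l) div c = x then V $$ ((z * c + l) mod c, y) else 0))"
  proof (intro sum.cong refl)
    fix z assume z: "z \<in> {0..<p}"
    have "flat_mat A $ (i * (p * c) + (z * c + l)) = A $$ (i * p + z, l)" if "l < c" for l
    proof -
      have "i * (p * c) + (z * c + l) = (i * p + z) * c + l" by (simp add: algebra_simps)
      moreover have "flat_mat A $ ((i * p + z) * c + l) = A $$ (i * p + z, l)"
        using z that by (intro flat_mat_index[OF A] ix) auto
      ultimately show ?thesis by (simp only:)
    qed
    then show "(if z = x then (\<Sum>l=0..<c. A $$ (i * p + z, l) * V $$ (l, y)) else 0) =
      (\<Sum>l=0..<c. flat_mat A $ (i * (p * c) + (z * c + l)) *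
        (if (z * c + l) div c = x then V $$ ((z * c + l) mod c, y) else 0))"
      by (auto intro!: sum.cong sum.neutral[symmetric])
  qed
  also have "\<dots> = (\<Sum>l=0..<p * c. flat_mat A $ (i * (p * c) + l) *
      (if l div c = x then V $$ (l mod c, y) else 0))"
    unfolding sum_index by simp
  also have "\<dots> = (unfold_vec a (p * c) (flat_mat A) * id_kron p V) $$ (i, j)"
    using ij unfolding x_def y_def by (simp add: scalar_prod_def id_kron_def carrier_matD[OF V] cong: if_cong)
  finally show "unfold_vec a (p * d) (flat_mat (A * V)) $$ (i, j)
      = (unfold_vec a (p * c) (flat_mat A) * id_kron p V) $$ (i, j)" .
qed (use V in \<open>auto simp: id_kron_def\<close>)

lemma mat_overD: "mat_over K M \<Longrightarrow> i < dim_row M \<Longrightarrow> j < dim_col M \<Longrightarrow> M $$ (i, j) \<in> K"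
  by (simp add: mat_over_def)

lemma mat_over_kron_id:
  assumes "mat_over K P" "0 \<in> K" shows "mat_over K (kron_id P c)"
  using assms by (auto simp: mat_over_def kron_id_def index_split)

text \<open>Since the rank equals the inner dimension, \<open>P * C\<close> and \<open>R * S\<close>
  are square and inverse to each other; exchanging their order exhibits a right inverse of
  \<open>R\<close>.\<close>

lemma right_invertible_factor:
  fixes C R :: "complex mat"
  assumes C: "C \<in> carrier_mat a q" and R: "R \<in> carrier_mat q b" and rk: "vec_space.rank a (C * R) = q"
  shows "right_invertible R"
proof -
  obtain P S where P: "P \<in> carrier_mat q a" and S: "S \<in> carrier_mat b q"
    and eq: "P * (C * R) * S = 1\<^sub>m q"
    using rank_decomp[of "C * R" a b] C R rk by auto
  have "(P * C) * (R * S) = 1\<^sub>m q"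
    using eq assoc_mult_mat[OF P C R] assoc_mult_mat[of "P * C" q q R b S q] P C R S by simp
  then have "(R * S) * (P * C) = 1\<^sub>m q"
    by (rule mat_mult_left_right_inverse[rotated 2]) (use P C R S in auto)
  then have "R * (S * (P * C)) = 1\<^sub>m q"
    using assoc_mult_mat[OF R S, of "P * C" q] P C by simp
  then show ?thesis unfolding right_invertible_iff[OF R]
    using P C S by (intro bexI[of _ "S * (P * C)"]) auto
qed

section \<open>Decompression and factorization\<close>

text \<open>The inequalities are recast for induction over the sites. \<open>r_n\<close> is the one
  in which \<open>r (n + 1) = 1\<close>, and \<open>r_le\<close> at \<open>i = 0\<close> is just
  positivity, because \<open>r 0 = 1\<close>.\<close>

locale tensor_train =
  fixes n :: nat and k r :: "nat \<Rightarrow> nat"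
  assumes k_pos: "i \<le> n \<Longrightarrow> 0 < k i" and r_pos: "i \<le> n \<Longrightarrow> 0 < r i"
    and r_0: "r 0 = 1" and r_n: "r n \<le> k n"
    and r_Suc_le: "i < n \<Longrightarrow> r (Suc i) \<le> r i * k i"
    and r_le: "i < n \<Longrightarrow> r i \<le> k i * r (Suc i)"
begin

definition left_dim :: "nat \<Rightarrow> nat" where "left_dim i = (\<Prod>j<i. k j)"
definition right_dim :: "nat \<Rightarrow> nat" where "right_dim i = (\<Prod>j=i..n. k j)"

lemma left_dim_simps [simp]: "left_dim 0 = 1" "left_dim (Suc i) = left_dim i * k i"
  by (simp_all add: left_dim_def)

lemma right_dim_Suc: "i \<le> n \<Longrightarrow> right_dim i = k i * right_dim (Suc i)"
  by (simp add: right_dim_def prod.atLeast_Suc_atMost)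

lemma right_dim_n [simp]: "right_dim n = k n"
  by (simp add: right_dim_def)

lemma left_right_dim: "i \<le> n \<Longrightarrow> left_dim i * right_dim i = right_dim 0"
  by (induction i) (simp_all add: right_dim_Suc mult.assoc)

text \<open>Indexed by the bond in front of site \<open>i\<close>, hence one more than the index of
  \<open>flattening\<close>. At bond 0 the matrix is a single row, where the inductions
  start.\<close>

definition flat :: "nat \<Rightarrow> complex vec \<Rightarrow> complex mat" where
  "flat i \<psi> = unfold_vec (left_dim i) (right_dim i) \<psi>"

lemma flat_carrier [simp, intro]: "flat i \<psi> \<in> carrier_mat (left_dim i) (right_dim i)"
  by (simp add: flat_def)

lemma flattening_eq: "flattening n k i \<psi> = flat (Suc i) \<psi>"
  by (simp add: flattening_def flat_def left_dim_def right_dim_def lessThan_Suc_atMost atLeast0AtMost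
      del: left_dim_simps)

lemma flat_0: "\<psi> \<in> carrier_vec (right_dim 0) \<Longrightarrow> flat_mat (flat 0 \<psi>) = \<psi>"
  by (simp add: flat_def)

lemma flat_Suc:
  assumes "i < n" "P \<in> carrier_mat a (left_dim i)"
  shows "unfold_vec (a * k i) (right_dim (Suc i)) (flat_mat (P * flat i \<psi>)) = kron_id P (k i) * flat (Suc i) \<psi>"
  using unfold_mult_left[OF assms(2), of "k i" "right_dim (Suc i)" \<psi>] assms
  by (simp add: flat_def right_dim_Suc)

text \<open>The rows of \<open>tail X i\<close> are indexed by the \<open>r i\<close> values of the bond in front of the site \<open>i\<close>; it
  is the matrix \<open>R\<^bsub>i-1\<^esub>\<close> of the decompression algorithm.\<close>

definition tail_vec :: "(nat \<Rightarrow> complex mat) \<Rightarrow> nat \<Rightarrow> complex vec" where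
  "tail_vec X i = decompress_steps n k r X (n - i)"

definition tail :: "(nat \<Rightarrow> complex mat) \<Rightarrow> nat \<Rightarrow> complex mat" where
  "tail X i = unfold_vec (r i) (right_dim i) (tail_vec X i)"

lemma tail_carrier [simp, intro]: "tail X i \<in> carrier_mat (r i) (right_dim i)"
  by (simp add: tail_def)

lemma tail_vec_0: "tail_vec X 0 = decompress n k r X"
  by (simp add: tail_vec_def decompress_def)

lemma tail_vec_n: "tail_vec X n = flat_mat (X n)"
  by (simp add: tail_vec_def)

lemma tail_vec_step:
  assumes "i < n" shows "tail_vec X i = flat_mat (X i * tail X (Suc i))"
proof -
  have n: "n - i = Suc (n - Suc i)" "n - Suc (n - Suc i) = i" using assms by auto
  show ?thesis unfolding tail_vec_def n(1) tail_def
    by (simp add: Let_def n(2) right_dim_def)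
qed

definition cores :: "(nat \<Rightarrow> complex mat) \<Rightarrow> bool" where
  "cores X \<longleftrightarrow> (\<forall>i<n. X i \<in> carrier_mat (r i * k i) (r (Suc i))) \<and> X n \<in> carrier_mat (r n) (k n)"

lemma coresD:
  assumes "cores X"
  shows "i < n \<Longrightarrow> X i \<in> carrier_mat (r i * k i) (r (Suc i))" "X n \<in> carrier_mat (r n) (k n)"
  using assms by (auto simp: cores_def)

lemma core_tail_carrier:
  "cores X \<Longrightarrow> i < n \<Longrightarrow> X i * tail X (Suc i) \<in> carrier_mat (r i * k i) (right_dim (Suc i))"
  using coresD(1)[of X i] by auto

lemma tail_vec_carrier:
  assumes X: "cores X" and i: "i \<le> n" shows "tail_vec X i \<in> carrier_vec (r i * right_dim i)"
proof (cases "i = n")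
  case True then show ?thesis using coresD(2)[OF X] by (auto simp: tail_vec_n)
next
  case False
  then have "i < n" using i by simp
  then show ?thesis
    using flat_mat_carrier[OF core_tail_carrier[OF X]] by (simp add: tail_vec_step right_dim_Suc mult.assoc)
qed

lemma decompress_carrier: "cores X \<Longrightarrow> decompress n k r X \<in> carrier_vec (right_dim 0)"
  using tail_vec_carrier[of X 0] by (simp add: tail_vec_0 r_0)

lemma flat_tail: "cores X \<Longrightarrow> i \<le> n \<Longrightarrow> flat_mat (tail X i) = tail_vec X i"
  using tail_vec_carrier by (simp add: tail_def)

lemma tail_n: "cores X \<Longrightarrow> tail X n = X n"
  using coresD(2) by (simp add: tail_def tail_vec_n)

lemma unfold_tail_vec:
  assumes "cores X" "i < n"
  shows "unfold_vec (r i * k i) (right_dim (Suc i)) (tail_vec X i) = X i * tail X (Suc i)"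
  using core_tail_carrier[OF assms] assms by (simp add: tail_vec_step)

section \<open>Cutting a tensor train at a bond into head and tail\<close>

primrec head :: "(nat \<Rightarrow> complex mat) \<Rightarrow> nat \<Rightarrow> complex mat" where
  "head X 0 = 1\<^sub>m 1"
| "head X (Suc i) = kron_id (head X i) (k i) * X i"

lemma head_carrier:
  assumes "cores X" shows "i \<le> n \<Longrightarrow> head X i \<in> carrier_mat (left_dim i) (r i)"
proof (induction i)
  case 0 then show ?case by (simp add: r_0)
next
  case (Suc i)
  then have "head X i \<in> carrier_mat (left_dim i) (r i)" and "i < n" by simp_all
  then show ?case
    using mult_carrier_mat[OF kron_id_carrier[of "head X i" "left_dim i" "r i" "k i"] coresD(1)[OF assms]] by simp
qed

text \<open>Cutting the contraction at bond \<open>i\<close> gives every flattening of the output a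
  factorization with inner dimension \<open>r i\<close>. It yields the rank bounds, and where a
  bound is attained, it passes full rank on to the tail. In the induction, the next index moves to
  the row side and the core at site \<open>i\<close> changes from the tail to the head.\<close>

lemma flat_decompress:
  assumes X: "cores X" shows "i \<le> n \<Longrightarrow> flat i (decompress n k r X) = head X i * tail X i"
proof (induction i)
  case 0
  then show ?case by (simp add: flat_def tail_def tail_vec_0 r_0)
next
  case (Suc i)
  then have i: "i < n" by simp
  have H: "head X i \<in> carrier_mat (left_dim i) (r i)" using head_carrier[OF X] i by simp
  have \<psi>: "decompress n k r X \<in> carrier_vec (left_dim i * right_dim i)"
    using decompress_carrier[OF X] left_right_dim[of i] i by simp
  have "flat (Suc i) (decompress n k r X) =
      unfold_vec (left_dim i * k i) (right_dim (Suc i)) (flat_mat (flat i (decompress n k r X)))"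
    using \<psi> by (simp add: flat_def)
  also have "\<dots> = unfold_vec (left_dim i * k i) (right_dim (Suc i)) (flat_mat (head X i * tail X i))"
    using Suc i by simp
  also have "\<dots> = kron_id (head X i) (k i) * (X i * tail X (Suc i))"
    using unfold_mult_left[OF H, of "k i" "right_dim (Suc i)" "tail_vec X i"] i
      unfold_tail_vec[OF X i] by (simp add: tail_def[of X i] right_dim_Suc)
  also have "\<dots> = head X (Suc i) * tail X (Suc i)"
    using assoc_mult_mat[OF kron_id_carrier[OF H, of "k i"] coresD(1)[OF X i] tail_carrier] by simp
  finally show ?case .
qed

lemma rank_flat_decompress:
  assumes "cores X" "i \<le> n" shows "vec_space.rank (left_dim i) (flat i (decompress n k r X)) \<le> r i"
  unfolding flat_decompress[OF assms] by (rule rank_le_factor[OF head_carrier[OF assms] tail_carrier])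

text \<open>The output is homogeneous of degree one in each core. With a scalar at the last core
  only, this shows that projective points go to projective points; with scalars at the other cores,
  it removes the determinants that adjugates introduce.\<close>

lemma tail_smult:
  assumes X: "cores X" and i: "i \<le> n"
  shows "tail_vec (\<lambda>j. c j \<cdot>\<^sub>m X j) i = (\<Prod>j=i..n. c j) \<cdot>\<^sub>v tail_vec X i"
  using i
proof (induction rule: inc_induct)
  case base
  show ?case by (simp add: tail_vec_n flat_mat_smult)
next
  case (step i)
  have "tail (\<lambda>j. c j \<cdot>\<^sub>m X j) (Suc i) = (\<Prod>j=Suc i..n. c j) \<cdot>\<^sub>m tail X (Suc i)"
    using step tail_vec_carrier[OF X, of "Suc i"] by (simp add: tail_def unfold_vec_smult)
  moreover have "(c i \<cdot>\<^sub>m X i) * (d \<cdot>\<^sub>m tail X (Suc i)) = (c i * d) \<cdot>\<^sub>m (X i * tail X (Suc i))" for d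
  proof -
    have Xi: "X i \<in> carrier_mat (r i * k i) (r (Suc i))" using coresD(1)[OF X] step by simp
    have "(c i \<cdot>\<^sub>m X i) * (d \<cdot>\<^sub>m tail X (Suc i)) = d \<cdot>\<^sub>m (c i \<cdot>\<^sub>m X i * tail X (Suc i))"
      using Xi by (intro mult_smult_distrib) auto
    also have "\<dots> = d \<cdot>\<^sub>m (c i \<cdot>\<^sub>m (X i * tail X (Suc i)))"
      using mult_smult_assoc_mat[OF Xi tail_carrier] by simp
    also have "\<dots> = (c i * d) \<cdot>\<^sub>m (X i * tail X (Suc i))" by (intro eq_matI) auto
    finally show ?thesis .
  qed
  ultimately have "(c i \<cdot>\<^sub>m X i) * tail (\<lambda>j. c j \<cdot>\<^sub>m X j) (Suc i) = (\<Prod>j=i..n. c j) \<cdot>\<^sub>m (X i * tail X (Suc i))"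
    using step by (simp add: prod.atLeast_Suc_atMost[of i n])
  then show ?case using step by (simp add: tail_vec_step flat_mat_smult)
qed

section \<open>The factorization algorithm as selection of rows of the flattenings\<close>

abbreviation fvec :: "complex vec \<Rightarrow> nat \<Rightarrow> complex vec" where
  "fvec \<psi> i \<equiv> fact_tensor n k r \<psi> i"

text \<open>The matrix \<open>R\<^bsub>i-1\<^esub>\<close> of the factorization algorithm.\<close>

definition fact_mat :: "complex vec \<Rightarrow> nat \<Rightarrow> complex mat" where
  "fact_mat \<psi> i = unfold_vec (r i) (right_dim i) (fvec \<psi> i)"

lemma fact_mat_carrier [simp, intro]: "fact_mat \<psi> i \<in> carrier_mat (r i) (right_dim i)"
  by (simp add: fact_mat_def)

lemma fact_unfolding_eq:
  "fact_unfolding n k r \<psi> i = unfold_vec (r i * k i) (right_dim (Suc i)) (fvec \<psi> i)"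
  by (simp add: fact_unfolding_def right_dim_def)

lemma fact_unfolding_carrier [simp, intro]:
  "fact_unfolding n k r \<psi> i \<in> carrier_mat (r i * k i) (right_dim (Suc i))"
  by (simp add: fact_unfolding_eq)

lemma fvec_Suc: "fvec \<psi> (Suc i) = flat_mat (top_rows (r (Suc i)) (fact_unfolding n k r \<psi> i))"
  by (simp add: fact_unfolding_def top_rows_def Let_def)

lemma fact_Suc: "fact_mat \<psi> (Suc i) = top_rows (r (Suc i)) (fact_unfolding n k r \<psi> i)"
  unfolding fact_mat_def fvec_Suc by (rule unfold_flat[OF top_rows_carrier[OF fact_unfolding_carrier]])

lemma fvec_carrier:
  assumes "\<psi> \<in> carrier_vec (right_dim 0)" shows "fvec \<psi> i \<in> carrier_vec (r i * right_dim i)"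
proof (cases i)
  case 0 then show ?thesis using assms by (simp add: r_0)
next
  case (Suc j) then show ?thesis
    using flat_mat_carrier[OF top_rows_carrier[OF fact_unfolding_carrier]] unfolding Suc fvec_Suc by blast
qed

lemma flat_fact: "\<psi> \<in> carrier_vec (right_dim 0) \<Longrightarrow> flat_mat (fact_mat \<psi> i) = fvec \<psi> i"
  using fvec_carrier by (simp add: fact_mat_def)

text \<open>The row selections performed by the factorization algorithm, as matrices.\<close>

primrec select :: "nat \<Rightarrow> complex mat" where
  "select 0 = 1\<^sub>m 1"
| "select (Suc i) = top_rows (r (Suc i)) (kron_id (select i) (k i))"

lemma select_carrier [simp, intro]: "select i \<in> carrier_mat (r i) (left_dim i)"
proof (induction i)
  case (Suc i)
  show ?case using top_rows_carrier[OF kron_id_carrier[OF Suc]] by simp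
qed (simp add: r_0)

lemma fact_select:
  assumes \<psi>: "\<psi> \<in> carrier_vec (right_dim 0)"
  shows "i \<le> n \<Longrightarrow> fact_mat \<psi> i = select i * flat i \<psi>"
    and "i < n \<Longrightarrow> fact_unfolding n k r \<psi> i = kron_id (select i) (k i) * flat (Suc i) \<psi>"
proof -
  have unf: "fact_unfolding n k r \<psi> i = kron_id (select i) (k i) * flat (Suc i) \<psi>"
    if "i < n" "fact_mat \<psi> i = select i * flat i \<psi>" for i
  proof -
    have "fvec \<psi> i = flat_mat (select i * flat i \<psi>)"
      using flat_fact[OF \<psi>, of i] that by simp
    then show ?thesis unfolding fact_unfolding_eq using flat_Suc[OF that(1) select_carrier] by simp
  qed
  show *: "i \<le> n \<Longrightarrow> fact_mat \<psi> i = select i * flat i \<psi>" for i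
  proof (induction i)
    case 0
    have "flat 0 \<psi> \<in> carrier_mat 1 (right_dim 0)" using flat_carrier[of 0 \<psi>] by simp
    then show ?case by (simp add: fact_mat_def flat_def r_0)
  next
    case (Suc i)
    then have i: "i < n" by simp
    have "kron_id (select i) (k i) \<in> carrier_mat (r i * k i) (left_dim (Suc i))"
      using kron_id_carrier[OF select_carrier] by simp
    then show ?case
      unfolding fact_Suc using unf[OF i] Suc i top_rows_mult[OF _ flat_carrier r_Suc_le[OF i]] by simp
  qed
  show "i < n \<Longrightarrow> fact_unfolding n k r \<psi> i = kron_id (select i) (k i) * flat (Suc i) \<psi>"
    using unf * by simp
qed

lemma rank_flat_ge:
  assumes \<psi>: "\<psi> \<in> carrier_vec (right_dim 0)" and i: "i \<le> n" and inv: "right_invertible (fact_mat \<psi> i)"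
  shows "r i \<le> vec_space.rank (left_dim i) (flat i \<psi>)"
proof -
  obtain Q where Q: "Q \<in> carrier_mat (right_dim i) (r i)" "fact_mat \<psi> i * Q = 1\<^sub>m (r i)"
    using inv right_invertible_iff[OF fact_mat_carrier] by blast
  show ?thesis
    using rank_ge_unit[OF flat_carrier select_carrier Q(1)] Q(2) fact_select(1)[OF \<psi> i] by simp
qed

lemma fvec_smult:
  assumes \<psi>: "\<psi> \<in> carrier_vec (right_dim 0)"
  shows "i \<le> n \<Longrightarrow> fvec (c \<cdot>\<^sub>v \<psi>) i = c \<cdot>\<^sub>v fvec \<psi> i"
proof (induction i)
  case (Suc i)
  then have i: "i < n" by simp
  have "fvec \<psi> i \<in> carrier_vec (r i * k i * right_dim (Suc i))"
    using fvec_carrier[OF \<psi>, of i] i by (simp add: right_dim_Suc mult.assoc)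
  then have "fact_unfolding n k r (c \<cdot>\<^sub>v \<psi>) i = c \<cdot>\<^sub>m fact_unfolding n k r \<psi> i"
    unfolding fact_unfolding_eq using Suc i by (simp add: unfold_vec_smult)
  moreover have "top_rows (r (Suc i)) (c \<cdot>\<^sub>m fact_unfolding n k r \<psi> i) =
      c \<cdot>\<^sub>m top_rows (r (Suc i)) (fact_unfolding n k r \<psi> i)"
    using r_Suc_le[OF i] carrier_matD[OF fact_unfolding_carrier[of \<psi> i]]
    by (intro eq_matI) (auto simp: top_rows_def)
  ultimately show ?case unfolding fvec_Suc by (simp add: flat_mat_smult)
qed simp

lemma fact_smult:
  assumes \<psi>: "\<psi> \<in> carrier_vec (right_dim 0)" and i: "i \<le> n"
  shows "fact_mat (c \<cdot>\<^sub>v \<psi>) i = c \<cdot>\<^sub>m fact_mat \<psi> i"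
  using fvec_smult[OF \<psi> i] fvec_carrier[OF \<psi>] by (simp add: fact_mat_def unfold_vec_smult)

section \<open>Normalized factors: recovery, uniqueness and reconstruction\<close>

definition normalized :: "(nat \<Rightarrow> complex mat) \<Rightarrow> bool" where
  "normalized X \<longleftrightarrow> cores X \<and> (\<forall>i<n. top_rows (r (Suc i)) (X i) = 1\<^sub>m (r (Suc i)))"

lemma fact_decompress:
  assumes "normalized X" shows "i \<le> n \<Longrightarrow> fvec (decompress n k r X) i = tail_vec X i"
proof (induction i)
  case 0 then show ?case by (simp add: tail_vec_0)
next
  case (Suc i)
  have X: "cores X" and i: "i < n" and top: "top_rows (r (Suc i)) (X i) = 1\<^sub>m (r (Suc i))"
    using assms Suc by (auto simp: normalized_def)
  have "fact_unfolding n k r (decompress n k r X) i = X i * tail X (Suc i)"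
    unfolding fact_unfolding_eq using Suc unfold_tail_vec[OF X i] by simp
  then have "fvec (decompress n k r X) (Suc i) = flat_mat (tail X (Suc i))"
    unfolding fvec_Suc
    using top_rows_mult[OF coresD(1)[OF X i] tail_carrier r_Suc_le[OF i]] top
      left_mult_one_mat[OF tail_carrier] by simp
  then show ?case using flat_tail[OF X] Suc by simp
qed

lemma fact_decompress_tail:
  assumes "normalized X" "i \<le> n" shows "fact_mat (decompress n k r X) i = tail X i"
  using fact_decompress[OF assms] by (simp add: fact_mat_def tail_def)

lemma decompress_nonzero:
  assumes X: "normalized X" and "X n \<noteq> 0\<^sub>m (r n) (k n)"
  shows "decompress n k r X \<noteq> 0\<^sub>v (right_dim 0)"
proof
  assume "decompress n k r X = 0\<^sub>v (right_dim 0)"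
  \<comment> \<open>Homogeneity with the scalar 0 takes the place of additivity: the algorithm makes
    zero matrices from the zero tensor, but it also recovers the last core of
    \<open>X\<close>.\<close>
  moreover have "0\<^sub>v (right_dim 0) = 0 \<cdot>\<^sub>v (0\<^sub>v (right_dim 0) :: complex vec)" by auto
  ultimately have "tail X n = 0 \<cdot>\<^sub>m fact_mat (0\<^sub>v (right_dim 0)) n"
    using fact_smult[of "0\<^sub>v (right_dim 0)" n 0] fact_decompress_tail[OF X, of n] by simp
  also have "\<dots> = 0\<^sub>m (r n) (k n)" using fact_mat_carrier[of "0\<^sub>v (right_dim 0)" n] by (intro eq_matI) auto
  finally show False using assms tail_n by (simp add: normalized_def)
qed

lemma fact_right_invertible:
  assumes X: "normalized X" and i: "i \<le> n"
    and rk: "vec_space.rank (left_dim i) (flat i (decompress n k r X)) = r i"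
  shows "right_invertible (fact_mat (decompress n k r X) i)"
proof -
  have c: "cores X" using X by (simp add: normalized_def)
  show ?thesis unfolding fact_decompress_tail[OF X i]
    using rk unfolding flat_decompress[OF c i]
    by (rule right_invertible_factor[OF head_carrier[OF c i] tail_carrier])
qed

text \<open>Factorization is homogeneous, so the scalar \<open>c\<close> appears in every tail. In
  \<open>Y i * tail Y (Suc i)\<close> it cancels against the one in front of
  \<open>X i * tail X (Suc i)\<close>, and a right inverse of the tail leaves
  \<open>Y i = X i\<close>. Only the last core, being a tail itself, keeps the scalar.\<close>

lemma decompress_inj:
  assumes X: "normalized X" and Y: "normalized Y" and eq: "decompress n k r Y = c \<cdot>\<^sub>v decompress n k r X"
    and c: "c \<noteq> 0" and inv: "\<And>i. i < n \<Longrightarrow> right_invertible (tail X (Suc i))"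
  shows "(\<forall>i<n. Y i = X i) \<and> Y n = c \<cdot>\<^sub>m X n"
proof -
  have XC: "cores X" and YC: "cores Y" using X Y by (auto simp: normalized_def)
  have \<psi>: "decompress n k r X \<in> carrier_vec (right_dim 0)" by (rule decompress_carrier[OF XC])
  have vec: "tail_vec Y i = c \<cdot>\<^sub>v tail_vec X i" if "i \<le> n" for i
    using fact_decompress[OF Y that] fact_decompress[OF X that] fvec_smult[OF \<psi> that] eq by simp
  have mat: "tail Y i = c \<cdot>\<^sub>m tail X i" if "i \<le> n" for i
    using vec[OF that] tail_vec_carrier[OF XC that] by (simp add: tail_def unfold_vec_smult)
  have "Y i = X i" if i: "i < n" for i
  proof -
    have Xi: "X i \<in> carrier_mat (r i * k i) (r (Suc i))" and Yi: "Y i \<in> carrier_mat (r i * k i) (r (Suc i))"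
      using coresD(1)[OF XC i] coresD(1)[OF YC i] .
    have "tail_vec X i \<in> carrier_vec (r i * k i * right_dim (Suc i))"
      using tail_vec_carrier[OF XC, of i] i by (simp add: right_dim_Suc mult.assoc)
    then have "Y i * tail Y (Suc i) = c \<cdot>\<^sub>m (X i * tail X (Suc i))"
      using vec[of i] i unfold_tail_vec[OF YC i] unfold_tail_vec[OF XC i] by (simp add: unfold_vec_smult)
    then have eq1: "c \<cdot>\<^sub>m (Y i * tail X (Suc i)) = c \<cdot>\<^sub>m (X i * tail X (Suc i))"
      using mat[of "Suc i"] i mult_smult_distrib[OF Yi tail_carrier] by simp
    have "inverse c \<cdot>\<^sub>m (c \<cdot>\<^sub>m M) = M" for M :: "complex mat" using c by (intro eq_matI) auto
    then have eq2: "Y i * tail X (Suc i) = X i * tail X (Suc i)" using eq1 by metis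
    obtain V where V: "V \<in> carrier_mat (right_dim (Suc i)) (r (Suc i))" "tail X (Suc i) * V = 1\<^sub>m (r (Suc i))"
      using inv[OF i] right_invertible_iff[OF tail_carrier] by blast
    show ?thesis
      using arg_cong[OF eq2, of "\<lambda>M. M * V"] assoc_mult_mat[OF Yi tail_carrier V(1)]
        assoc_mult_mat[OF Xi tail_carrier V(1)] V(2) Xi Yi by simp
  qed
  then show ?thesis using mat[of n] tail_n[OF XC] tail_n[OF YC] by simp
qed

text \<open>Each unfolding consists of rows of a flattening, so the rank bound makes it
  \<open>C * Q\<close> with inner dimension \<open>r (Suc i)\<close>, and its first rows are
  \<open>top_rows ?q C * Q\<close>. These have the right inverse \<open>V i\<close>, so the square
  matrices \<open>top_rows ?q C\<close> and \<open>Q * V i\<close> are inverse to each other. Hence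
  \<open>V i\<close> followed by the matrix of first rows acts on \<open>Q\<close> as the identity,
  and multiplying the unfolding by \<open>V i\<close> solves for the core.\<close>

lemma reconstruct:
  assumes \<psi>: "\<psi> \<in> carrier_vec (right_dim 0)"
    and ranks: "\<forall>i<n. vec_space.rank (left_dim (Suc i)) (flat (Suc i) \<psi>) \<le> r (Suc i)"
    and inverses: "\<forall>i<n. V i \<in> carrier_mat (right_dim (Suc i)) (r (Suc i)) \<and>
      fact_mat \<psi> (Suc i) * V i = 1\<^sub>m (r (Suc i))"
    and X_def: "\<forall>i<n. X i = fact_unfolding n k r \<psi> i * V i" "X n = fact_mat \<psi> n"
  shows "normalized X" "decompress n k r X = \<psi>"
    "\<And>i. i < n \<Longrightarrow> fact_unfolding n k r \<psi> i = X i * fact_mat \<psi> (Suc i)"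
proof -
  have rk: "vec_space.rank (left_dim (Suc i)) (flat (Suc i) \<psi>) \<le> r (Suc i)"
    and V: "V i \<in> carrier_mat (right_dim (Suc i)) (r (Suc i)) \<and> fact_mat \<psi> (Suc i) * V i = 1\<^sub>m (r (Suc i))"
    if "i < n" for i using ranks inverses that by blast+
  have X: "\<And>i. i < n \<Longrightarrow> X i = fact_unfolding n k r \<psi> i * V i" "X n = fact_mat \<psi> n"
    using X_def by blast+
  have Xi: "X i \<in> carrier_mat (r i * k i) (r (Suc i))" if "i < n" for i
    using X(1)[OF that] V[OF that] mult_carrier_mat[OF fact_unfolding_carrier] by simp
  have XC: "cores X" using Xi X(2) fact_mat_carrier[of \<psi> n] by (auto simp: cores_def)
  have "top_rows (r (Suc i)) (X i) = 1\<^sub>m (r (Suc i))" if i: "i < n" for i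
    using top_rows_mult[OF fact_unfolding_carrier, of "V i" _ "r (Suc i)" "r (Suc i)" \<psi>] V[OF i] X(1)[OF i]
      r_Suc_le[OF i] fact_Suc by simp
  then show "normalized X" using XC by (simp add: normalized_def)
  show unf: "fact_unfolding n k r \<psi> i = X i * fact_mat \<psi> (Suc i)" if i: "i < n" for i
  proof -
    let ?q = "r (Suc i)" and ?F = "flat (Suc i) \<psi>" and ?a = "left_dim (Suc i)" and ?b = "right_dim (Suc i)"
    let ?M = "fact_unfolding n k r \<psi> i" and ?d = "vec_space.rank (left_dim (Suc i)) (flat (Suc i) \<psi>)"
    have "r (Suc i) \<le> ?d"
      by (rule rank_flat_ge[OF \<psi>]) (use i V[OF i] right_invertible_iff[OF fact_mat_carrier] in auto)
    \<comment> \<open>Equality of the rank with \<open>r (Suc i)\<close> is what makes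
      \<open>top_rows ?q C\<close> square, so that one-sided inverses can be exchanged.\<close>
    then have d: "?d = ?q" using rk[OF i] by simp
    obtain P S where P: "P \<in> carrier_mat ?q ?a" and S: "S \<in> carrier_mat ?b ?q"
      and eq: "?F * S * (P * ?F) = ?F"
      using rank_decomp[OF flat_carrier[of "Suc i" \<psi>]] unfolding d by blast
    define E where "E = kron_id (select i) (k i)"
    have E: "E \<in> carrier_mat (r i * k i) ?a" by (simp add: E_def)
    define Q where "Q = P * ?F"
    have Q: "Q \<in> carrier_mat ?q ?b" using mult_carrier_mat[OF P flat_carrier] by (simp add: Q_def)
    define C where "C = E * (?F * S)"
    have FS: "?F * S \<in> carrier_mat ?a ?q" using mult_carrier_mat[OF flat_carrier S] .
    have C: "C \<in> carrier_mat (r i * k i) ?q" using mult_carrier_mat[OF E FS] by (simp add: C_def)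
    have M: "?M = C * Q"
      using fact_select(2)[OF \<psi> i] eq assoc_mult_mat[OF E FS Q] by (simp add: C_def Q_def E_def)
    have Vi: "V i \<in> carrier_mat ?b ?q" "fact_mat \<psi> (Suc i) * V i = 1\<^sub>m ?q" using V[OF i] by auto
    have U: "fact_mat \<psi> (Suc i) = top_rows ?q C * Q"
      unfolding fact_Suc M by (rule top_rows_mult[OF C Q r_Suc_le[OF i]])
    have topC: "top_rows ?q C \<in> carrier_mat ?q ?q" using C by simp
    have QV: "Q * V i \<in> carrier_mat ?q ?q" using mult_carrier_mat[OF Q Vi(1)] .
    have "top_rows ?q C * (Q * V i) = 1\<^sub>m ?q"
      using Vi(2) unfolding U using assoc_mult_mat[OF topC Q Vi(1)] by simp
    then have "Q * V i * top_rows ?q C = 1\<^sub>m ?q"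
      by (rule mat_mult_left_right_inverse[OF topC QV])
    then have "Q * V i * fact_mat \<psi> (Suc i) = Q"
      unfolding U using assoc_mult_mat[OF QV topC Q] Q by simp
    moreover have "X i * fact_mat \<psi> (Suc i) = C * (Q * V i * fact_mat \<psi> (Suc i))"
      unfolding X(1)[OF i] M using assoc_mult_mat[OF C Q Vi(1)] assoc_mult_mat[OF C QV fact_mat_carrier] by simp
    ultimately show ?thesis using M by simp
  qed
  have "tail_vec X i = fvec \<psi> i" if "i \<le> n" for i
    using that
  proof (induction rule: inc_induct)
    case base show ?case using X(2) flat_fact[OF \<psi>] by (simp add: tail_vec_n)
  next
    case (step i)
    then have "tail X (Suc i) = fact_mat \<psi> (Suc i)" by (simp add: tail_def fact_mat_def)
    then have "tail_vec X i = flat_mat (fact_unfolding n k r \<psi> i)"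
      using step unf by (simp add: tail_vec_step)
    also have "\<dots> = fvec \<psi> i"
      unfolding fact_unfolding_eq using fvec_carrier[OF \<psi>, of i] step
      by (simp add: right_dim_Suc mult.assoc del: fact_tensor.simps)
    finally show ?case .
  qed
  from this[of 0] show "decompress n k r X = \<psi>" by (simp add: tail_vec_0)
qed

text \<open>A right inverse \<open>V\<close> of the next tail strips it off:
  \<open>tail X i\<close>, multiplied by an identity tensored with \<open>V\<close>, is the side
  unfolding of \<open>X i\<close>, in which the middle index belongs to the columns. A right inverse
  of this product yields one of \<open>tail X i\<close>.\<close>

lemma tail_right_invertible:
  assumes X: "cores X" and inv: "\<And>i. i < n \<Longrightarrow> right_invertible (unfold_vec (r i) (k i * r (Suc i)) (flat_mat (X i)))"
    and invn: "right_invertible (X n)"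
  shows "i \<le> n \<Longrightarrow> right_invertible (tail X i)"
proof (induction rule: inc_induct)
  case base show ?case using invn tail_n[OF X] by simp
next
  case (step i)
  then have i: "i < n" by simp
  have Xi: "X i \<in> carrier_mat (r i * k i) (r (Suc i))" using coresD(1)[OF X i] .
  obtain V where V: "V \<in> carrier_mat (right_dim (Suc i)) (r (Suc i))" "tail X (Suc i) * V = 1\<^sub>m (r (Suc i))"
    using step right_invertible_iff[OF tail_carrier] by blast
  let ?A = "X i * tail X (Suc i)"
  have A: "?A \<in> carrier_mat (r i * k i) (right_dim (Suc i))" by (rule core_tail_carrier[OF X i])
  have "?A * V = X i" using assoc_mult_mat[OF Xi tail_carrier V(1)] V(2) Xi by simp
  then have eq: "unfold_vec (r i) (k i * r (Suc i)) (flat_mat (X i)) = tail X i * id_kron (k i) V"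
    using unfold_mult_right[OF A V(1)] i by (simp add: tail_def[of X i] tail_vec_step right_dim_Suc)
  have "id_kron (k i) V \<in> carrier_mat (right_dim i) (k i * r (Suc i))"
    using V i by (simp add: right_dim_Suc)
  then show ?case using inv[OF i] unfolding eq by (rule right_invertible_mult[OF tail_carrier])
qed

end

section \<open>Decomposition of arbitrary tensors of the variety over the given field\<close>

lemma rank_factor_over:
  fixes M :: "complex mat"
  assumes "scalars K" and M: "M \<in> carrier_mat a b" "mat_over K M" and q: "vec_space.rank a M \<le> q"
  shows "\<exists>C\<in>carrier_mat a q. \<exists>P\<in>carrier_mat q a. mat_over K C \<and> mat_over K P \<and> M = C * (P * M)"
proof -
  interpret scalars K by fact
  define d where "d = vec_space.rank a M"
  obtain P S where P: "P \<in> carrier_mat d a" "mat_over K P" and S: "S \<in> carrier_mat b d" "mat_over K S"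
    and eq: "M * S * (P * M) = M"
    using rank_decomposition[OF M d_def] by blast
  have MS: "M * S \<in> carrier_mat a d" using M S by simp
  have KMS: "mat_over K (M * S)" by (rule mat_over_mult) (use M S in auto)
  \<comment> \<open>Zero columns and zero rows fill the inner dimension up from the rank
    \<open>d\<close> to the prescribed \<open>q\<close>.\<close>
  define C' where "C' = mat a q (\<lambda>(i, j). if j < d then (M * S) $$ (i, j) else 0)"
  define P' where "P' = mat q a (\<lambda>(i, j). if i < d then P $$ (i, j) else 0)"
  have C': "C' \<in> carrier_mat a q" "mat_over K C'" using mat_overD[OF KMS, unfolded carrier_matD[OF MS]] by (auto simp: C'_def mat_over_def simp del: index_mult_mat(1))
  have P': "P' \<in> carrier_mat q a" "mat_over K P'" using mat_overD[OF P(2)] P(1) by (auto simp: P'_def mat_over_def)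
  have "C' * P' = M * S * P"
  proof (rule eq_matI)
    fix i j assume "i < dim_row (M * S * P)" "j < dim_col (M * S * P)"
    then have ij: "i < a" "j < a" using MS P by auto
    have "(C' * P') $$ (i, j) = (\<Sum>l=0..<q. if l < d then (M * S) $$ (i, l) * P $$ (l, j) else 0)"
      using ij C' P' by (auto simp: scalar_prod_def C'_def P'_def intro!: sum.cong)
    also have "\<dots> = (\<Sum>l=0..<d. (M * S) $$ (i, l) * P $$ (l, j))"
      using q by (intro sum.mono_neutral_cong_right) (auto simp: d_def)
    also have "\<dots> = (M * S * P) $$ (i, j)" 
    proof -
      have "(D * P) $$ (i, j) = (\<Sum>l=0..<d. D $$ (i, l) * P $$ (l, j))"
        if "D \<in> carrier_mat a d" for D using ij that P by (simp add: scalar_prod_def)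
      from this[OF MS] show ?thesis ..
    qed
    finally show "(C' * P') $$ (i, j) = (M * S * P) $$ (i, j)" .
  qed (use C' P' MS P in auto)
  then have "M = C' * (P' * M)"
    using assoc_mult_mat[OF C'(1) P'(1) M(1)] assoc_mult_mat[OF MS P(1) M(1)] eq by simp
  then show ?thesis using C' P' by blast
qed

context tensor_train
begin

text \<open>The factorizations at different bonds can be chosen independently of each other, because
  \<open>C i * P i\<close> fixes \<open>flat (Suc i) \<psi>\<close>. With \<open>P\<close> of one
  bond and \<open>C\<close> of the next combined into a core, the tail at bond \<open>i\<close> is
  \<open>Q i * flat i \<psi>\<close>: passing a site only inserts \<open>C i * P i\<close> in front
  of a flattening that absorbs it.\<close>

lemma decomposition_exists:
  assumes "scalars K" and \<psi>: "\<psi> \<in> carrier_vec (right_dim 0)" "\<And>j. j < right_dim 0 \<Longrightarrow> \<psi> $ j \<in> K"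
    and rk: "\<And>i. i < n \<Longrightarrow> vec_space.rank (left_dim (Suc i)) (flat (Suc i) \<psi>) \<le> r (Suc i)"
  shows "\<exists>X. cores X \<and> (\<forall>i\<le>n. mat_over K (X i)) \<and> decompress n k r X = \<psi>"
proof -
  interpret scalars K by fact
  have Fover: "mat_over K (flat i \<psi>)" if "i \<le> n" for i
    unfolding mat_over_def
  proof (intro allI impI)
    fix a b assume "a < dim_row (flat i \<psi>)" "b < dim_col (flat i \<psi>)"
    then have ab: "a < left_dim i" "b < right_dim i" by (auto simp: flat_def)
    then have "a * right_dim i + b < right_dim 0" using index_less[OF ab] left_right_dim[OF that] by simp
    then show "flat i \<psi> $$ (a, b) \<in> K" using ab \<psi>(2) by (simp add: flat_def)
  qed
  have "\<forall>i. \<exists>C P. i < n \<longrightarrow> C \<in> carrier_mat (left_dim (Suc i)) (r (Suc i)) \<and>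
      P \<in> carrier_mat (r (Suc i)) (left_dim (Suc i)) \<and> mat_over K C \<and> mat_over K P \<and>
      flat (Suc i) \<psi> = C * (P * flat (Suc i) \<psi>)"
    using rank_factor_over[OF assms(1) flat_carrier Fover rk] by (metis Suc_leI)
  then obtain C P where CP: "\<And>i. i < n \<Longrightarrow> C i \<in> carrier_mat (left_dim (Suc i)) (r (Suc i)) \<and>
      P i \<in> carrier_mat (r (Suc i)) (left_dim (Suc i)) \<and> mat_over K (C i) \<and> mat_over K (P i) \<and>
      flat (Suc i) \<psi> = C i * (P i * flat (Suc i) \<psi>)"
    by metis
  \<comment> \<open>The bond in front of site \<open>i\<close> carries the matrix \<open>P\<close>
    with index \<open>i - 1\<close>; bond 0 is trivial.\<close>
  define Q where "Q i = (if i = 0 then 1\<^sub>m 1 else P (i - 1))" for i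
  have Q: "Q i \<in> carrier_mat (r i) (left_dim i)" "mat_over K (Q i)" if "i \<le> n" for i
    using CP[of "i - 1"] that by (auto simp: Q_def r_0 simp del: left_dim_simps(2))
  define X where "X i = (if i < n then kron_id (Q i) (k i) * C i else Q n * flat n \<psi>)" for i
  have Xc: "X i \<in> carrier_mat (r i * k i) (r (Suc i))" if "i < n" for i
    using kron_id_carrier[OF Q(1), of i "k i"] CP[OF that] that by (simp add: X_def)
  have QF: "Q i * flat i \<psi> \<in> carrier_mat (r i) (right_dim i)" if "i \<le> n" for i
    using mult_carrier_mat[OF Q(1)[OF that] flat_carrier] .
  have XC: "cores X" using Xc QF[of n] by (simp add: cores_def X_def)
  have over: "mat_over K (X i)" if "i \<le> n" for i
  proof (cases "i < n")
    case True
    have "mat_over K (kron_id (Q i) (k i))" using Q[of i] True by (intro mat_over_kron_id) auto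
    moreover have "dim_col (kron_id (Q i) (k i)) = dim_row (C i)"
      using CP[OF True] carrier_matD(2)[OF kron_id_carrier[OF Q(1), of i "k i"]] True by auto
    ultimately show ?thesis using CP[OF True] mat_over_mult True by (simp add: X_def)
  next
    case False
    then show ?thesis using Q[of n] Fover[of n] mat_over_mult[of "Q n" "flat n \<psi>"] flat_carrier[of n \<psi>]
      by (auto simp: X_def)
  qed
  have "tail_vec X i = flat_mat (Q i * flat i \<psi>)" if "i \<le> n" for i
    using that
  proof (induction rule: inc_induct)
    case base show ?case by (simp add: tail_vec_n X_def)
  next
    case (step i)
    have i: "i < n" using step by simp
    have "tail X (Suc i) = Q (Suc i) * flat (Suc i) \<psi>"
      unfolding tail_def using step QF[of "Suc i"] by simp
    then have "X i * tail X (Suc i) = kron_id (Q i) (k i) * C i * (P i * flat (Suc i) \<psi>)"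
      using i by (simp add: X_def Q_def)
    also have "\<dots> = kron_id (Q i) (k i) * (C i * (P i * flat (Suc i) \<psi>))"
      using CP[OF i] kron_id_carrier[OF Q(1), of i "k i"] i
        mult_carrier_mat[of "P i" "r (Suc i)" "left_dim (Suc i)" "flat (Suc i) \<psi>" "right_dim (Suc i)"]
      by (intro assoc_mult_mat[of _ "r i * k i" "left_dim (Suc i)" _ "r (Suc i)" _ "right_dim (Suc i)"])
        (simp_all del: left_dim_simps add: left_dim_simps(2)[symmetric])
    also have "\<dots> = kron_id (Q i) (k i) * flat (Suc i) \<psi>" using CP[OF i] by metis
    also have "\<dots> = unfold_vec (r i * k i) (right_dim (Suc i)) (flat_mat (Q i * flat i \<psi>))"
      using flat_Suc[OF i Q(1)] i by simp
    finally have "tail_vec X i = flat_mat (unfold_vec (r i * k i) (right_dim (Suc i)) (flat_mat (Q i * flat i \<psi>)))"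
      using i by (simp add: tail_vec_step)
    also have "\<dots> = flat_mat (Q i * flat i \<psi>)"
      using flat_mat_carrier[OF QF, of i] i by (intro flat_unfold) (simp add: right_dim_Suc mult.assoc)
    finally show ?case .
  qed
  from this[of 0] have "decompress n k r X = \<psi>"
    using flat_0[OF \<psi>(1)] flat_carrier[of 0 \<psi>] by (simp add: tail_vec_0 Q_def)
  then show ?thesis using XC over by blast
qed

end

section \<open>Polynomial functions and the Zariski topology\<close>

text \<open>The size is demanded at every argument and not only on representatives, since polynomial
  functions live on a whole type. \<open>trunc\<close> and \<open>pad\<close> below exist to meet
  this demand.\<close>

definition polymat :: "complex set \<Rightarrow> ('p \<Rightarrow> complex) set \<Rightarrow> nat \<Rightarrow> nat \<Rightarrow> ('p \<Rightarrow> complex mat) \<Rightarrow> bool" where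
  "polymat K C a b F \<longleftrightarrow> (\<forall>x. F x \<in> carrier_mat a b) \<and> (\<forall>i<a. \<forall>j<b. (\<lambda>x. F x $$ (i, j)) \<in> polyfun K C)"

definition polyvec :: "complex set \<Rightarrow> ('p \<Rightarrow> complex) set \<Rightarrow> nat \<Rightarrow> ('p \<Rightarrow> complex vec) \<Rightarrow> bool" where
  "polyvec K C d f \<longleftrightarrow> (\<forall>x. f x \<in> carrier_vec d) \<and> (\<forall>i<d. (\<lambda>x. f x $ i) \<in> polyfun K C)"

lemma polyfun_cong:
  assumes "p \<in> polyfun K C" "\<And>c. c \<in> C \<Longrightarrow> c x = c y" shows "p x = p y"
  using assms(1) by induction (auto simp: assms(2))

lemma polyfun_compose:
  assumes "p \<in> polyfun K C" "\<And>c. c \<in> C \<Longrightarrow> (\<lambda>x. c (g x)) \<in> polyfun K C'"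
  shows "(\<lambda>x. p (g x)) \<in> polyfun K C'"
  using assms(1) by induction (simp_all add: polyfun.const polyfun.add polyfun.mult assms(2))

lemma polyfun_poly:
  assumes "p \<in> polyfun K C" "\<And>c. c \<in> C \<Longrightarrow> \<exists>q. \<forall>t. c (\<gamma> t) = poly q t"
  shows "\<exists>q. \<forall>t. p (\<gamma> t) = poly q t"
  using assms(1)
proof induction
  case (const a) show ?case by (intro exI[of _ "[:a:]"]) simp
next
  case (add p q)
  then obtain f g where "\<forall>t. p (\<gamma> t) = poly f t" "\<forall>t. q (\<gamma> t) = poly g t" by blast
  then show ?case by (intro exI[of _ "f + g"]) simp
next
  case (mult p q)
  then obtain f g where "\<forall>t. p (\<gamma> t) = poly f t" "\<forall>t. q (\<gamma> t) = poly g t" by blast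
  then show ?case by (intro exI[of _ "f * g"]) simp
qed (rule assms(2))

text \<open>The product has finitely many roots. The parameter is sought among the natural numbers
  because they lie in either field, so that a point of a line over \<open>K\<close> stays over
  \<open>K\<close>.\<close>

lemma poly_common_nonroot:
  fixes f g :: "complex poly"
  assumes "f \<noteq> 0" "g \<noteq> 0"
  shows "\<exists>m :: nat. poly f (of_nat m) \<noteq> 0 \<and> poly g (of_nat m) \<noteq> 0"
proof (rule ccontr)
  assume "\<not> ?thesis"
  then have "range (of_nat :: nat \<Rightarrow> complex) \<subseteq> {z. poly (f * g) z = 0}" by auto
  moreover have "finite {z. poly (f * g) z = 0}" using assms by (intro poly_roots_finite) simp
  ultimately have "finite (range (of_nat :: nat \<Rightarrow> complex))" by (rule finite_subset)
  then have "finite (UNIV :: nat set)" by (rule finite_imageD) (simp add: inj_on_def)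
  then show False by simp
qed

context scalars
begin

lemma polyfun_eval:
  assumes "p \<in> polyfun K C" "\<And>c. c \<in> C \<Longrightarrow> c x \<in> K" shows "p x \<in> K"
  using assms(1) by induction (auto simp: assms(2))

lemma polyfun_sum: "(\<And>i. i \<in> I \<Longrightarrow> f i \<in> polyfun K C) \<Longrightarrow> (\<lambda>x. \<Sum>i\<in>I. f i x) \<in> polyfun K C"
  by (induction I rule: infinite_finite_induct) (simp_all add: polyfun.const polyfun.add)

lemma polyfun_prod: "(\<And>i. i \<in> I \<Longrightarrow> f i \<in> polyfun K C) \<Longrightarrow> (\<lambda>x. \<Prod>i\<in>I. f i x) \<in> polyfun K C"
  by (induction I rule: infinite_finite_induct) (simp_all add: polyfun.const polyfun.mult)

lemma polymatD:
  assumes "polymat K C a b F"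
  shows "F x \<in> carrier_mat a b" "i < a \<Longrightarrow> j < b \<Longrightarrow> (\<lambda>x. F x $$ (i, j)) \<in> polyfun K C"
  using assms by (auto simp: polymat_def)

lemma polymat_const: "M \<in> carrier_mat a b \<Longrightarrow> mat_over K M \<Longrightarrow> polymat K C a b (\<lambda>_. M)"
  by (simp add: polymat_def mat_over_def polyfun.const)

lemma polymat_mult:
  assumes F: "polymat K C a b F" and G: "polymat K C b c G"
  shows "polymat K C a c (\<lambda>x. F x * G x)"
  unfolding polymat_def
proof (intro conjI allI impI)
  fix x show "F x * G x \<in> carrier_mat a c" using polymatD(1)[OF F] polymatD(1)[OF G] by (rule mult_carrier_mat)
next
  fix i j assume ij: "i < a" "j < c"
  have "(F x * G x) $$ (i, j) = (\<Sum>l=0..<b. F x $$ (i, l) * G x $$ (l, j))" for x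
    using ij polymatD(1)[OF F, of x] polymatD(1)[OF G, of x] by (simp add: scalar_prod_def)
  then show "(\<lambda>x. (F x * G x) $$ (i, j)) \<in> polyfun K C"
    using ij by (auto intro!: polyfun_sum polyfun.mult polymatD(2)[OF F] polymatD(2)[OF G])
qed

lemma polymat_top_rows:
  assumes F: "polymat K C a b F" and q: "q \<le> a"
  shows "polymat K C q b (\<lambda>x. top_rows q (F x))"
  using q polymatD(2)[OF F] by (auto simp: polymat_def top_rows_def carrier_matD[OF polymatD(1)[OF F]])

lemma polymat_unfold:
  assumes f: "polyvec K C (a * b) f" shows "polymat K C a b (\<lambda>x. unfold_vec a b (f x))"
  unfolding polymat_def
proof (intro conjI allI impI)
  fix i j assume "i < a" "j < b"
  then show "(\<lambda>x. unfold_vec a b (f x) $$ (i, j)) \<in> polyfun K C"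
    using f index_less[of i a j b] by (simp add: polyvec_def)
qed simp

lemma polyvec_flat:
  assumes F: "polymat K C a b F" shows "polyvec K C (a * b) (\<lambda>x. flat_mat (F x))"
  unfolding polyvec_def
proof (intro conjI allI impI)
  fix x show "flat_mat (F x) \<in> carrier_vec (a * b)" using polymatD(1)[OF F] by (rule flat_mat_carrier)
next
  fix i assume i: "i < a * b"
  have "flat_mat (F x) $ i = F x $$ (i div b, i mod b)" for x
    using i polymatD(1)[OF F, of x] by (simp add: flat_mat_def)
  then show "(\<lambda>x. flat_mat (F x) $ i) \<in> polyfun K C"
    using polymatD(2)[OF F] index_split[OF i] by simp
qed

lemma polyfun_det:
  assumes F: "polymat K C q q F" shows "(\<lambda>x. det (F x)) \<in> polyfun K C"
proof -
  have "det (F x) = (\<Sum>p | p permutes {0..<q}. signof p * (\<Prod>i=0..<q. F x $$ (i, p i)))" for x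
    by (rule det_def'[OF polymatD(1)[OF F]])
  moreover have "signof p \<in> K" for p :: "nat \<Rightarrow> nat" by (simp add: sign_def)
  moreover have "p i < q" if "p permutes {0..<q}" "i < q" for p i
    using permutes_in_image[OF that(1), of i] that(2) by simp
  ultimately show ?thesis
    by (simp, intro polyfun_sum polyfun.mult polyfun_prod polyfun.const polymatD(2)[OF F]) auto
qed

lemma polymat_adj_mat:
  assumes F: "polymat K C q q F" shows "polymat K C q q (\<lambda>x. adj_mat (F x))"
  unfolding polymat_def
proof (intro conjI allI impI)
  fix x show "adj_mat (F x) \<in> carrier_mat q q" using adj_mat(1)[OF polymatD(1)[OF F]] .
next
  fix i j assume ij: "i < q" "j < q"
  have "polymat K C (q - 1) (q - 1) (\<lambda>x. mat_delete (F x) j i)"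
    using polymatD(2)[OF F] ij
    by (auto simp: polymat_def mat_delete_def carrier_matD[OF polymatD(1)[OF F]] intro!: carrier_matI)
  then have "(\<lambda>x. (- 1) ^ (j + i) * det (mat_delete (F x) j i)) \<in> polyfun K C"
    using K by (intro polyfun.mult polyfun.const polyfun_det) auto
  moreover have "adj_mat (F x) $$ (i, j) = (- 1) ^ (j + i) * det (mat_delete (F x) j i)" for x
    using ij polymatD(1)[OF F, of x] by (simp add: adj_mat_def cofactor_def)
  ultimately show "(\<lambda>x. adj_mat (F x) $$ (i, j)) \<in> polyfun K C" by simp
qed

lemma mat_over_polymat:
  assumes "polymat K C a b F" "\<And>c. c \<in> C \<Longrightarrow> c x \<in> K" shows "mat_over K (F x)"
  unfolding mat_over_def carrier_matD[OF polymatD(1)[OF assms(1)]]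
proof (intro allI impI)
  fix i j assume "i < a" "j < b"
  then have "(\<lambda>x. F x $$ (i, j)) \<in> polyfun K C" by (rule polymatD(2)[OF assms(1)])
  then show "F x $$ (i, j) \<in> K" by (rule polyfun_eval) (rule assms(2))
qed

lemma is_zariski_open_nonvanishing:
  assumes "P \<subseteq> polyfun K (coords X)"
    and "\<And>x. x \<in> reps_over K X \<Longrightarrow> pt X x \<in> U \<longleftrightarrow> (\<exists>p\<in>P. p x \<noteq> 0)"
    and "U \<subseteq> points_over K X"
  shows "openin (zariski K X) U"
  unfolding openin_zariski is_zariski_open_def
  using assms(1,3) by (intro conjI exI[of _ P]) (simp_all add: assms(2) cong: conj_cong)

text \<open>Near a given representative an open set contains the nonvanishing locus of a single
  polynomial. Density thus reduces to moving a point of \<open>S\<close> with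
  \<open>p x \<noteq> 0\<close> to a point of \<open>A\<close> at which the same \<open>p\<close>
  does not vanish, one polynomial at a time.\<close>

lemma dense_open_in_zariskiI:
  assumes S: "S \<subseteq> points_over K X" and W: "openin (zariski K X) W" and A: "A = S \<inter> W"
    and dense: "\<And>x p. x \<in> reps_over K X \<Longrightarrow> pt X x \<in> S \<Longrightarrow> p \<in> polyfun K (coords X) \<Longrightarrow> p x \<noteq> 0 \<Longrightarrow>
      \<exists>y\<in>reps_over K X. p y \<noteq> 0 \<and> pt X y \<in> A"
  shows "dense_open_in (zariski K X) S A"
  unfolding dense_open_in_def
proof
  show "openin (subtopology (zariski K X) S) A"
    unfolding openin_subtopology using W A by blast
  have top: "topspace (subtopology (zariski K X) S) = S"
    using S by (auto simp: topspace_zariski)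
  show "subtopology (zariski K X) S closure_of A = S"
  proof
    show "subtopology (zariski K X) S closure_of A \<subseteq> S"
      using closure_of_subset_topspace[of "subtopology (zariski K X) S" A] top by simp
    show "S \<subseteq> subtopology (zariski K X) S closure_of A"
    proof
      fix z assume z: "z \<in> S"
      have meet: "\<exists>y\<in>A. y \<in> T" if zT: "z \<in> T" and T: "openin (subtopology (zariski K X) S) T" for T
      proof -
        obtain U where U: "is_zariski_open K X U" "T = U \<inter> S"
          using T unfolding openin_subtopology openin_zariski by blast
        obtain P where P: "P \<subseteq> polyfun K (coords X)"
          "{x \<in> reps_over K X. pt X x \<in> U} = {x \<in> reps_over K X. \<exists>p\<in>P. p x \<noteq> 0}"
          using U(1) unfolding is_zariski_open_def by blast
        obtain x where x: "x \<in> reps_over K X" "z = pt X x" using z S by (auto simp: points_over_def)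
        then obtain p where p: "p \<in> P" "p x \<noteq> 0" using P(2) zT U(2) by blast
        then obtain y where y: "y \<in> reps_over K X" "p y \<noteq> 0" "pt X y \<in> A"
          using dense[OF x(1), of p] z x(2) P(1) by blast
        then have "pt X y \<in> U" using P(2) p(1) by blast
        then show ?thesis using y A U(2) by blast
      qed
      then show "z \<in> subtopology (zariski K X) S closure_of A"
        unfolding in_closure_of top using z meet by blast
    qed
  qed
qed

end

section \<open>The parametrization\<close>

lemma right_invertible_smult:
  assumes M: "M \<in> carrier_mat q m" and c: "c \<noteq> 0" and inv: "right_invertible M"
  shows "right_invertible (c \<cdot>\<^sub>m M)"
proof -
  obtain Q where Q: "Q \<in> carrier_mat m q" "M * Q = 1\<^sub>m q" using inv right_invertible_iff[OF M] by blast
  have "(c \<cdot>\<^sub>m M) * (inverse c \<cdot>\<^sub>m Q) = inverse c \<cdot>\<^sub>m (c \<cdot>\<^sub>m M * Q)"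
    using M Q by (intro mult_smult_distrib) auto
  also have "\<dots> = inverse c \<cdot>\<^sub>m (c \<cdot>\<^sub>m 1\<^sub>m q)" using mult_smult_assoc_mat[OF M Q(1)] Q(2) by simp
  also have "\<dots> = 1\<^sub>m q" using c by (intro eq_matI) auto
  finally show ?thesis using M Q by (subst right_invertible_iff[of _ q m]) (auto intro!: bexI[of _ "inverse c \<cdot>\<^sub>m Q"])
qed

lemma smult_mat_inverse: "c \<noteq> 0 \<Longrightarrow> inverse c \<cdot>\<^sub>m (c \<cdot>\<^sub>m M) = (M :: complex mat)"
  by (intro eq_matI) auto

lemma smult_vec_inverse: "c \<noteq> 0 \<Longrightarrow> inverse c \<cdot>\<^sub>v (c \<cdot>\<^sub>v v) = (v :: complex vec)"
  by (intro eq_vecI) auto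

lemma rank_smult:
  fixes M :: "complex mat"
  assumes M: "M \<in> carrier_mat a b" and c: "c \<noteq> 0"
  shows "vec_space.rank a (c \<cdot>\<^sub>m M) = vec_space.rank a M"
proof -
  have le: "vec_space.rank a (d \<cdot>\<^sub>m N) \<le> vec_space.rank a N" if N: "N \<in> carrier_mat a b" for d and N :: "complex mat"
  proof -
    let ?d = "vec_space.rank a N"
    obtain P S where P: "P \<in> carrier_mat ?d a" and S: "S \<in> carrier_mat b ?d" and eq: "N * S * (P * N) = N"
      using rank_decomp[OF N] by blast
    have NS: "N * S \<in> carrier_mat a ?d" and PN: "P * N \<in> carrier_mat ?d b" using N P S by auto
    have "d \<cdot>\<^sub>m N = (d \<cdot>\<^sub>m (N * S)) * (P * N)" using mult_smult_assoc_mat[OF NS PN] eq by simp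
    then show ?thesis using rank_le_factor[of "d \<cdot>\<^sub>m (N * S)" a ?d "P * N" b] NS PN by simp
  qed
  show ?thesis
    using le[OF M, of c] le[of "c \<cdot>\<^sub>m M" "inverse c"] M smult_mat_inverse[OF c] by (simp add: order_antisym)
qed

lemma proj_vec_eq_iff: "proj_vec v = proj_vec w \<longleftrightarrow> (\<exists>c. c \<noteq> 0 \<and> w = c \<cdot>\<^sub>v v)"
proof
  assume "proj_vec v = proj_vec w"
  moreover have "w \<in> proj_vec w" unfolding proj_vec_def by (force intro: exI[of _ 1])
  ultimately show "\<exists>c. c \<noteq> 0 \<and> w = c \<cdot>\<^sub>v v" by (auto simp: proj_vec_def)
next
  assume "\<exists>c. c \<noteq> 0 \<and> w = c \<cdot>\<^sub>v v"
  then obtain c where c: "c \<noteq> 0" "w = c \<cdot>\<^sub>v v" by blast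
  have "d \<cdot>\<^sub>v v = (d / c) \<cdot>\<^sub>v w" for d unfolding c(2) using c(1) by (intro eq_vecI) auto
  moreover have "d \<cdot>\<^sub>v w = (d * c) \<cdot>\<^sub>v v" for d unfolding c(2) by (intro eq_vecI) auto
  ultimately show "proj_vec v = proj_vec w"
    unfolding proj_vec_def using c(1) by (auto; metis divide_eq_0_iff mult_eq_0_iff)
qed

lemma proj_mat_eq_iff: "proj_mat A = proj_mat B \<longleftrightarrow> (\<exists>c. c \<noteq> 0 \<and> B = c \<cdot>\<^sub>m A)"
proof
  assume "proj_mat A = proj_mat B"
  moreover have "B = 1 \<cdot>\<^sub>m B" by (intro eq_matI) auto
  then have "B \<in> proj_mat B" unfolding proj_mat_def by (auto intro!: exI[of _ 1])
  ultimately show "\<exists>c. c \<noteq> 0 \<and> B = c \<cdot>\<^sub>m A" by (auto simp: proj_mat_def)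
next
  assume "\<exists>c. c \<noteq> 0 \<and> B = c \<cdot>\<^sub>m A"
  then obtain c where c: "c \<noteq> 0" "B = c \<cdot>\<^sub>m A" by blast
  have "d \<cdot>\<^sub>m A = (d / c) \<cdot>\<^sub>m B" for d unfolding c(2) using c(1) by (intro eq_matI) auto
  moreover have "d \<cdot>\<^sub>m B = (d * c) \<cdot>\<^sub>m A" for d unfolding c(2) by (intro eq_matI) auto
  ultimately show "proj_mat A = proj_mat B"
    unfolding proj_mat_def using c(1) by (auto; metis divide_eq_0_iff mult_eq_0_iff)
qed

lemma top_invertible_full_rank:
  fixes A :: "complex mat"
  assumes A: "A \<in> carrier_mat m q" and q: "q \<le> m" and inv: "det (top_rows q A) \<noteq> 0"
  shows "vec_space.rank m A = q"
proof -
  have top: "top_rows q A \<in> carrier_mat q q" using A by simp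
  obtain S where S: "S \<in> carrier_mat q q" "top_rows q A * S = 1\<^sub>m q"
    using inv right_invertible_square[OF top] right_invertible_iff[OF top] by blast
  have "top_rows q (1\<^sub>m m) * A = top_rows q A"
    using top_rows_mult[OF one_carrier_mat A q] A by simp
  then have "q \<le> vec_space.rank m A"
    using rank_ge_unit[OF A top_rows_carrier[OF one_carrier_mat] S(1)] S(2) by simp
  then show ?thesis using vec_space.rank_le_nc[OF A] by simp
qed

lemma right_invertible_nonzero:
  assumes inv: "right_invertible M" and M: "M \<in> carrier_mat q m" and q: "0 < q"
  shows "M \<noteq> 0\<^sub>m q m"
proof
  assume "M = 0\<^sub>m q m"
  moreover obtain S where "S \<in> carrier_mat m q" "M * S = 1\<^sub>m q"
    using inv right_invertible_iff[OF M] by blast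
  ultimately have "(1\<^sub>m q :: complex mat) $$ (0, 0) = 0\<^sub>m q q $$ (0, 0)" by simp
  then show False using q by simp
qed

lemma row_right_invertible:
  assumes M: "M \<in> carrier_mat 1 m" and nz: "M \<noteq> 0\<^sub>m 1 m"
  shows "right_invertible M"
proof -
  obtain j where j: "j < m" "M $$ (0, j) \<noteq> 0"
  proof (rule ccontr)
    assume "\<not> thesis"
    then have "M = 0\<^sub>m 1 m" using M that by (intro eq_matI) auto
    then show False using nz by simp
  qed
  define Q where "Q = mat m 1 (\<lambda>(l, _). if l = j then inverse (M $$ (0, j)) else 0)"
  have "M * Q = 1\<^sub>m 1"
  proof (rule eq_matI)
    fix a b assume "a < dim_row (1\<^sub>m 1 :: complex mat)" "b < dim_col (1\<^sub>m 1 :: complex mat)"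
    then have ab: "a = 0" "b = 0" by auto
    have "(M * Q) $$ (0, 0) = (\<Sum>l=0..<m. M $$ (0, l) * (if l = j then inverse (M $$ (0, j)) else 0))"
      using M by (simp add: scalar_prod_def Q_def)
    also have "\<dots> = M $$ (0, j) * inverse (M $$ (0, j))" using j by (simp add: if_distrib cong: if_cong)
    finally show "(M * Q) $$ (a, b) = 1\<^sub>m 1 $$ (a, b)" using j ab by simp
  qed (use M in \<open>auto simp: Q_def\<close>)
  then show ?thesis unfolding right_invertible_iff[OF M] by (auto simp: Q_def intro!: bexI[of _ Q])
qed

definition unit_block :: "nat \<Rightarrow> nat \<Rightarrow> complex mat" where
  "unit_block a b = mat a b (\<lambda>(i, j). if i = j then 1 else 0)"

lemma unit_block_carrier [simp]: "unit_block a b \<in> carrier_mat a b"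
  by (simp add: unit_block_def)

lemma unit_block_mult: "q \<le> m \<Longrightarrow> unit_block q m * unit_block m q = 1\<^sub>m q"
proof (rule eq_matI)
  fix i j assume q: "q \<le> m" and "i < dim_row (1\<^sub>m q :: complex mat)" "j < dim_col (1\<^sub>m q :: complex mat)"
  then have ij: "i < q" "j < q" by auto
  have "(unit_block q m * unit_block m q) $$ (i, j) =
      (\<Sum>l=0..<m. (if i = l then 1 else 0) * (if l = j then 1 else 0))"
    using ij by (simp add: scalar_prod_def unit_block_def)
  also have "\<dots> = (\<Sum>l=0..<m. if l = i then (if i = j then 1 else 0) else 0)"
    by (intro sum.cong) auto
  also have "\<dots> = 1\<^sub>m q $$ (i, j)" using ij q by simp
  finally show "(unit_block q m * unit_block m q) $$ (i, j) = 1\<^sub>m q $$ (i, j)" .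
qed (simp_all add: unit_block_def)

lemma (in scalars) mat_over_unit_block: "mat_over K (unit_block a b)"
  by (simp add: mat_over_def unit_block_def)

context tensor_train
begin

declare left_dim_simps [simp del]

abbreviation PS where "PS \<equiv> param_space n k r"
abbreviation TS where "TS \<equiv> tensor_space n k"

section \<open>Variety, manifold and open set in terms of representing tensors\<close>

lemma reps_tensor: "reps TS = carrier_vec (right_dim 0) - {0\<^sub>v (right_dim 0)}"
  by (simp add: tensor_space_def right_dim_def)

lemma coords_tensor: "coords TS = {\<lambda>v. v $ j | j. j < right_dim 0}"
  by (simp add: tensor_space_def right_dim_def)

lemma pt_tensor [simp]: "pt TS = proj_vec"
  by (simp add: tensor_space_def)

lemma reps_tensor_smult: "\<psi> \<in> reps TS \<Longrightarrow> c \<noteq> 0 \<Longrightarrow> c \<cdot>\<^sub>v \<psi> \<in> reps TS"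
proof -
  assume \<psi>: "\<psi> \<in> reps TS" and c: "c \<noteq> 0"
  have "c \<cdot>\<^sub>v \<psi> \<noteq> 0\<^sub>v (right_dim 0)"
  proof
    assume "c \<cdot>\<^sub>v \<psi> = 0\<^sub>v (right_dim 0)"
    then have "\<psi> = inverse c \<cdot>\<^sub>v 0\<^sub>v (right_dim 0)" using smult_vec_inverse[OF c, of \<psi>] by simp
    also have "\<dots> = 0\<^sub>v (right_dim 0)" by (intro eq_vecI) auto
    finally show False using \<psi> by (simp add: reps_tensor)
  qed
  then show ?thesis using \<psi> by (simp add: reps_tensor)
qed

lemma rank_flat_smult:
  assumes "\<psi> \<in> reps TS" "c \<noteq> 0" "i \<le> n"
  shows "vec_space.rank (left_dim i) (flat i (c \<cdot>\<^sub>v \<psi>)) = vec_space.rank (left_dim i) (flat i \<psi>)"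
  using assms rank_smult[OF flat_carrier assms(2), of i \<psi>] left_right_dim[OF assms(3)]
  by (simp add: flat_def reps_tensor unfold_vec_smult)

lemma variety_iff:
  assumes \<psi>: "\<psi> \<in> reps TS"
  shows "proj_vec \<psi> \<in> tt_variety n k r \<longleftrightarrow>
    (\<forall>i<n. vec_space.rank (left_dim (Suc i)) (flat (Suc i) \<psi>) \<le> r (Suc i))"
proof -
  have dim: "(\<Prod>j=0..i. k j) = left_dim (Suc i)" for i
    by (simp add: left_dim_def lessThan_Suc_atMost atLeast0AtMost del: left_dim_simps)
  show ?thesis (is "_ \<longleftrightarrow> ?R \<psi>")
  proof
    assume "proj_vec \<psi> \<in> tt_variety n k r"
    then obtain \<phi> where \<phi>: "\<phi> \<in> reps TS" "proj_vec \<psi> = proj_vec \<phi>" "?R \<phi>"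
      unfolding tt_variety_def flattening_eq dim by blast
    then obtain c where "c \<noteq> 0" "\<phi> = c \<cdot>\<^sub>v \<psi>" unfolding proj_vec_eq_iff by blast
    then show "?R \<psi>" using \<phi>(3) rank_flat_smult[OF \<psi>, of c] by simp
  next
    assume "?R \<psi>" then show "proj_vec \<psi> \<in> tt_variety n k r"
      using \<psi> unfolding tt_variety_def flattening_eq dim by blast
  qed
qed

lemma manifold_iff:
  assumes \<psi>: "\<psi> \<in> reps TS"
  shows "proj_vec \<psi> \<in> tt_manifold n k r \<longleftrightarrow>
    (\<forall>i<n. vec_space.rank (left_dim (Suc i)) (flat (Suc i) \<psi>) = r (Suc i))"
proof -
  have dim: "(\<Prod>j=0..i. k j) = left_dim (Suc i)" for i
    by (simp add: left_dim_def lessThan_Suc_atMost atLeast0AtMost del: left_dim_simps)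
  show ?thesis (is "_ \<longleftrightarrow> ?R \<psi>")
  proof
    assume "proj_vec \<psi> \<in> tt_manifold n k r"
    then obtain \<phi> where \<phi>: "\<phi> \<in> reps TS" "proj_vec \<psi> = proj_vec \<phi>" "?R \<phi>"
      unfolding tt_manifold_def flattening_eq dim by blast
    then obtain c where "c \<noteq> 0" "\<phi> = c \<cdot>\<^sub>v \<psi>" unfolding proj_vec_eq_iff by blast
    then show "?R \<psi>" using \<phi>(3) rank_flat_smult[OF \<psi>, of c] by simp
  next
    assume "?R \<psi>" then show "proj_vec \<psi> \<in> tt_manifold n k r"
      using \<psi> unfolding tt_manifold_def flattening_eq dim by blast
  qed
qed

lemma manifold_subset_variety: "tt_manifold n k r \<subseteq> tt_variety n k r"
  unfolding tt_manifold_def tt_variety_def by fastforce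

text \<open>The rows picked by the factorization algorithm are rows of the flattenings, so their
  independence already bounds the ranks of the flattenings from below.\<close>

lemma open_iff:
  assumes \<psi>: "\<psi> \<in> reps TS"
  shows "proj_vec \<psi> \<in> tt_open n k r \<longleftrightarrow> proj_vec \<psi> \<in> tt_variety n k r \<and>
    (\<forall>i<n. right_invertible (fact_mat \<psi> (Suc i)))"
proof -
  have dim: "\<psi> \<in> carrier_vec (right_dim 0)" using \<psi> by (simp add: reps_tensor)
  have first: "lin_indpt_first_rows (r (Suc i)) (fact_unfolding n k r \<phi> i) \<longleftrightarrow> right_invertible (fact_mat \<phi> (Suc i))"
    if "i < n" for i \<phi>
    unfolding fact_Suc by (rule lin_indpt_first_rows_iff[OF fact_unfolding_carrier r_Suc_le[OF that]])
  show ?thesis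
  proof
    assume "proj_vec \<psi> \<in> tt_open n k r"
    then obtain \<phi> where \<phi>: "\<phi> \<in> reps TS" "proj_vec \<phi> = proj_vec \<psi>" "proj_vec \<phi> \<in> tt_manifold n k r"
      "\<forall>i<n. lin_indpt_first_rows (r (Suc i)) (fact_unfolding n k r \<phi> i)"
      unfolding tt_open_def by force
    obtain c where c: "c \<noteq> 0" "\<psi> = c \<cdot>\<^sub>v \<phi>" using \<phi>(2) unfolding proj_vec_eq_iff by blast
    have \<phi>d: "\<phi> \<in> carrier_vec (right_dim 0)" using \<phi> by (simp add: reps_tensor)
    have "right_invertible (fact_mat \<psi> (Suc i))" if "i < n" for i
      unfolding c(2) using fact_smult[OF \<phi>d, of "Suc i" c] right_invertible_smult[OF fact_mat_carrier c(1)]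
        \<phi>(4) first that by simp
    then show "proj_vec \<psi> \<in> tt_variety n k r \<and> (\<forall>i<n. right_invertible (fact_mat \<psi> (Suc i)))"
      using \<phi>(2,3) manifold_subset_variety by auto
  next
    assume R: "proj_vec \<psi> \<in> tt_variety n k r \<and> (\<forall>i<n. right_invertible (fact_mat \<psi> (Suc i)))"
    have "proj_vec \<psi> \<in> tt_manifold n k r"
      unfolding manifold_iff[OF \<psi>]
    proof (intro allI impI)
      fix i assume i: "i < n"
      show "vec_space.rank (left_dim (Suc i)) (flat (Suc i) \<psi>) = r (Suc i)"
        using R i variety_iff[OF \<psi>] rank_flat_ge[OF dim, of "Suc i"] by (metis Suc_leI le_antisym)
    qed
    then show "proj_vec \<psi> \<in> tt_open n k r"
      using R first \<psi> unfolding tt_open_def by blast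
  qed
qed

lemma fact_mat_0_right_invertible:
  assumes \<psi>: "\<psi> \<in> reps TS" shows "right_invertible (fact_mat \<psi> 0)"
proof -
  have c: "fact_mat \<psi> 0 \<in> carrier_mat 1 (right_dim 0)" using fact_mat_carrier[of \<psi> 0] by (simp add: r_0)
  have "fact_mat \<psi> 0 \<noteq> 0\<^sub>m 1 (right_dim 0)"
  proof
    assume "fact_mat \<psi> 0 = 0\<^sub>m 1 (right_dim 0)"
    then have "flat_mat (fact_mat \<psi> 0) = flat_mat (0\<^sub>m 1 (right_dim 0))" by simp
    also have "\<dots> = 0\<^sub>v (right_dim 0)" by (intro eq_vecI) (auto simp: flat_mat_def)
    finally show False using flat_fact[of \<psi> 0] \<psi> by (simp add: reps_tensor)
  qed
  then show ?thesis by (rule row_right_invertible[OF c])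
qed

text \<open>For \<open>n = 0\<close> there is no rank condition to draw on; the last matrix is then
  \<open>\<psi>\<close> itself, a nonzero row.\<close>

lemma fact_n_right_invertible:
  assumes "\<psi> \<in> reps TS" "proj_vec \<psi> \<in> tt_open n k r" shows "right_invertible (fact_mat \<psi> n)"
proof (cases n)
  case 0 then show ?thesis using fact_mat_0_right_invertible[OF assms(1)] by simp
next
  case (Suc m) then show ?thesis using open_iff[OF assms(1)] assms(2) by simp
qed

section \<open>Representatives of parameters and their normal forms\<close>

lemma reps_param:
  "A \<in> reps PS \<longleftrightarrow> cores A \<and> (\<forall>i<n. vec_space.rank (r i * k i) (A i) = r (Suc i)) \<and> A n \<noteq> 0\<^sub>m (r n) (k n)"
  by (auto simp: param_space_def cores_def)

lemma pt_param: "pt PS A = (\<lambda>i\<in>{1..n}. vec_space.col_space (r (i - 1) * k (i - 1)) (A (i - 1)), proj_mat (A n))"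
  by (simp add: param_space_def)

text \<open>Leaves cores unchanged, but has the right sizes at every argument, so that its entries
  and those of products are polynomial functions.\<close>

definition trunc :: "(nat \<Rightarrow> complex mat) \<Rightarrow> nat \<Rightarrow> complex mat" where
  "trunc A i = (if i < n then mat (r i * k i) (r (Suc i)) (\<lambda>ab. A i $$ ab)
     else mat (r n) (k n) (\<lambda>ab. A n $$ ab))"

lemma cores_trunc: "cores (trunc A)"
  by (simp add: cores_def trunc_def)

lemma trunc_eq: "cores A \<Longrightarrow> i \<le> n \<Longrightarrow> trunc A i = A i"
  by (auto simp: cores_def trunc_def intro!: eq_matI)

lemma tail_vec_cong:
  assumes "\<And>i. i \<le> n \<Longrightarrow> X i = Y i" shows "i \<le> n \<Longrightarrow> tail_vec X i = tail_vec Y i"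
proof (induction rule: inc_induct)
  case base show ?case using assms by (simp add: tail_vec_n)
next
  case (step i) then show ?case using assms[of i] by (simp add: tail_vec_step tail_def)
qed

lemma decompress_cong: "(\<And>i. i \<le> n \<Longrightarrow> X i = Y i) \<Longrightarrow> decompress n k r X = decompress n k r Y"
  using tail_vec_cong[of X Y 0] by (simp add: tail_vec_0)

abbreviation top_block :: "(nat \<Rightarrow> complex mat) \<Rightarrow> nat \<Rightarrow> complex mat" where
  "top_block A i \<equiv> top_rows (r (Suc i)) (A i)"

lemma top_block_carrier: "cores A \<Longrightarrow> i < n \<Longrightarrow> top_block A i \<in> carrier_mat (r (Suc i)) (r (Suc i))"
  using top_rows_carrier coresD(1) by blast

text \<open>Multiplication by adjugates normalizes the top blocks up to scalars without introducing denominators.\<close>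

definition gauge :: "(nat \<Rightarrow> complex mat) \<Rightarrow> nat \<Rightarrow> complex mat" where
  "gauge A i = (if i < n then trunc A i * adj_mat (top_block (trunc A) i) else trunc A n)"

definition normal_cores :: "(nat \<Rightarrow> complex mat) \<Rightarrow> nat \<Rightarrow> complex mat" where
  "normal_cores A i = (if i < n then inverse (det (top_block (trunc A) i)) else 1) \<cdot>\<^sub>m gauge A i"

lemma cores_gauge: "cores (gauge A)"
  using coresD(2)[OF cores_trunc, of A]
    mult_carrier_mat[OF coresD(1)[OF cores_trunc] adj_mat(1)[OF top_block_carrier[OF cores_trunc]]]
  by (simp add: cores_def gauge_def)

text \<open>The inverse determinants collect into one scalar. Where they do not vanish, the
  polynomial family \<open>gauge A\<close> and the normal forms therefore decompress to the same
  projective point.\<close>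

lemma decompress_normal_cores:
  "decompress n k r (normal_cores A) =
    (\<Prod>i=0..n. if i < n then inverse (det (top_block (trunc A) i)) else 1) \<cdot>\<^sub>v decompress n k r (gauge A)"
  using tail_smult[OF cores_gauge[of A], of 0 "\<lambda>i. if i < n then inverse (det (top_block (trunc A) i)) else 1"]
  by (simp add: tail_vec_0 normal_cores_def[abs_def])

lemma normal_cores:
  assumes A: "cores A" and dets: "\<forall>i<n. det (top_block A i) \<noteq> 0"
  shows "normalized (normal_cores A)" "normal_cores A n = A n"
    "\<And>i. i < n \<Longrightarrow> vec_space.col_space (r i * k i) (normal_cores A i) = vec_space.col_space (r i * k i) (A i)"
    "\<And>i. i < n \<Longrightarrow> normal_form (r (Suc i)) (r i * k i) (vec_space.col_space (r i * k i) (A i)) = normal_cores A i"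
    "\<And>i. i < n \<Longrightarrow> A i = normal_cores A i * top_block A i"
proof -
  define H where "H i = inverse (det (top_block A i)) \<cdot>\<^sub>m adj_mat (top_block A i)" for i
  have det: "det (top_block A i) \<noteq> 0" if "i < n" for i using dets that by blast
  have Ai: "A i \<in> carrier_mat (r i * k i) (r (Suc i))" if "i < n" for i using coresD(1)[OF A that] .
  have top: "top_block A i \<in> carrier_mat (r (Suc i)) (r (Suc i))" if "i < n" for i
    using top_block_carrier[OF A that] .
  have H: "H i \<in> carrier_mat (r (Suc i)) (r (Suc i))" if "i < n" for i
    using adj_mat(1)[OF top[OF that]] by (simp add: H_def)
  have inv: "inverse (det (top_block A i)) \<cdot>\<^sub>m (det (top_block A i) \<cdot>\<^sub>m 1\<^sub>m (r (Suc i))) = 1\<^sub>m (r (Suc i))" if "i < n" for i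
    by (rule smult_mat_inverse[OF det[OF that]])
  have GH: "top_block A i * H i = 1\<^sub>m (r (Suc i))" if i: "i < n" for i
    unfolding H_def using mult_smult_distrib[OF top[OF i] adj_mat(1)[OF top[OF i]]] adj_mat(2)[OF top[OF i]] inv[OF i] by simp
  have HG: "H i * top_block A i = 1\<^sub>m (r (Suc i))" if i: "i < n" for i
    by (rule mat_mult_left_right_inverse[OF top[OF i] H[OF i] GH[OF i]])
  have X: "normal_cores A i = A i * H i" if i: "i < n" for i
    using i mult_smult_distrib[OF Ai[OF i] adj_mat(1)[OF top[OF i]]] trunc_eq[OF A, of i]
    by (simp add: normal_cores_def gauge_def H_def)
  show n: "normal_cores A n = A n"
    using trunc_eq[OF A, of n] by (auto simp: normal_cores_def gauge_def)
  have Xc: "normal_cores A i \<in> carrier_mat (r i * k i) (r (Suc i))" if "i < n" for i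
    using X[OF that] mult_carrier_mat[OF Ai H] that by simp
  have Xtop: "top_block (normal_cores A) i = 1\<^sub>m (r (Suc i))" if i: "i < n" for i
    using X[OF i] GH[OF i] top_rows_mult[OF Ai[OF i] H[OF i] r_Suc_le[OF i]] by simp
  show "normalized (normal_cores A)"
    using Xc Xtop n coresD(2)[OF A] by (simp add: normalized_def cores_def)
  show col: "vec_space.col_space (r i * k i) (normal_cores A i) = vec_space.col_space (r i * k i) (A i)" if i: "i < n" for i
  proof -
    have "right_invertible (H i)" unfolding right_invertible_iff[OF H[OF i]] using HG[OF i] top[OF i] by blast
    then have "det (H i) \<noteq> 0" using right_invertible_square[OF H[OF i]] by simp
    then show ?thesis unfolding X[OF i] by (rule col_space_mult_invertible[OF Ai[OF i] H[OF i]])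
  qed
  show "normal_form (r (Suc i)) (r i * k i) (vec_space.col_space (r i * k i) (A i)) = normal_cores A i" if i: "i < n" for i
    by (rule normal_form_unique[OF Ai[OF i] Xc[OF i] r_Suc_le[OF i] Xtop[OF i] col[OF i]])
  show "A i = normal_cores A i * top_block A i" if i: "i < n" for i
    unfolding X[OF i] using assoc_mult_mat[OF Ai[OF i] H[OF i] top[OF i]] HG[OF i] Ai[OF i] by simp
qed

lemma tt_map_pt:
  assumes X: "cores X" "X n = A n"
    and nf: "\<And>i. i < n \<Longrightarrow> normal_form (r (Suc i)) (r i * k i) (vec_space.col_space (r i * k i) (A i)) = X i"
  shows "tt_map n k r (pt PS A) = proj_vec (decompress n k r X)"
proof -
  \<comment> \<open>Scaling the matrix chosen in \<open>L\<close> by \<open>c\<close> scales the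
    output by \<open>c\<close>, so all choices together form exactly one projective point.\<close>
  have dec: "decompress n k r (\<lambda>i. if i < n
      then normal_form (r (Suc i)) (r i * k i) ((\<lambda>i\<in>{1..n}. vec_space.col_space (r (i - 1) * k (i - 1)) (A (i - 1))) (Suc i))
      else c \<cdot>\<^sub>m A n) = c \<cdot>\<^sub>v decompress n k r X" for c
  proof -
    have "decompress n k r (\<lambda>i. if i < n
        then normal_form (r (Suc i)) (r i * k i) ((\<lambda>i\<in>{1..n}. vec_space.col_space (r (i - 1) * k (i - 1)) (A (i - 1))) (Suc i))
        else c \<cdot>\<^sub>m A n) = decompress n k r (\<lambda>i. (if i = n then c else 1) \<cdot>\<^sub>m X i)"
      using nf X(2) by (intro decompress_cong) (auto intro!: eq_matI)
    also have "\<dots> = (\<Prod>j=0..n. if j = n then c else 1) \<cdot>\<^sub>v decompress n k r X"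
      using tail_smult[OF X(1), of 0 "\<lambda>i. if i = n then c else 1"] by (simp add: tail_vec_0)
    also have "(\<Prod>j=0..n. if j = n then c else 1) = c" by simp
    finally show ?thesis .
  qed
  show ?thesis
    unfolding tt_map_def pt_param prod.case proj_mat_def proj_vec_def
    by (auto simp: dec image_iff) (metis dec)
qed

text \<open>Two basis matrices of a subspace differ by a square factor \<open>T\<close>, and if the
  top block of \<open>A i * T\<close> has a right inverse, so does that of \<open>A i\<close>. Hence
  any representative can be used to test for the chart. For the last matrix, full rank means full
  row rank because \<open>r n \<le> k n\<close>.\<close>

lemma chart_iff:
  assumes A: "A \<in> reps PS"
  shows "pt PS A \<in> tt_chart n k r \<longleftrightarrow> (\<forall>i<n. det (top_block A i) \<noteq> 0) \<and> right_invertible (A n)"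
proof -
  have cA: "cores A" and rk: "\<And>i. i < n \<Longrightarrow> vec_space.rank (r i * k i) (A i) = r (Suc i)"
    using A by (auto simp: reps_param)
  have grass: "vec_space.col_space (r i * k i) (A i) \<in> grass_chart (r (Suc i)) (r i * k i) \<longleftrightarrow> det (top_block A i) \<noteq> 0"
    if i: "i < n" for i
  proof
    have Ai: "A i \<in> carrier_mat (r i * k i) (r (Suc i))" using coresD(1)[OF cA i] .
    have top: "top_block A i \<in> carrier_mat (r (Suc i)) (r (Suc i))" using top_block_carrier[OF cA i] .
    {
      assume "vec_space.col_space (r i * k i) (A i) \<in> grass_chart (r (Suc i)) (r i * k i)"
      then obtain B where B: "B \<in> carrier_mat (r i * k i) (r (Suc i))" "lin_indpt_first_rows (r (Suc i)) B"
        "vec_space.col_space (r i * k i) B = vec_space.col_space (r i * k i) (A i)"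
        unfolding grass_chart_def by force
      obtain T where T: "T \<in> carrier_mat (r (Suc i)) (r (Suc i))" "B = A i * T"
        using factor_through_col_space[OF Ai B(1)] cols_subset_col_space[OF B(1)] B(3) by auto
      have "right_invertible (top_block A i * T)"
        using B(2) lin_indpt_first_rows_iff[OF B(1) r_Suc_le[OF i]] top_rows_mult[OF Ai T(1) r_Suc_le[OF i]] T(2) by simp
      then have "right_invertible (top_block A i)" by (rule right_invertible_mult[OF top T(1)])
      then show "det (top_block A i) \<noteq> 0" using right_invertible_square[OF top] by simp
    next
      assume "det (top_block A i) \<noteq> 0"
      then have "lin_indpt_first_rows (r (Suc i)) (A i)"
        using right_invertible_square[OF top] lin_indpt_first_rows_iff[OF Ai r_Suc_le[OF i]] by simp
      then show "vec_space.col_space (r i * k i) (A i) \<in> grass_chart (r (Suc i)) (r i * k i)"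
        using Ai unfolding grass_chart_def by blast
    }
  qed
  have An: "A n \<in> carrier_mat (r n) (k n)" using coresD(2)[OF cA] .
  have proj: "proj_mat (A n) \<in> proj_mat ` {B \<in> carrier_mat (r n) (k n). vec_space.rank (r n) B = min (r n) (k n)}
      \<longleftrightarrow> right_invertible (A n)"
  proof
    assume "proj_mat (A n) \<in> proj_mat ` {B \<in> carrier_mat (r n) (k n). vec_space.rank (r n) B = min (r n) (k n)}"
    then obtain B where B: "proj_mat B = proj_mat (A n)" "B \<in> carrier_mat (r n) (k n)"
      "vec_space.rank (r n) B = r n" using r_n by (auto simp: min_def)
    then have inv: "right_invertible B" using full_row_rank_iff_right_invertible[OF B(2)] by simp
    obtain c where "c \<noteq> 0" "A n = c \<cdot>\<^sub>m B" using B(1) unfolding proj_mat_eq_iff by blast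
    then show "right_invertible (A n)" using right_invertible_smult[OF B(2) _ inv] by simp
  next
    assume "right_invertible (A n)"
    then have "vec_space.rank (r n) (A n) = min (r n) (k n)"
      using full_row_rank_iff_right_invertible[OF An] r_n by simp
    then show "proj_mat (A n) \<in> proj_mat ` {B \<in> carrier_mat (r n) (k n). vec_space.rank (r n) B = min (r n) (k n)}"
      using An by blast
  qed
  have PiE: "(\<lambda>i\<in>{1..n}. vec_space.col_space (r (i - 1) * k (i - 1)) (A (i - 1)))
        \<in> (\<Pi>\<^sub>E i\<in>{1..n}. grass_chart (r i) (r (i - 1) * k (i - 1))) \<longleftrightarrow> (\<forall>i<n. det (top_block A i) \<noteq> 0)"
    (is "?f \<in> ?E \<longleftrightarrow> ?R")
  proof
    assume f: "?f \<in> ?E"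
    show ?R
    proof (intro allI impI)
      fix i assume "i < n"
      then show "det (top_block A i) \<noteq> 0" using PiE_mem[OF f, of "Suc i"] grass by simp
    qed
  next
    assume R: ?R
    show "?f \<in> ?E"
    proof (intro PiE_I)
      fix i assume i: "i \<in> {1..n}"
      then obtain j where "i = Suc j" "j < n" by (cases i) auto
      then show "?f i \<in> grass_chart (r i) (r (i - 1) * k (i - 1))"
        using grass[of j] R i by simp
    qed auto
  qed
  show ?thesis unfolding pt_param tt_chart_def mem_Times_iff fst_conv snd_conv using PiE proj by simp
qed

lemma chart_subset: "tt_chart n k r \<subseteq> tt_parameters n k r"
proof -
  have "grass_chart (r i) (r (i - 1) * k (i - 1)) \<subseteq> grassmannian (r i) (r (i - 1) * k (i - 1))" if "i \<in> {1..n}" for i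
  proof
    fix S assume "S \<in> grass_chart (r i) (r (i - 1) * k (i - 1))"
    then obtain A where A: "A \<in> carrier_mat (r (i - 1) * k (i - 1)) (r i)" "lin_indpt_first_rows (r i) A"
      "S = vec_space.col_space (r (i - 1) * k (i - 1)) A" unfolding grass_chart_def by blast
    have le: "r i \<le> r (i - 1) * k (i - 1)" using r_Suc_le[of "i - 1"] that by auto
    have "det (top_rows (r i) A) \<noteq> 0"
      using A lin_indpt_first_rows_iff[OF A(1) le] right_invertible_square[OF top_rows_carrier[OF A(1)]] by simp
    then show "S \<in> grassmannian (r i) (r (i - 1) * k (i - 1))"
      unfolding A(3) by (intro col_space_in_grassmannian[OF A(1)] top_invertible_full_rank[OF A(1) le])
  qed
  moreover have "{B \<in> carrier_mat (r n) (k n). vec_space.rank (r n) B = min (r n) (k n)}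
      \<subseteq> carrier_mat (r n) (k n) - {0\<^sub>m (r n) (k n) :: complex mat}"
  proof
    fix B :: "complex mat" assume "B \<in> {B \<in> carrier_mat (r n) (k n). vec_space.rank (r n) B = min (r n) (k n)}"
    then have B: "B \<in> carrier_mat (r n) (k n)" "vec_space.rank (r n) B = r n" using r_n by (auto simp: min_def)
    then have "B \<noteq> 0\<^sub>m (r n) (k n)"
      using right_invertible_nonzero full_row_rank_iff_right_invertible[OF B(1)] r_pos[of n] by simp
    then show "B \<in> carrier_mat (r n) (k n) - {0\<^sub>m (r n) (k n)}" using B by simp
  qed
  ultimately show ?thesis
    unfolding tt_chart_def tt_parameters_def by (intro Sigma_mono PiE_mono image_mono) auto
qed

lemma chart_rep:
  assumes "z \<in> tt_chart n k r" obtains A where "A \<in> reps PS" "z = pt PS A"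
proof -
  have "z \<in> points_over UNIV PS" using assms chart_subset points_over_param_space by blast
  then show ?thesis using that by (auto simp: points_over_def reps_over_def)
qed

text \<open>The image has two useful representatives: the decompression of the normal forms, to
  which the results on factorization apply, and that of \<open>gauge A\<close>, whose coordinates
  are polynomial in those of \<open>A\<close>.\<close>

lemma chart_map:
  assumes A: "A \<in> reps PS" and chart: "pt PS A \<in> tt_chart n k r"
  shows "normalized (normal_cores A)"
    "decompress n k r (normal_cores A) \<in> reps TS"
    "decompress n k r (gauge A) \<in> reps TS"
    "tt_map n k r (pt PS A) = proj_vec (decompress n k r (normal_cores A))"
    "tt_map n k r (pt PS A) = proj_vec (decompress n k r (gauge A))"
    "tt_map n k r (pt PS A) \<in> tt_variety n k r"
proof -
  have cA: "cores A" and nz: "A n \<noteq> 0\<^sub>m (r n) (k n)" using A by (auto simp: reps_param)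
  have det: "\<forall>i<n. det (top_block A i) \<noteq> 0" using chart chart_iff[OF A] by blast
  note nc = normal_cores[OF cA det]
  show X: "normalized (normal_cores A)" by (rule nc(1))
  then have Xc: "cores (normal_cores A)" by (simp add: normalized_def)
  show D: "decompress n k r (normal_cores A) \<in> reps TS"
    using decompress_nonzero[OF X] decompress_carrier[OF Xc] nc(2) nz by (simp add: reps_tensor)
  define c where "c = (\<Prod>i=0..n. if i < n then inverse (det (top_block (trunc A) i)) else 1)"
  have c: "c \<noteq> 0" using det trunc_eq[OF cA] by (auto simp: c_def)
  have scale: "decompress n k r (normal_cores A) = c \<cdot>\<^sub>v decompress n k r (gauge A)"
    unfolding c_def by (rule decompress_normal_cores)
  then have "decompress n k r (gauge A) = inverse c \<cdot>\<^sub>v decompress n k r (normal_cores A)"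
    using smult_vec_inverse[OF c] by simp
  then show "decompress n k r (gauge A) \<in> reps TS" using reps_tensor_smult[OF D] c by simp
  show eq: "tt_map n k r (pt PS A) = proj_vec (decompress n k r (normal_cores A))"
    by (rule tt_map_pt[OF Xc nc(2) nc(4)])
  show "tt_map n k r (pt PS A) = proj_vec (decompress n k r (gauge A))"
    unfolding eq using scale c proj_vec_eq_iff by metis
  show "tt_map n k r (pt PS A) \<in> tt_variety n k r"
    unfolding eq variety_iff[OF D] using rank_flat_decompress[OF Xc] by simp
qed

lemma tt_map_variety: "tt_map n k r ` tt_chart n k r \<subseteq> tt_variety n k r"
proof
  fix y assume "y \<in> tt_map n k r ` tt_chart n k r"
  then obtain z where z: "z \<in> tt_chart n k r" "y = tt_map n k r z" by blast
  obtain A where A: "A \<in> reps PS" "z = pt PS A" using chart_rep[OF z(1)] by blast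
  show "y \<in> tt_variety n k r" unfolding z(2) A(2) by (rule chart_map(6)[OF A(1) z(1)[unfolded A(2)]])
qed

text \<open>Each flattening is head times tail. If its rank attains the inner dimension, the tail
  has full row rank, and by the identity top blocks this tail is the matrix that factorization
  finds.\<close>

lemma chart_manifold_open:
  assumes "z \<in> tt_chart n k r" "tt_map n k r z \<in> tt_manifold n k r"
  shows "tt_map n k r z \<in> tt_open n k r"
proof -
  obtain A where A: "A \<in> reps PS" "z = pt PS A" using chart_rep[OF assms(1)] by blast
  note m = chart_map[OF A(1) assms(1)[unfolded A(2)]]
  have "\<forall>i<n. right_invertible (fact_mat (decompress n k r (normal_cores A)) (Suc i))"
    using assms(2) fact_right_invertible[OF m(1)] manifold_iff[OF m(2)] unfolding A(2) m(4) by simp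
  then show ?thesis using m(6) unfolding A(2) m(4) open_iff[OF m(2)] by blast
qed

section \<open>The part of the chart on which the map is bijective, and its inverse\<close>

definition tt_domain :: "((nat \<Rightarrow> complex vec set) \<times> complex mat set) set" where
  "tt_domain = {z \<in> tt_chart n k r. tt_map n k r z \<in> tt_open n k r}"

lemma tt_map_inj: "inj_on (tt_map n k r) tt_domain"
proof (rule inj_onI)
  fix y z assume y: "y \<in> tt_domain" and z: "z \<in> tt_domain" and eq: "tt_map n k r y = tt_map n k r z"
  obtain A where A: "A \<in> reps PS" "y = pt PS A" using y chart_rep unfolding tt_domain_def by blast
  obtain B where B: "B \<in> reps PS" "z = pt PS B" using z chart_rep unfolding tt_domain_def by blast
  have chA: "pt PS A \<in> tt_chart n k r" and chB: "pt PS B \<in> tt_chart n k r"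
    using y z A(2) B(2) by (auto simp: tt_domain_def)
  note mA = chart_map[OF A(1) chA] and mB = chart_map[OF B(1) chB]
  have cA: "cores A" and cB: "cores B" using A(1) B(1) by (auto simp: reps_param)
  have dA: "\<forall>i<n. det (top_block A i) \<noteq> 0" and dB: "\<forall>i<n. det (top_block B i) \<noteq> 0"
    using chA chB chart_iff[OF A(1)] chart_iff[OF B(1)] by blast+
  note nA = normal_cores[OF cA dA] and nB = normal_cores[OF cB dB]
  obtain c where c: "c \<noteq> 0" "decompress n k r (normal_cores B) = c \<cdot>\<^sub>v decompress n k r (normal_cores A)"
    using eq unfolding A(2) B(2) mA(4) mB(4) proj_vec_eq_iff by blast
  have "right_invertible (tail (normal_cores A) (Suc i))" if "i < n" for i
  proof -
    have "right_invertible (fact_mat (decompress n k r (normal_cores A)) (Suc i))"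
      using y open_iff[OF mA(2)] that unfolding tt_domain_def A(2) mem_Collect_eq mA(4) by blast
    then show ?thesis using fact_decompress_tail[OF mA(1), of "Suc i"] that by simp
  qed
  then have res: "\<And>i. i < n \<Longrightarrow> normal_cores B i = normal_cores A i" "B n = c \<cdot>\<^sub>m A n"
    using decompress_inj[OF mA(1) mB(1) c(2,1)] nA(2) nB(2) by auto
  have "vec_space.col_space (r i * k i) (B i) = vec_space.col_space (r i * k i) (A i)" if "i < n" for i
    using nA(3)[OF that] nB(3)[OF that] res(1)[OF that] by simp
  then have "(\<lambda>i\<in>{1..n}. vec_space.col_space (r (i - 1) * k (i - 1)) (A (i - 1))) =
      (\<lambda>i\<in>{1..n}. vec_space.col_space (r (i - 1) * k (i - 1)) (B (i - 1)))"
    by (intro restrict_ext) auto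
  moreover have "proj_mat (A n) = proj_mat (B n)" unfolding proj_mat_eq_iff using res(2) c(1) by blast
  ultimately show "y = z" unfolding A(2) B(2) pt_param by simp
qed

text \<open>Up to a change of basis the factor \<open>X\<^sub>i\<close> of the factorization algorithm is obtained from \<open>\<psi>\<^sup>i\<close> by
  multiplication with a constant matrix, so that the inverse map is linear in suitable homogeneous
  coordinates.\<close>

definition factors :: "(nat \<Rightarrow> complex mat) \<Rightarrow> complex vec \<Rightarrow> nat \<Rightarrow> complex mat" where
  "factors Q \<psi> i = (if i < n then fact_unfolding n k r \<psi> i * Q i else fact_mat \<psi> n)"

lemma factors:
  assumes \<psi>: "\<psi> \<in> reps TS" "proj_vec \<psi> \<in> tt_open n k r"
    and Q: "\<And>i. i < n \<Longrightarrow> Q i \<in> carrier_mat (right_dim (Suc i)) (r (Suc i))"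
    and det: "\<And>i. i < n \<Longrightarrow> det (fact_mat \<psi> (Suc i) * Q i) \<noteq> 0"
  shows "factors Q \<psi> \<in> reps PS" "pt PS (factors Q \<psi>) \<in> tt_domain"
    "tt_map n k r (pt PS (factors Q \<psi>)) = proj_vec \<psi>"
proof -
  have dim: "\<psi> \<in> carrier_vec (right_dim 0)" using \<psi>(1) by (simp add: reps_tensor)
  define G where "G i = fact_mat \<psi> (Suc i) * Q i" for i
  have G: "G i \<in> carrier_mat (r (Suc i)) (r (Suc i))" if "i < n" for i
    unfolding G_def by (rule mult_carrier_mat[OF fact_mat_carrier Q[OF that]])
  have "\<exists>W\<in>carrier_mat (r (Suc i)) (r (Suc i)). G i * W = 1\<^sub>m (r (Suc i))" if "i < n" for i
    using right_invertible_square[OF G[OF that]] right_invertible_iff[OF G[OF that]] det[OF that] by (simp add: G_def)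
  then obtain W where W: "\<And>i. i < n \<Longrightarrow> W i \<in> carrier_mat (r (Suc i)) (r (Suc i)) \<and> G i * W i = 1\<^sub>m (r (Suc i))"
    by metis
  \<comment> \<open>\<open>Q i * W i\<close> is a right inverse of
    \<open>fact_mat \<psi> (Suc i)\<close>, so \<open>X\<close> is the normalized tuple of the
    factorization algorithm. \<open>factors\<close> leaves \<open>W\<close> out in order to remain
    polynomial in \<open>\<psi>\<close>, at the price of a change of basis by
    \<open>G i\<close>.\<close>
  define X where "X i = (if i < n then fact_unfolding n k r \<psi> i * (Q i * W i) else fact_mat \<psi> n)" for i
  have rk: "\<forall>i<n. vec_space.rank (left_dim (Suc i)) (flat (Suc i) \<psi>) \<le> r (Suc i)"
    using \<psi> open_iff[OF \<psi>(1)] variety_iff[OF \<psi>(1)] by blast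
  have V: "Q i * W i \<in> carrier_mat (right_dim (Suc i)) (r (Suc i)) \<and>
      fact_mat \<psi> (Suc i) * (Q i * W i) = 1\<^sub>m (r (Suc i))" if i: "i < n" for i
    using mult_carrier_mat[OF Q[OF i], of "W i" "r (Suc i)"] W[OF i]
      assoc_mult_mat[OF fact_mat_carrier Q[OF i], of "W i" "r (Suc i)" \<psi>] by (simp add: G_def)
  then have V': "\<forall>i<n. Q i * W i \<in> carrier_mat (right_dim (Suc i)) (r (Suc i)) \<and>
      fact_mat \<psi> (Suc i) * (Q i * W i) = 1\<^sub>m (r (Suc i))" by blast
  have Xeq: "\<forall>i<n. X i = fact_unfolding n k r \<psi> i * (Q i * W i)" by (simp add: X_def)
  have Xn: "X n = fact_mat \<psi> n" by (simp add: X_def)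
  note rec = reconstruct[OF dim rk V' Xeq Xn]
  have Xc: "cores X" using rec(1) by (simp add: normalized_def)
  have Xi: "X i \<in> carrier_mat (r i * k i) (r (Suc i))" if "i < n" for i using coresD(1)[OF Xc that] .
  have F: "factors Q \<psi> i = X i * G i" if i: "i < n" for i
    using i rec(3)[OF i] assoc_mult_mat[OF Xi[OF i] fact_mat_carrier Q[OF i]] by (simp add: factors_def G_def)
  have Fc: "cores (factors Q \<psi>)"
    using mult_carrier_mat[OF Xi G] F fact_mat_carrier[of \<psi> n] by (simp add: cores_def) (simp add: factors_def)
  have top: "top_block (factors Q \<psi>) i = G i" if i: "i < n" for i
    using F[OF i] top_rows_mult[OF Xi[OF i] G[OF i] r_Suc_le[OF i]] rec(1) i G[OF i] by (simp add: normalized_def)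
  have Fdet: "det (top_block (factors Q \<psi>) i) \<noteq> 0" if "i < n" for i
    using top[OF that] det[OF that] by (simp add: G_def)
  have inv: "right_invertible (factors Q \<psi> n)" using fact_n_right_invertible[OF \<psi>] by (simp add: factors_def)
  have nz: "factors Q \<psi> n \<noteq> 0\<^sub>m (r n) (k n)"
    by (rule right_invertible_nonzero[OF inv coresD(2)[OF Fc]]) (simp add: r_pos)
  show reps: "factors Q \<psi> \<in> reps PS"
    unfolding reps_param using Fc nz top_invertible_full_rank[OF coresD(1)[OF Fc] r_Suc_le Fdet] by simp
  show eq: "tt_map n k r (pt PS (factors Q \<psi>)) = proj_vec \<psi>"
  proof -
    have "normal_form (r (Suc i)) (r i * k i) (vec_space.col_space (r i * k i) (factors Q \<psi> i)) = X i" if i: "i < n" for i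
    proof (rule normal_form_unique[OF coresD(1)[OF Fc i] Xi[OF i] r_Suc_le[OF i]])
      show "top_block X i = 1\<^sub>m (r (Suc i))" using rec(1) i by (simp add: normalized_def)
      show "vec_space.col_space (r i * k i) (X i) = vec_space.col_space (r i * k i) (factors Q \<psi> i)"
        unfolding F[OF i] using col_space_mult_invertible[OF Xi[OF i] G[OF i]] det[OF i] by (simp add: G_def)
    qed
    then show ?thesis using tt_map_pt[OF Xc, of "factors Q \<psi>"] Xn rec(2) by (simp add: factors_def)
  qed
  show "pt PS (factors Q \<psi>) \<in> tt_domain"
    unfolding tt_domain_def using chart_iff[OF reps] Fdet inv eq \<psi>(2) by simp
qed

end

section \<open>Points and polynomial formulas over a fixed field\<close>

locale tensor_train_scalars = tensor_train n k r + scalars K for n k r K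
begin

lemma coords_core: "i < n \<Longrightarrow> a < r i * k i \<Longrightarrow> b < r (Suc i) \<Longrightarrow> (\<lambda>A. A i $$ (a, b)) \<in> coords PS"
  and coords_core_n: "a < r n \<Longrightarrow> b < k n \<Longrightarrow> (\<lambda>A. A n $$ (a, b)) \<in> coords PS"
  by (auto simp: param_space_def)

lemma reps_over_param:
  "A \<in> reps_over K PS \<longleftrightarrow> A \<in> reps PS \<and> (\<forall>i\<le>n. mat_over K (A i))"
proof -
  have "(\<forall>c\<in>coords PS. c A \<in> K) \<longleftrightarrow> (\<forall>i\<le>n. mat_over K (A i))" if A: "A \<in> reps PS"
  proof
    have cA: "cores A" using A by (simp add: reps_param)
    assume c: "\<forall>c\<in>coords PS. c A \<in> K"
    show "\<forall>i\<le>n. mat_over K (A i)"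
    proof (intro allI impI)
      fix i assume "i \<le> n"
      then consider "i < n" | "i = n" by linarith
      then show "mat_over K (A i)"
      proof cases
        case 1
        show ?thesis unfolding mat_over_def carrier_matD[OF coresD(1)[OF cA 1]]
          using bspec[OF c coords_core[OF 1]] by simp
      next
        case 2
        show ?thesis unfolding 2 mat_over_def carrier_matD[OF coresD(2)[OF cA]]
          using bspec[OF c coords_core_n] by simp
      qed
    qed
  next
    have cA: "cores A" using A by (simp add: reps_param)
    assume "\<forall>i\<le>n. mat_over K (A i)"
    then show "\<forall>c\<in>coords PS. c A \<in> K"
      using carrier_matD[OF coresD(1)[OF cA]] carrier_matD[OF coresD(2)[OF cA]]
      by (auto simp: param_space_def mat_over_def)
  qed
  then show ?thesis unfolding reps_over_def by blast
qed

lemma coords_over_cores: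
  assumes "cores A" "\<And>i. i \<le> n \<Longrightarrow> mat_over K (A i)" "c \<in> coords PS" shows "c A \<in> K"
  using assms carrier_matD[OF coresD(1)[OF assms(1)]] carrier_matD[OF coresD(2)[OF assms(1)]]
  by (auto simp: param_space_def mat_over_def)

lemma reps_over_tensor: "\<psi> \<in> reps_over K TS \<longleftrightarrow> \<psi> \<in> reps TS \<and> (\<forall>j<right_dim 0. \<psi> $ j \<in> K)"
  unfolding reps_over_def coords_tensor by auto

lemma polymat_trunc:
  "i < n \<Longrightarrow> polymat K (coords PS) (r i * k i) (r (Suc i)) (\<lambda>A. trunc A i)"
  "polymat K (coords PS) (r n) (k n) (\<lambda>A. trunc A n)"
  using coords_core coords_core_n by (auto simp: polymat_def trunc_def intro: polyfun.coord)

lemma polyvec_decompress: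
  assumes "\<And>i. i < n \<Longrightarrow> polymat K C (r i * k i) (r (Suc i)) (\<lambda>x. X x i)"
    and "polymat K C (r n) (k n) (\<lambda>x. X x n)"
  shows "polyvec K C (right_dim 0) (\<lambda>x. decompress n k r (X x))"
proof -
  have "polyvec K C (r i * right_dim i) (\<lambda>x. tail_vec (X x) i)" if "i \<le> n" for i
    using that
  proof (induction rule: inc_induct)
    case base
    show ?case using polyvec_flat[OF assms(2)] by (simp add: tail_vec_n)
  next
    case (step i)
    then have i: "i < n" by simp
    have "polymat K C (r (Suc i)) (right_dim (Suc i)) (\<lambda>x. tail (X x) (Suc i))"
      unfolding tail_def by (rule polymat_unfold) (rule step)
    from polyvec_flat[OF polymat_mult[OF assms(1)[OF i] this]]
    show ?case using i by (simp add: tail_vec_step right_dim_Suc mult.assoc)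
  qed
  from this[of 0] show ?thesis by (simp add: tail_vec_0 r_0)
qed

lemma polymat_top_block: "i < n \<Longrightarrow> polymat K (coords PS) (r (Suc i)) (r (Suc i)) (\<lambda>A. top_block (trunc A) i)"
  by (rule polymat_top_rows[OF polymat_trunc(1) r_Suc_le])

lemma polymat_gauge:
  "i < n \<Longrightarrow> polymat K (coords PS) (r i * k i) (r (Suc i)) (\<lambda>A. gauge A i)"
  "polymat K (coords PS) (r n) (k n) (\<lambda>A. gauge A n)"
  using polymat_mult[OF polymat_trunc(1) polymat_adj_mat[OF polymat_top_block], of i] polymat_trunc(2)
  by (simp_all add: gauge_def)

lemma polyvec_gauge: "polyvec K (coords PS) (right_dim 0) (\<lambda>A. decompress n k r (gauge A))"
  by (rule polyvec_decompress[OF polymat_gauge])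

lemma polyvec_trunc: "polyvec K (coords PS) (right_dim 0) (\<lambda>A. decompress n k r (trunc A))"
  by (rule polyvec_decompress[OF polymat_trunc])

lemma polyvec_fvec:
  assumes f: "polyvec K C (right_dim 0) f" shows "i \<le> n \<Longrightarrow> polyvec K C (r i * right_dim i) (\<lambda>x. fvec (f x) i)"
proof (induction i)
  case 0 then show ?case using f by (simp add: r_0)
next
  case (Suc i)
  then have i: "i < n" by simp
  have "polyvec K C (r i * k i * right_dim (Suc i)) (\<lambda>x. fvec (f x) i)"
    using Suc i by (simp add: right_dim_Suc mult.assoc)
  from polymat_unfold[OF this]
  have "polymat K C (r i * k i) (right_dim (Suc i)) (\<lambda>x. fact_unfolding n k r (f x) i)"
    unfolding fact_unfolding_eq .
  from polyvec_flat[OF polymat_top_rows[OF this r_Suc_le[OF i]]] show ?case unfolding fvec_Suc .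
qed

lemma polymat_fact:
  assumes f: "polyvec K C (right_dim 0) f"
  shows "i \<le> n \<Longrightarrow> polymat K C (r i) (right_dim i) (\<lambda>x. fact_mat (f x) i)"
    and "i < n \<Longrightarrow> polymat K C (r i * k i) (right_dim (Suc i)) (\<lambda>x. fact_unfolding n k r (f x) i)"
proof -
  show "i \<le> n \<Longrightarrow> polymat K C (r i) (right_dim i) (\<lambda>x. fact_mat (f x) i)"
    unfolding fact_mat_def by (rule polymat_unfold[OF polyvec_fvec[OF f]])
  show "i < n \<Longrightarrow> polymat K C (r i * k i) (right_dim (Suc i)) (\<lambda>x. fact_unfolding n k r (f x) i)"
    unfolding fact_unfolding_eq using polyvec_fvec[OF f, of i]
    by (intro polymat_unfold) (simp add: right_dim_Suc mult.assoc)
qed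

text \<open>Coordinates of tensors are polynomial only on vectors of the right dimension, hence the
  padding.\<close>

definition pad :: "complex vec \<Rightarrow> complex vec" where
  "pad \<psi> = vec (right_dim 0) (\<lambda>j. \<psi> $ j)"

lemma pad_eq: "\<psi> \<in> carrier_vec (right_dim 0) \<Longrightarrow> pad \<psi> = \<psi>"
  by (auto simp: pad_def intro!: eq_vecI)

lemma polyvec_pad: "polyvec K (coords TS) (right_dim 0) pad"
  unfolding polyvec_def
proof (intro conjI allI impI)
  fix j assume j: "j < right_dim 0"
  then have "(\<lambda>v. v $ j) \<in> coords TS" by (auto simp: coords_tensor)
  then show "(\<lambda>v. pad v $ j) \<in> polyfun K (coords TS)" using j by (simp add: pad_def polyfun.coord)
qed (simp add: pad_def)

lemma polyfun_tensor_compose: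
  assumes "p \<in> polyfun K (coords TS)" "polyvec K C (right_dim 0) f"
  shows "(\<lambda>x. p (f x)) \<in> polyfun K C"
proof (rule polyfun_compose[OF assms(1)])
  fix c assume "c \<in> coords TS"
  then obtain j where "j < right_dim 0" "c = (\<lambda>v. v $ j)" by (auto simp: coords_tensor)
  then show "(\<lambda>x. c (f x)) \<in> polyfun K C" using assms(2) by (simp add: polyvec_def)
qed

lemma coords_over_tensor: "\<psi> \<in> reps_over K TS \<Longrightarrow> c \<in> coords TS \<Longrightarrow> c \<psi> \<in> K"
  by (auto simp: reps_over_def)

lemma coords_over_param: "A \<in> reps_over K PS \<Longrightarrow> c \<in> coords PS \<Longrightarrow> c A \<in> K"
  by (auto simp: reps_over_def)

lemma mat_over_fact:
  assumes \<psi>: "\<psi> \<in> reps_over K TS"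
  shows "i \<le> n \<Longrightarrow> mat_over K (fact_mat \<psi> i)" "i < n \<Longrightarrow> mat_over K (fact_unfolding n k r \<psi> i)"
proof -
  have pad: "pad \<psi> = \<psi>" using \<psi> by (simp add: pad_eq reps_over_tensor reps_tensor)
  show "i \<le> n \<Longrightarrow> mat_over K (fact_mat \<psi> i)"
    using mat_over_polymat[OF polymat_fact(1)[OF polyvec_pad], of i \<psi>] coords_over_tensor[OF \<psi>] unfolding pad by blast
  show "i < n \<Longrightarrow> mat_over K (fact_unfolding n k r \<psi> i)"
    using mat_over_polymat[OF polymat_fact(2)[OF polyvec_pad], of i \<psi>] coords_over_tensor[OF \<psi>] unfolding pad by blast
qed

lemma decompress_gauge_over:
  assumes "cores A" "\<And>i. i \<le> n \<Longrightarrow> mat_over K (A i)" "j < right_dim 0"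
  shows "decompress n k r (gauge A) $ j \<in> K"
proof -
  have "(\<lambda>A. decompress n k r (gauge A) $ j) \<in> polyfun K (coords PS)"
    using polyvec_gauge assms(3) by (simp add: polyvec_def)
  then show ?thesis by (rule polyfun_eval) (rule coords_over_cores[OF assms(1,2)])
qed

lemma decompress_gauge_reps_over:
  assumes A: "A \<in> reps_over K PS" and "pt PS A \<in> tt_chart n k r"
  shows "decompress n k r (gauge A) \<in> reps_over K TS"
  unfolding reps_over_tensor
  using A chart_map(3) assms(2) decompress_gauge_over unfolding reps_over_param reps_param by blast

lemma tt_map_over:
  assumes "z \<in> tt_chart n k r \<inter> points_over K PS" shows "tt_map n k r z \<in> points_over K TS"
proof -
  obtain A where A: "A \<in> reps_over K PS" "z = pt PS A" using assms by (auto simp: points_over_def)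
  have chart: "pt PS A \<in> tt_chart n k r" using assms A(2) by simp
  have "A \<in> reps PS" using A(1) by (simp add: reps_over_param)
  from chart_map(5)[OF this chart] show ?thesis
    unfolding points_over_def A(2) pt_tensor using decompress_gauge_reps_over[OF A(1) chart] by blast
qed

lemma tt_map_regular:
  assumes S: "S \<subseteq> tt_chart n k r \<inter> points_over K PS"
  shows "regular_map K PS S TS (tt_map n k r)"
  unfolding regular_map_def
proof (intro ballI exI conjI impI)
  \<comment> \<open>The formula through \<open>gauge\<close> is valid on all of \<open>S\<close>, so
    \<open>S\<close> itself serves as the neighbourhood of each point.\<close>
  show "openin (subtopology (zariski K PS) S) S"
    unfolding openin_subtopology using S openin_topspace[of "zariski K PS"] topspace_zariski[of K PS]
    by (intro exI[of _ "topspace (zariski K PS)"]) auto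
next
  fix c assume "c \<in> coords TS"
  then obtain j where "j < right_dim 0" "c = (\<lambda>v. v $ j)" by (auto simp: coords_tensor)
  then show "(\<lambda>A. c (decompress n k r (gauge A))) \<in> polyfun K (coords PS)"
    using polyvec_gauge by (simp add: polyvec_def)
next
  fix x assume x: "x \<in> reps_over K PS" "pt PS x \<in> S"
  then have "x \<in> reps PS" "pt PS x \<in> tt_chart n k r" using S by (auto simp: reps_over_param)
  from chart_map(3,5)[OF this] show "decompress n k r (gauge x) \<in> reps TS"
    "tt_map n k r (pt PS x) = pt TS (decompress n k r (gauge x))" by simp_all
qed

lemma open_multipliers:
  assumes \<psi>: "\<psi> \<in> reps_over K TS" "proj_vec \<psi> \<in> tt_open n k r"
  obtains Q where "\<And>i. i < n \<Longrightarrow> Q i \<in> carrier_mat (right_dim (Suc i)) (r (Suc i))"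
    "\<And>i. i < n \<Longrightarrow> mat_over K (Q i)" "\<And>i. i < n \<Longrightarrow> det (fact_mat \<psi> (Suc i) * Q i) \<noteq> 0"
proof -
  have "\<psi> \<in> reps TS" using \<psi>(1) by (simp add: reps_over_tensor)
  then have "right_invertible (fact_mat \<psi> (Suc i))" if "i < n" for i
    using open_iff \<psi>(2) that by blast
  then have "\<exists>Q\<in>carrier_mat (right_dim (Suc i)) (r (Suc i)). mat_over K Q \<and> det (fact_mat \<psi> (Suc i) * Q) \<noteq> 0"
    if "i < n" for i
    using right_invertible_det[OF fact_mat_carrier mat_over_fact(1)[OF \<psi>(1)], of "Suc i"] that by simp
  then show ?thesis using that by metis
qed

lemma factors_over:
  assumes \<psi>: "\<psi> \<in> reps_over K TS" "proj_vec \<psi> \<in> tt_open n k r"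
    and Q: "\<And>i. i < n \<Longrightarrow> Q i \<in> carrier_mat (right_dim (Suc i)) (r (Suc i))" "\<And>i. i < n \<Longrightarrow> mat_over K (Q i)"
    and det: "\<And>i. i < n \<Longrightarrow> det (fact_mat \<psi> (Suc i) * Q i) \<noteq> 0"
  shows "factors Q \<psi> \<in> reps_over K PS"
  unfolding reps_over_param
proof (intro conjI allI impI)
  have "\<psi> \<in> reps TS" using \<psi>(1) by (simp add: reps_over_tensor)
  then show "factors Q \<psi> \<in> reps PS" using factors(1)[OF _ \<psi>(2) Q(1) det] by blast
  fix i assume "i \<le> n"
  show "mat_over K (factors Q \<psi> i)"
  proof (cases "i < n")
    case True
    have "mat_over K (fact_unfolding n k r \<psi> i * Q i)"
      by (rule mat_over_mult[OF mat_over_fact(2)[OF \<psi>(1) True] Q(2)[OF True]])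
        (use carrier_matD[OF fact_unfolding_carrier] carrier_matD[OF Q(1)[OF True]] in simp)
    then show ?thesis using True by (simp add: factors_def)
  next
    case False
    then show ?thesis using mat_over_fact(1)[OF \<psi>(1), of n] by (simp add: factors_def)
  qed
qed

section \<open>Bijectivity over the field, openness of the image, and regularity of the
  inverse\<close>

lemma tt_map_bij:
  "bij_betw (tt_map n k r) (tt_domain \<inter> points_over K PS) (tt_open n k r \<inter> points_over K TS)"
  unfolding bij_betw_def
proof
  show "inj_on (tt_map n k r) (tt_domain \<inter> points_over K PS)"
    using tt_map_inj by (rule inj_on_subset) blast
  show "tt_map n k r ` (tt_domain \<inter> points_over K PS) = tt_open n k r \<inter> points_over K TS"
  proof
    show "tt_map n k r ` (tt_domain \<inter> points_over K PS) \<subseteq> tt_open n k r \<inter> points_over K TS"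
      using tt_map_over unfolding tt_domain_def by blast
    show "tt_open n k r \<inter> points_over K TS \<subseteq> tt_map n k r ` (tt_domain \<inter> points_over K PS)"
    proof
      fix y assume y: "y \<in> tt_open n k r \<inter> points_over K TS"
      then obtain \<psi> where \<psi>: "\<psi> \<in> reps_over K TS" "y = proj_vec \<psi>" by (auto simp: points_over_def)
      have o: "proj_vec \<psi> \<in> tt_open n k r" using y \<psi>(2) by simp
      have \<psi>r: "\<psi> \<in> reps TS" using \<psi>(1) by (simp add: reps_over_tensor)
      \<comment> \<open>Multipliers over \<open>K\<close> make the preimage a point over
        \<open>K\<close>, although membership in \<open>tt_open\<close> is a statement about complex
        matrices.\<close>
      obtain Q where Q: "\<And>i. i < n \<Longrightarrow> Q i \<in> carrier_mat (right_dim (Suc i)) (r (Suc i))"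
        "\<And>i. i < n \<Longrightarrow> mat_over K (Q i)" "\<And>i. i < n \<Longrightarrow> det (fact_mat \<psi> (Suc i) * Q i) \<noteq> 0"
        by (rule open_multipliers[OF \<psi>(1) o]) blast
      have "pt PS (factors Q \<psi>) \<in> points_over K PS"
        unfolding points_over_def using factors_over[OF \<psi>(1) o Q] by blast
      then show "y \<in> tt_map n k r ` (tt_domain \<inter> points_over K PS)"
        using factors(2,3)[OF \<psi>r o Q(1,3)] \<psi>(2) by (metis IntI imageI)
    qed
  qed
qed

text \<open>\<open>tt_open\<close> is open relative to the variety, not in general in projective
  space. This set keeps only the nonvanishing condition, so that it is open and its trace on the
  variety is \<open>tt_open\<close> over \<open>K\<close>.\<close>

definition open_reps :: "complex vec set set" where
  "open_reps = {pt TS \<psi> | \<psi>. \<psi> \<in> reps_over K TS \<and> (\<forall>i<n. right_invertible (fact_mat \<psi> (Suc i)))}"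

lemma open_reps_iff:
  assumes \<psi>: "\<psi> \<in> reps_over K TS"
  shows "pt TS \<psi> \<in> open_reps \<longleftrightarrow> (\<forall>i<n. right_invertible (fact_mat \<psi> (Suc i)))"
proof
  assume "pt TS \<psi> \<in> open_reps"
  then obtain \<phi> where \<phi>: "\<phi> \<in> reps_over K TS" "proj_vec \<phi> = proj_vec \<psi>"
    "\<forall>i<n. right_invertible (fact_mat \<phi> (Suc i))" unfolding open_reps_def by auto
  obtain c where c: "c \<noteq> 0" "\<psi> = c \<cdot>\<^sub>v \<phi>" using \<phi>(2) unfolding proj_vec_eq_iff by blast
  have "\<phi> \<in> carrier_vec (right_dim 0)" using \<phi>(1) by (simp add: reps_over_tensor reps_tensor)
  then show "\<forall>i<n. right_invertible (fact_mat \<psi> (Suc i))"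
    unfolding c(2) using fact_smult \<phi>(3) right_invertible_smult[OF fact_mat_carrier c(1)] by simp
next
  assume "\<forall>i<n. right_invertible (fact_mat \<psi> (Suc i))"
  then show "pt TS \<psi> \<in> open_reps" using \<psi> unfolding open_reps_def by blast
qed

text \<open>A product over all bonds, so that a single polynomial certifies full row rank
  everywhere; the multipliers at different bonds can be chosen independently.\<close>

definition minors :: "(nat \<Rightarrow> complex mat) \<Rightarrow> complex vec \<Rightarrow> complex" where
  "minors Q \<psi> = (\<Prod>i<n. det (fact_mat \<psi> (Suc i) * Q i))"

definition multipliers :: "(nat \<Rightarrow> complex mat) set" where
  "multipliers = {Q. \<forall>i<n. Q i \<in> carrier_mat (right_dim (Suc i)) (r (Suc i)) \<and> mat_over K (Q i)}"

lemma polyfun_minors: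
  assumes f: "polyvec K C (right_dim 0) f" and Q: "Q \<in> multipliers"
  shows "(\<lambda>x. minors Q (f x)) \<in> polyfun K C"
  unfolding minors_def
proof (rule polyfun_prod)
  fix i assume "i \<in> {..<n}"
  then have i: "i < n" by simp
  show "(\<lambda>x. det (fact_mat (f x) (Suc i) * Q i)) \<in> polyfun K C"
    using polymat_fact(1)[OF f, of "Suc i"] Q i
    by (intro polyfun_det polymat_mult[OF _ polymat_const]) (auto simp: multipliers_def)
qed

lemma minors_iff:
  assumes \<psi>: "\<psi> \<in> reps_over K TS"
  shows "(\<exists>Q\<in>multipliers. minors Q \<psi> \<noteq> 0) \<longleftrightarrow> (\<forall>i<n. right_invertible (fact_mat \<psi> (Suc i)))"
proof -
  have eq: "right_invertible (fact_mat \<psi> (Suc i)) \<longleftrightarrow>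
      (\<exists>Q\<in>carrier_mat (right_dim (Suc i)) (r (Suc i)). mat_over K Q \<and> det (fact_mat \<psi> (Suc i) * Q) \<noteq> 0)"
    if "i < n" for i
    by (rule right_invertible_det[OF fact_mat_carrier mat_over_fact(1)[OF \<psi>]]) (use that in simp)
  show ?thesis
  proof
    assume "\<exists>Q\<in>multipliers. minors Q \<psi> \<noteq> 0"
    then obtain Q where Q: "Q \<in> multipliers" "minors Q \<psi> \<noteq> 0" by blast
    show "\<forall>i<n. right_invertible (fact_mat \<psi> (Suc i))"
    proof (intro allI impI)
      fix i assume i: "i < n"
      then have "det (fact_mat \<psi> (Suc i) * Q i) \<noteq> 0" using Q(2) by (simp add: minors_def)
      then show "right_invertible (fact_mat \<psi> (Suc i))"
        unfolding eq[OF i] using Q(1) i by (auto simp: multipliers_def)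
    qed
  next
    assume "\<forall>i<n. right_invertible (fact_mat \<psi> (Suc i))"
    then have "\<forall>i. \<exists>Q. i < n \<longrightarrow> Q \<in> carrier_mat (right_dim (Suc i)) (r (Suc i)) \<and> mat_over K Q \<and>
        det (fact_mat \<psi> (Suc i) * Q) \<noteq> 0" using eq by blast
    then obtain Q where "\<And>i. i < n \<Longrightarrow> Q i \<in> carrier_mat (right_dim (Suc i)) (r (Suc i)) \<and> mat_over K (Q i) \<and>
        det (fact_mat \<psi> (Suc i) * Q i) \<noteq> 0" by metis
    then show "\<exists>Q\<in>multipliers. minors Q \<psi> \<noteq> 0"
      by (intro bexI[of _ Q]) (auto simp: multipliers_def minors_def)
  qed
qed

lemma openin_open_reps: "openin (zariski K TS) open_reps"
proof (rule is_zariski_open_nonvanishing)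
  show "(\<lambda>Q \<psi>. minors Q (pad \<psi>)) ` multipliers \<subseteq> polyfun K (coords TS)"
    using polyfun_minors[OF polyvec_pad] by blast
  show "open_reps \<subseteq> points_over K TS" by (auto simp: open_reps_def points_over_def)
  fix \<psi> assume \<psi>: "\<psi> \<in> reps_over K TS"
  have "pad \<psi> = \<psi>" using \<psi> by (simp add: pad_eq reps_over_tensor reps_tensor)
  then show "pt TS \<psi> \<in> open_reps \<longleftrightarrow> (\<exists>p\<in>(\<lambda>Q \<psi>. minors Q (pad \<psi>)) ` multipliers. p \<psi> \<noteq> 0)"
    unfolding open_reps_iff[OF \<psi>] minors_iff[OF \<psi>, symmetric] by simp
qed

lemma open_reps_open: "tt_variety n k r \<inter> open_reps = tt_open n k r \<inter> points_over K TS"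
proof -
  have "proj_vec \<psi> \<in> tt_variety n k r \<and> proj_vec \<psi> \<in> open_reps \<longleftrightarrow> proj_vec \<psi> \<in> tt_open n k r"
    if "\<psi> \<in> reps_over K TS" for \<psi>
    using open_reps_iff[OF that] open_iff[of \<psi>] that by (simp add: reps_over_tensor)
  moreover have "open_reps \<subseteq> points_over K TS" by (auto simp: open_reps_def points_over_def)
  ultimately show ?thesis unfolding points_over_def by auto
qed

lemma inverse_regular:
  "regular_map K TS (tt_open n k r \<inter> points_over K TS) PS
    (inv_into (tt_domain \<inter> points_over K PS) (tt_map n k r))"
  unfolding regular_map_def
proof
  let ?B = "tt_open n k r \<inter> points_over K TS" and ?A = "tt_domain \<inter> points_over K PS"
  fix y assume y: "y \<in> ?B"
  then obtain \<psi> where \<psi>: "\<psi> \<in> reps_over K TS" "y = proj_vec \<psi>" by (auto simp: points_over_def)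
  have o: "proj_vec \<psi> \<in> tt_open n k r" using y \<psi>(2) by simp
  obtain Q where Q: "Q \<in> multipliers" "minors Q \<psi> \<noteq> 0"
    using minors_iff[OF \<psi>(1)] open_iff[of \<psi>] \<psi>(1) o by (auto simp: reps_over_tensor)
  \<comment> \<open>A neighbourhood on which the multipliers chosen for \<open>\<psi>\<close> keep
    working, so that \<open>factors Q\<close> is one polynomial formula for the inverse
    there.\<close>
  define W where "W = {pt TS \<phi> | \<phi>. \<phi> \<in> reps_over K TS \<and> minors Q \<phi> \<noteq> 0}"
  have Wiff: "pt TS \<phi> \<in> W \<longleftrightarrow> minors Q \<phi> \<noteq> 0" if \<phi>: "\<phi> \<in> reps_over K TS" for \<phi>
  proof
    assume "pt TS \<phi> \<in> W"
    then obtain \<chi> where \<chi>: "\<chi> \<in> reps_over K TS" "proj_vec \<chi> = proj_vec \<phi>" "minors Q \<chi> \<noteq> 0"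
      unfolding W_def by auto
    obtain c where c: "c \<noteq> 0" "\<phi> = c \<cdot>\<^sub>v \<chi>" using \<chi>(2) unfolding proj_vec_eq_iff by blast
    have dim: "\<chi> \<in> carrier_vec (right_dim 0)" using \<chi>(1) by (simp add: reps_over_tensor reps_tensor)
    have "det (fact_mat \<phi> (Suc i) * Q i) \<noteq> 0" if i: "i < n" for i
    proof -
      have Qi: "Q i \<in> carrier_mat (right_dim (Suc i)) (r (Suc i))" using Q(1) i by (simp add: multipliers_def)
      have "fact_mat \<phi> (Suc i) * Q i = c \<cdot>\<^sub>m (fact_mat \<chi> (Suc i) * Q i)"
        unfolding c(2) using fact_smult[OF dim, of "Suc i"] i mult_smult_assoc_mat[OF fact_mat_carrier Qi] by simp
      then show ?thesis using \<chi>(3) i c(1) by (simp add: minors_def)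
    qed
    then show "minors Q \<phi> \<noteq> 0" by (simp add: minors_def)
  qed (use \<phi> in \<open>auto simp: W_def\<close>)
  have openW: "openin (zariski K TS) W"
  proof (rule is_zariski_open_nonvanishing)
    show "{\<lambda>\<phi>. minors Q (pad \<phi>)} \<subseteq> polyfun K (coords TS)"
      using polyfun_minors[OF polyvec_pad Q(1)] by blast
    show "W \<subseteq> points_over K TS" by (auto simp: W_def points_over_def)
    fix \<phi> assume \<phi>: "\<phi> \<in> reps_over K TS"
    have "pad \<phi> = \<phi>" using \<phi> by (simp add: pad_eq reps_over_tensor reps_tensor)
    then show "pt TS \<phi> \<in> W \<longleftrightarrow> (\<exists>p\<in>{\<lambda>\<phi>. minors Q (pad \<phi>)}. p \<phi> \<noteq> 0)"
      using Wiff[OF \<phi>] by simp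
  qed
  show "\<exists>N P. openin (subtopology (zariski K TS) ?B) N \<and> y \<in> N \<and>
      (\<forall>c\<in>coords PS. (\<lambda>x. c (P x)) \<in> polyfun K (coords TS)) \<and>
      (\<forall>x\<in>reps_over K TS. pt TS x \<in> N \<longrightarrow> P x \<in> reps PS \<and> inv_into ?A (tt_map n k r) (pt TS x) = pt PS (P x))"
  proof (intro exI conjI ballI impI)
    show "openin (subtopology (zariski K TS) ?B) (W \<inter> ?B)"
      unfolding openin_subtopology using openW by blast
    show "y \<in> W \<inter> ?B" using y Wiff[OF \<psi>(1)] Q(2) \<psi>(2) by simp
  next
    fix c assume "c \<in> coords PS"
    then consider i a b where "i < n" "a < r i * k i" "b < r (Suc i)" "c = (\<lambda>A. A i $$ (a, b))"
      | a b where "a < r n" "b < k n" "c = (\<lambda>A. A n $$ (a, b))"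
      by (auto simp: param_space_def)
    then show "(\<lambda>x. c (factors Q (pad x))) \<in> polyfun K (coords TS)"
    proof cases
      case 1
      have "polymat K (coords TS) (r i * k i) (r (Suc i)) (\<lambda>x. fact_unfolding n k r (pad x) i * Q i)"
        using Q(1) 1(1) by (intro polymat_mult[OF polymat_fact(2)[OF polyvec_pad] polymat_const])
          (auto simp: multipliers_def)
      then show ?thesis using polymatD(2) 1 by (simp add: factors_def)
    next
      case 2
      then show ?thesis using polymatD(2)[OF polymat_fact(1)[OF polyvec_pad, of n]] by (simp add: factors_def)
    qed
  next
    fix \<phi> assume \<phi>: "\<phi> \<in> reps_over K TS" and N: "pt TS \<phi> \<in> W \<inter> ?B"
    have \<phi>r: "\<phi> \<in> reps TS" using \<phi> by (simp add: reps_over_tensor)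
    have pad: "pad \<phi> = \<phi>" using \<phi>r by (simp add: pad_eq reps_tensor)
    have o: "proj_vec \<phi> \<in> tt_open n k r" using N by simp
    have Qc: "Q i \<in> carrier_mat (right_dim (Suc i)) (r (Suc i))" "mat_over K (Q i)" if "i < n" for i
      using Q(1) that by (auto simp: multipliers_def)
    have det: "det (fact_mat \<phi> (Suc i) * Q i) \<noteq> 0" if "i < n" for i
      using Wiff[OF \<phi>] N that by (simp add: minors_def)
    show "factors Q (pad \<phi>) \<in> reps PS" unfolding pad using factors(1)[OF \<phi>r o Qc(1) det] .
    have "pt PS (factors Q \<phi>) \<in> ?A"
      using factors(2)[OF \<phi>r o Qc(1) det] factors_over[OF \<phi> o Qc det] unfolding points_over_def by blast
    moreover have "inj_on (tt_map n k r) ?A" using tt_map_inj by (rule inj_on_subset) blast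
    ultimately show "inv_into ?A (tt_map n k r) (pt TS \<phi>) = pt PS (factors Q (pad \<phi>))"
      unfolding pad pt_tensor using factors(3)[OF \<phi>r o Qc(1) det] by (metis inv_into_f_f)
  qed
qed

subsection \<open>Density\<close>

text \<open>Both nonvanishing conditions can be met on the line through \<open>x\<close> and \<open>y\<close>: each fails at only finitely many
  points of it.\<close>

lemma common_nonvanishing:
  assumes p: "p \<in> polyfun K (coords PS)" "p x \<noteq> 0" and q: "q \<in> polyfun K (coords PS)" "q y \<noteq> 0"
    and x: "\<And>c. c \<in> coords PS \<Longrightarrow> c x \<in> K" and y: "\<And>c. c \<in> coords PS \<Longrightarrow> c y \<in> K"
  shows "\<exists>w. cores w \<and> (\<forall>i\<le>n. mat_over K (w i)) \<and> p w \<noteq> 0 \<and> q w \<noteq> 0"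
proof -
  define \<gamma> where "\<gamma> t i = (if i < n
      then mat (r i * k i) (r (Suc i)) (\<lambda>ab. x i $$ ab + t * (y i $$ ab - x i $$ ab))
      else mat (r n) (k n) (\<lambda>ab. x n $$ ab + t * (y n $$ ab - x n $$ ab)))" for t i
  have \<gamma>: "c (\<gamma> t) = c x + t * (c y - c x)" if "c \<in> coords PS" for c t
    using that by (auto simp: param_space_def \<gamma>_def)
  have cores: "cores (\<gamma> t)" for t by (simp add: cores_def \<gamma>_def)
  have line: "\<exists>f. \<forall>t. c (\<gamma> t) = poly f t" if "c \<in> coords PS" for c
    by (intro exI[of _ "[:c x, c y - c x:]"]) (simp add: \<gamma>[OF that])
  have "\<exists>f. \<forall>t. p (\<gamma> t) = poly f t" by (rule polyfun_poly[OF p(1)]) (rule line)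
  then obtain f where f: "\<And>t. p (\<gamma> t) = poly f t" by blast
  have "\<exists>g. \<forall>t. q (\<gamma> t) = poly g t" by (rule polyfun_poly[OF q(1)]) (rule line)
  then obtain g where g: "\<And>t. q (\<gamma> t) = poly g t" by blast
  \<comment> \<open>\<open>\<gamma> 0\<close> has the same coordinates as \<open>x\<close> but is
    cut to size, so it need not be the same function.\<close>
  have "p (\<gamma> 0) = p x" by (rule polyfun_cong[OF p(1)]) (simp add: \<gamma>)
  then have "f \<noteq> 0" using f[of 0] p(2) by auto
  have "q (\<gamma> 1) = q y" by (rule polyfun_cong[OF q(1)]) (simp add: \<gamma>)
  then have "g \<noteq> 0" using g[of 1] q(2) by auto
  with \<open>f \<noteq> 0\<close> obtain m :: nat where m: "poly f (of_nat m) \<noteq> 0" "poly g (of_nat m) \<noteq> 0"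
    using poly_common_nonroot by blast
  define w where "w = \<gamma> (of_nat m)"
  have wK: "c w \<in> K" if "c \<in> coords PS" for c
    unfolding w_def \<gamma>[OF that] using x[OF that] y[OF that] by simp
  have "mat_over K (w i)" if "i \<le> n" for i
  proof (cases "i < n")
    case True
    then show ?thesis
      using wK[OF coords_core[OF True]] carrier_matD[OF coresD(1)[OF cores True]]
      unfolding mat_over_def w_def by simp
  next
    case False
    then have "i = n" using that by simp
    then show ?thesis
      using wK[OF coords_core_n] carrier_matD[OF coresD(2)[OF cores]]
      unfolding mat_over_def w_def by simp
  qed
  then show ?thesis using cores m f g unfolding w_def by (intro exI[of _ "\<gamma> (of_nat m)"]) simp
qed

section \<open>Generic factors\<close>

definition top_minors :: "(nat \<Rightarrow> complex mat) \<Rightarrow> complex" where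
  "top_minors A = (\<Prod>i<n. det (top_block (trunc A) i))"

text \<open>The unit blocks pick leading maximal minors of the side unfoldings and of the last
  matrix. A fixed choice is enough, since density asks for just one polynomial that forces the image
  into \<open>tt_open\<close>.\<close>

definition side_minors :: "(nat \<Rightarrow> complex mat) \<Rightarrow> complex" where
  "side_minors A = (\<Prod>i<n. det (unfold_vec (r i) (k i * r (Suc i)) (flat_mat (trunc A i)) *
      unit_block (k i * r (Suc i)) (r i))) * det (trunc A n * unit_block (k n) (r n))"

lemma polyfun_top_minors: "top_minors \<in> polyfun K (coords PS)"
  unfolding top_minors_def[abs_def]
proof (rule polyfun_prod)
  fix i assume "i \<in> {..<n}"
  then have "i < n" by simp
  then show "(\<lambda>A. det (top_block (trunc A) i)) \<in> polyfun K (coords PS)"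
    by (rule polyfun_det[OF polymat_top_block])
qed

lemma polyfun_last_minor:
  assumes "Q \<in> carrier_mat (k n) (r n)" "mat_over K Q"
  shows "(\<lambda>A. det (trunc A n * Q)) \<in> polyfun K (coords PS)"
  by (rule polyfun_det[OF polymat_mult[OF polymat_trunc(2) polymat_const[OF assms]]])

lemma polyfun_side_minors: "side_minors \<in> polyfun K (coords PS)"
  unfolding side_minors_def[abs_def]
proof (intro polyfun.mult polyfun_prod polyfun_last_minor mat_over_unit_block unit_block_carrier)
  fix i assume "i \<in> {..<n}"
  then have i: "i < n" by simp
  have "polyvec K (coords PS) (r i * (k i * r (Suc i))) (\<lambda>A. flat_mat (trunc A i))"
    using polyvec_flat[OF polymat_trunc(1)[OF i]] by (simp add: mult.assoc)
  from polymat_mult[OF polymat_unfold[OF this] polymat_const[OF unit_block_carrier mat_over_unit_block]]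
  show "(\<lambda>A. det (unfold_vec (r i) (k i * r (Suc i)) (flat_mat (trunc A i)) * unit_block (k i * r (Suc i)) (r i)))
    \<in> polyfun K (coords PS)" by (rule polyfun_det)
qed

text \<open>Unit blocks turn minors into 1: for \<open>X\<close> in the ordinary unfolding, thanks
  to \<open>r (Suc i) \<le> r i * k i\<close>, and for \<open>Z\<close> in the side unfolding,
  thanks to \<open>r i \<le> k i * r (Suc i)\<close>. One tuple of unit blocks need not do both, so
  the two tuples are joined by a line.\<close>

lemma generic_cores_exist:
  "\<exists>Y. cores Y \<and> (\<forall>i\<le>n. mat_over K (Y i)) \<and> top_minors Y \<noteq> 0 \<and> side_minors Y \<noteq> 0"
proof -
  define X where "X i = (if i < n then unit_block (r i * k i) (r (Suc i)) else unit_block (r n) (k n))" for i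
  define Z where "Z i = (if i < n then unfold_vec (r i * k i) (r (Suc i)) (flat_mat (unit_block (r i) (k i * r (Suc i))))
    else unit_block (r n) (k n))" for i
  have cX: "cores X" and cZ: "cores Z" by (simp_all add: cores_def X_def Z_def)
  have KX: "mat_over K (X i)" for i by (simp add: X_def mat_over_unit_block)
  have "mat_over K (unfold_vec a b (flat_mat (unit_block c d)))" if "a * b = c * d" for a b c d
    unfolding mat_over_def
  proof (intro allI impI)
    fix i j assume "i < dim_row (unfold_vec a b (flat_mat (unit_block c d)))"
      "j < dim_col (unfold_vec a b (flat_mat (unit_block c d)))"
    then have ij: "i < a" "j < b" by auto
    then have "i * b + j < c * d" using index_less[OF ij] that by simp
    then show "unfold_vec a b (flat_mat (unit_block c d)) $$ (i, j) \<in> K"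
      using ij index_split[of "i * b + j" c d] by (simp add: flat_mat_def unit_block_def)
  qed
  then have KZ: "mat_over K (Z i)" for i by (simp add: Z_def mat_over_unit_block mult.assoc)
  have "top_block (trunc X) i = 1\<^sub>m (r (Suc i))" if i: "i < n" for i
    using i trunc_eq[OF cX, of i] r_Suc_le[OF i]
    by (intro eq_matI) (auto simp: X_def top_rows_def unit_block_def)
  then have topX: "top_minors X \<noteq> 0" by (simp add: top_minors_def)
  have side: "unfold_vec (r i) (k i * r (Suc i)) (flat_mat (trunc Z i)) * unit_block (k i * r (Suc i)) (r i) = 1\<^sub>m (r i)"
    if i: "i < n" for i
  proof -
    have "flat_mat (unit_block (r i) (k i * r (Suc i))) \<in> carrier_vec (r i * k i * r (Suc i))"
      using flat_mat_carrier[OF unit_block_carrier[of "r i" "k i * r (Suc i)"]] by (simp add: mult.assoc)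
    then have "flat_mat (Z i) = flat_mat (unit_block (r i) (k i * r (Suc i)))"
      using i by (simp add: Z_def)
    then show ?thesis using i trunc_eq[OF cZ, of i] unit_block_mult[OF r_le[OF i]]
      by (simp add: unfold_flat[OF unit_block_carrier])
  qed
  have "trunc Z n * unit_block (k n) (r n) = 1\<^sub>m (r n)"
    using trunc_eq[OF cZ, of n] unit_block_mult[OF r_n] by (simp add: Z_def)
  then have sideZ: "side_minors Z \<noteq> 0" using side by (simp add: side_minors_def)
  show ?thesis
    by (rule common_nonvanishing[OF polyfun_top_minors topX polyfun_side_minors sideZ])
      (auto intro: coords_over_cores[OF cX KX] coords_over_cores[OF cZ KZ])
qed

lemma generic_cores:
  assumes w: "cores w" "\<forall>i\<le>n. mat_over K (w i)" "top_minors w \<noteq> 0" "side_minors w \<noteq> 0"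
  shows "w \<in> reps_over K PS" "pt PS w \<in> tt_domain"
proof -
  have tr: "trunc w i = w i" if "i \<le> n" for i using trunc_eq[OF w(1) that] .
  have det: "\<forall>i<n. det (top_block w i) \<noteq> 0" using w(3) tr by (simp add: top_minors_def)
  have wn: "w n \<in> carrier_mat (r n) (k n)" using coresD(2)[OF w(1)] .
  have "det (w n * unit_block (k n) (r n)) \<noteq> 0" using w(4) tr by (simp add: side_minors_def)
  then have "right_invertible (w n * unit_block (k n) (r n))"
    using right_invertible_square[OF mult_carrier_mat[OF wn unit_block_carrier]] by simp
  then have invn: "right_invertible (w n)" by (rule right_invertible_mult[OF wn unit_block_carrier])
  then have "w n \<noteq> 0\<^sub>m (r n) (k n)" by (rule right_invertible_nonzero[OF _ wn]) (simp add: r_pos)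
  then have reps: "w \<in> reps PS"
    unfolding reps_param using w(1) top_invertible_full_rank[OF coresD(1)[OF w(1)] r_Suc_le] det by simp
  then show "w \<in> reps_over K PS" using w(2) by (simp add: reps_over_param)
  have chart: "pt PS w \<in> tt_chart n k r" using chart_iff[OF reps] det invn by blast
  note m = chart_map[OF reps chart]
  note nc = normal_cores[OF w(1) det]
  have cX: "cores (normal_cores w)" using nc(1) by (simp add: normalized_def)
  have side: "right_invertible (unfold_vec (r i) (k i * r (Suc i)) (flat_mat (normal_cores w i)))" if i: "i < n" for i
  proof -
    let ?M = "unfold_vec (r i) (k i * r (Suc i)) (flat_mat (w i))"
    have M: "?M \<in> carrier_mat (r i) (k i * r (Suc i))" by simp
    have "det (?M * unit_block (k i * r (Suc i)) (r i)) \<noteq> 0"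
      using w(4) i tr by (simp add: side_minors_def)
    then have "right_invertible (?M * unit_block (k i * r (Suc i)) (r i))"
      using right_invertible_square[OF mult_carrier_mat[OF M unit_block_carrier]] by simp
    then have "right_invertible ?M" by (rule right_invertible_mult[OF M unit_block_carrier])
    \<comment> \<open>A core is its normal form times the top block, which acts on the last index.
      In the side unfolding this is still a factor on the right, so full row rank descends to the
      normal form.\<close>
    moreover have "?M = unfold_vec (r i) (k i * r (Suc i)) (flat_mat (normal_cores w i)) * id_kron (k i) (top_block w i)"
      using unfold_mult_right[OF coresD(1)[OF cX i] top_block_carrier[OF w(1) i]] nc(5)[OF i] by simp
    ultimately show ?thesis
      using right_invertible_mult[OF unfold_vec_carrier id_kron_carrier[OF top_block_carrier[OF w(1) i]]] by metis
  qed
  have "right_invertible (fact_mat (decompress n k r (normal_cores w)) (Suc i))" if "i < n" for i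
    using tail_right_invertible[OF cX side, of "Suc i"] nc(2) invn that fact_decompress_tail[OF nc(1), of "Suc i"]
    by simp
  then have "proj_vec (decompress n k r (normal_cores w)) \<in> tt_open n k r"
    using open_iff[OF m(2)] m(6) unfolding m(4) by blast
  then show "pt PS w \<in> tt_domain" using chart unfolding tt_domain_def m(4)[symmetric] by blast
qed

lemma param_dense:
  assumes A: "A \<in> reps_over K PS" and p: "p \<in> polyfun K (coords PS)" "p A \<noteq> 0"
  shows "\<exists>B\<in>reps_over K PS. p B \<noteq> 0 \<and> pt PS B \<in> tt_domain"
proof -
  obtain Y where Y: "cores Y" "\<forall>i\<le>n. mat_over K (Y i)" "top_minors Y \<noteq> 0" "side_minors Y \<noteq> 0"
    using generic_cores_exist by blast
  have "(\<lambda>A. top_minors A * side_minors A) \<in> polyfun K (coords PS)"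
    by (intro polyfun.mult polyfun_top_minors polyfun_side_minors)
  moreover have "top_minors Y * side_minors Y \<noteq> 0" using Y by simp
  ultimately have "\<exists>w. cores w \<and> (\<forall>i\<le>n. mat_over K (w i)) \<and> p w \<noteq> 0 \<and> top_minors w * side_minors w \<noteq> 0"
    by (rule common_nonvanishing[OF p, where q = "\<lambda>A. top_minors A * side_minors A"])
      (use coords_over_param[OF A] coords_over_cores[OF Y(1)] Y(2) in auto)
  then obtain w where w: "cores w" "\<forall>i\<le>n. mat_over K (w i)" "p w \<noteq> 0" "top_minors w * side_minors w \<noteq> 0"
    by blast
  then have "top_minors w \<noteq> 0" "side_minors w \<noteq> 0" by auto
  from generic_cores[OF w(1,2) this] w(3) show ?thesis by blast
qed

text \<open>Pulled back along decompression, \<open>p\<close> does not vanish at a decomposition of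
  \<open>\<psi>\<close>, and the minors do not vanish at a generic tuple; some tuple satisfies both.
  Its decompression stays in the variety because the sizes of the cores bound the ranks.\<close>

lemma tensor_dense:
  assumes \<psi>: "\<psi> \<in> reps_over K TS" "proj_vec \<psi> \<in> tt_variety n k r"
    and p: "p \<in> polyfun K (coords TS)" "p \<psi> \<noteq> 0"
  shows "\<exists>\<phi>\<in>reps_over K TS. p \<phi> \<noteq> 0 \<and> proj_vec \<phi> \<in> tt_open n k r"
proof -
  have \<psi>r: "\<psi> \<in> reps TS" and \<psi>K: "\<And>j. j < right_dim 0 \<Longrightarrow> \<psi> $ j \<in> K"
    using \<psi>(1) by (auto simp: reps_over_tensor)
  have \<psi>d: "\<psi> \<in> carrier_vec (right_dim 0)" "\<psi> \<noteq> 0\<^sub>v (right_dim 0)" using \<psi>r by (auto simp: reps_tensor)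
  obtain Z where Z: "cores Z" "\<forall>i\<le>n. mat_over K (Z i)" "decompress n k r Z = \<psi>"
    using decomposition_exists[OF scalars_axioms \<psi>d(1) \<psi>K] \<psi>(2) variety_iff[OF \<psi>r] by blast
  \<comment> \<open>This coordinate becomes a factor of \<open>f\<close>, which ensures that the new
    tensor is nonzero and represents a projective point.\<close>
  obtain j where j: "j < right_dim 0" "\<psi> $ j \<noteq> 0"
  proof (rule ccontr)
    assume "\<not> thesis"
    then have "\<psi> = 0\<^sub>v (right_dim 0)" using \<psi>d(1) that by (intro eq_vecI) auto
    then show False using \<psi>d(2) by simp
  qed
  obtain Y where Y: "cores Y" "\<forall>i\<le>n. mat_over K (Y i)" "top_minors Y \<noteq> 0" "side_minors Y \<noteq> 0"
    using generic_cores_exist by blast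
  note gY = generic_cores[OF Y]
  have chart: "pt PS Y \<in> tt_chart n k r" using gY(2) by (simp add: tt_domain_def)
  have Yr: "Y \<in> reps PS" using gY(1) by (simp add: reps_over_param)
  have \<chi>: "decompress n k r (gauge Y) \<in> reps_over K TS"
    using decompress_gauge_reps_over[OF gY(1) chart] .
  have "proj_vec (decompress n k r (gauge Y)) \<in> tt_open n k r"
    using gY(2) chart_map(5)[OF Yr chart] by (simp add: tt_domain_def)
  then obtain Q where Q: "Q \<in> multipliers" "minors Q (decompress n k r (gauge Y)) \<noteq> 0"
    using minors_iff[OF \<chi>] open_iff[OF chart_map(3)[OF Yr chart]] by blast
  have dec_trunc: "decompress n k r (trunc A) = decompress n k r A" if "cores A" for A
    using trunc_eq[OF that] by (rule decompress_cong)
  \<comment> \<open>The second end of the line is \<open>gauge Y\<close> and not \<open>Y\<close>,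
    as it is the decompression of \<open>gauge Y\<close> that represents the image of the parameter
    given by \<open>Y\<close>.\<close>
  have gK: "mat_over K (gauge Y i)" if "i \<le> n" for i
  proof (cases "i < n")
    case True
    show ?thesis by (rule mat_over_polymat[OF polymat_gauge(1)[OF True]]) (use coords_over_param[OF gY(1)] in blast)
  next
    case False
    then have "i = n" using that by simp
    show ?thesis unfolding \<open>i = n\<close>
      by (rule mat_over_polymat[OF polymat_gauge(2)]) (use coords_over_param[OF gY(1)] in blast)
  qed
  define f where "f A = p (decompress n k r (trunc A)) * decompress n k r (trunc A) $ j" for A
  define g where "g A = minors Q (decompress n k r (trunc A))" for A
  have f: "f \<in> polyfun K (coords PS)"
    unfolding f_def[abs_def]
    using polyfun_tensor_compose[OF p(1) polyvec_trunc] polyvec_trunc j(1)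
    by (intro polyfun.mult) (simp_all add: polyvec_def)
  have g: "g \<in> polyfun K (coords PS)"
    unfolding g_def[abs_def] by (rule polyfun_minors[OF polyvec_trunc Q(1)])
  have fZ: "f Z \<noteq> 0" using p(2) j(2) Z dec_trunc[OF Z(1)] by (simp add: f_def)
  have gY': "g (gauge Y) \<noteq> 0" using Q(2) dec_trunc[OF cores_gauge] by (simp add: g_def)
  have "\<exists>w. cores w \<and> (\<forall>i\<le>n. mat_over K (w i)) \<and> f w \<noteq> 0 \<and> g w \<noteq> 0"
    by (rule common_nonvanishing[OF f fZ g gY'])
      (use coords_over_cores[OF Z(1)] Z(2) coords_over_cores[OF cores_gauge gK] in auto)
  then obtain w where w: "cores w" "\<forall>i\<le>n. mat_over K (w i)" "f w \<noteq> 0" "g w \<noteq> 0" by blast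
  define \<phi> where "\<phi> = decompress n k r w"
  have fw: "p \<phi> \<noteq> 0" "\<phi> $ j \<noteq> 0" and gw: "minors Q \<phi> \<noteq> 0"
    using w(3,4) dec_trunc[OF w(1)] by (auto simp: f_def g_def \<phi>_def)
  have "\<phi> \<noteq> 0\<^sub>v (right_dim 0)" using fw(2) j(1) by auto
  then have \<phi>r: "\<phi> \<in> reps TS" using decompress_carrier[OF w(1)] by (simp add: reps_tensor \<phi>_def)
  have "\<phi> $ l \<in> K" if "l < right_dim 0" for l
  proof -
    have "(\<lambda>A. decompress n k r (trunc A) $ l) \<in> polyfun K (coords PS)"
      using polyvec_trunc that by (simp add: polyvec_def)
    then have "decompress n k r (trunc w) $ l \<in> K"
      by (rule polyfun_eval) (use coords_over_cores[OF w(1)] w(2) in blast)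
    then show ?thesis using dec_trunc[OF w(1)] by (simp add: \<phi>_def)
  qed
  then have \<phi>: "\<phi> \<in> reps_over K TS" using \<phi>r by (simp add: reps_over_tensor)
  have "proj_vec \<phi> \<in> tt_variety n k r"
    using variety_iff[OF \<phi>r] rank_flat_decompress[OF w(1)] by (simp add: \<phi>_def)
  moreover have "\<forall>i<n. right_invertible (fact_mat \<phi> (Suc i))" using minors_iff[OF \<phi>] Q(1) gw by blast
  ultimately have "proj_vec \<phi> \<in> tt_open n k r" using open_iff[OF \<phi>r] by blast
  then show ?thesis using \<phi> fw(1) by blast
qed

section \<open>Open dense subsets and birationality\<close>

lemma chart_condition:
  assumes A: "A \<in> reps_over K PS"
  shows "pt PS A \<in> tt_chart n k r \<longleftrightarrow>
    (\<exists>Q\<in>carrier_mat (k n) (r n). mat_over K Q \<and> top_minors A * det (trunc A n * Q) \<noteq> 0)"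
proof -
  have Ar: "A \<in> reps PS" and An: "mat_over K (A n)" using A by (auto simp: reps_over_param)
  have cA: "cores A" using Ar by (simp add: reps_param)
  show ?thesis
    unfolding chart_iff[OF Ar] right_invertible_det[OF coresD(2)[OF cA] An] top_minors_def
    using trunc_eq[OF cA] by auto
qed

lemma openin_chart: "openin (zariski K PS) (tt_chart n k r \<inter> points_over K PS)"
proof (rule is_zariski_open_nonvanishing)
  let ?P = "(\<lambda>Q A. top_minors A * det (trunc A n * Q)) ` {Q \<in> carrier_mat (k n) (r n). mat_over K Q}"
  show "?P \<subseteq> polyfun K (coords PS)"
    using polyfun.mult[OF polyfun_top_minors polyfun_last_minor] by blast
  fix A assume A: "A \<in> reps_over K PS"
  then have "pt PS A \<in> points_over K PS" by (auto simp: points_over_def)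
  then show "pt PS A \<in> tt_chart n k r \<inter> points_over K PS \<longleftrightarrow> (\<exists>p\<in>?P. p A \<noteq> 0)"
    using chart_condition[OF A] by auto
qed simp

lemma openin_domain: "openin (zariski K PS) (tt_domain \<inter> points_over K PS)"
proof (rule is_zariski_open_nonvanishing)
  let ?P = "(\<lambda>(Q, Q') A. top_minors A * det (trunc A n * Q) * minors Q' (decompress n k r (gauge A))) `
    ({Q \<in> carrier_mat (k n) (r n). mat_over K Q} \<times> multipliers)"
  show "?P \<subseteq> polyfun K (coords PS)"
    using polyfun.mult[OF polyfun.mult[OF polyfun_top_minors polyfun_last_minor] polyfun_minors[OF polyvec_gauge]]
    by auto
  fix A assume A: "A \<in> reps_over K PS"
  then have pt: "pt PS A \<in> points_over K PS" by (auto simp: points_over_def)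
  have Ar: "A \<in> reps PS" using A by (simp add: reps_over_param)
  show "pt PS A \<in> tt_domain \<inter> points_over K PS \<longleftrightarrow> (\<exists>p\<in>?P. p A \<noteq> 0)"
  proof (cases "pt PS A \<in> tt_chart n k r")
    case True
    note m = chart_map[OF Ar True]
    have "tt_map n k r (pt PS A) \<in> tt_open n k r \<longleftrightarrow>
        (\<exists>Q\<in>multipliers. minors Q (decompress n k r (gauge A)) \<noteq> 0)"
      using open_iff[OF m(3)] m(6) minors_iff[OF decompress_gauge_reps_over[OF A True]] unfolding m(5) by blast
    then show ?thesis using True pt chart_condition[OF A] unfolding tt_domain_def by auto
  next
    \<comment> \<open>Off the chart the product of the first two factors vanishes for every
      \<open>Q\<close>, whatever tensor \<open>gauge A\<close> decompresses to.\<close>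
    case False
    then show ?thesis using chart_condition[OF A] unfolding tt_domain_def by auto
  qed
qed simp

lemma chart_dense_open:
  "dense_open_in (zariski K PS) (points_over K PS) (tt_chart n k r \<inter> points_over K PS)"
proof (rule dense_open_in_zariskiI[OF subset_refl openin_chart])
  fix A p assume "A \<in> reps_over K PS" "p \<in> polyfun K (coords PS)" "p A \<noteq> 0"
  from param_dense[OF this] show "\<exists>y\<in>reps_over K PS. p y \<noteq> 0 \<and> pt PS y \<in> tt_chart n k r \<inter> points_over K PS"
    unfolding tt_domain_def points_over_def by blast
qed blast

lemma domain_dense_open:
  "dense_open_in (zariski K PS) (points_over K PS) (tt_domain \<inter> points_over K PS)"
proof (rule dense_open_in_zariskiI[OF subset_refl openin_domain])
  fix A p assume "A \<in> reps_over K PS" "p \<in> polyfun K (coords PS)" "p A \<noteq> 0"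
  from param_dense[OF this] show "\<exists>y\<in>reps_over K PS. p y \<noteq> 0 \<and> pt PS y \<in> tt_domain \<inter> points_over K PS"
    unfolding points_over_def by blast
qed blast

text \<open>\<open>S\<close> is kept general for two applications: the complex manifold, and the
  real points of the variety.\<close>

lemma tensor_dense_open:
  assumes "S \<subseteq> tt_variety n k r \<inter> points_over K TS" "tt_open n k r \<inter> points_over K TS \<subseteq> S"
  shows "dense_open_in (zariski K TS) S (tt_open n k r \<inter> points_over K TS)"
proof (rule dense_open_in_zariskiI[OF _ openin_open_reps])
  show "S \<subseteq> points_over K TS" using assms(1) by blast
  show "tt_open n k r \<inter> points_over K TS = S \<inter> open_reps" using assms open_reps_open by blast
  fix \<psi> p assume "\<psi> \<in> reps_over K TS" "pt TS \<psi> \<in> S" "p \<in> polyfun K (coords TS)" "p \<psi> \<noteq> 0"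
  then show "\<exists>y\<in>reps_over K TS. p y \<noteq> 0 \<and> pt TS y \<in> tt_open n k r \<inter> points_over K TS"
    using tensor_dense[of \<psi> p] assms(1) unfolding points_over_def pt_tensor by blast
qed

text \<open>The map is regular on the whole chart, but the isomorphism is between the smaller sets
  \<open>tt_domain\<close> and \<open>tt_open\<close>, because a point of the chart may go to a
  tensor whose flattenings drop rank.\<close>

lemma tt_map_birational:
  "birational_map K PS (points_over K PS) TS (tt_variety n k r \<inter> points_over K TS)
    (tt_chart n k r \<inter> points_over K PS) (tt_map n k r)"
proof -
  have "rational_map K PS (points_over K PS) TS (tt_variety n k r \<inter> points_over K TS)
      (tt_chart n k r \<inter> points_over K PS) (tt_map n k r)"
    unfolding rational_map_def using chart_dense_open tt_map_regular[OF subset_refl] tt_map_variety tt_map_over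
    by blast
  moreover have "tt_open n k r \<inter> points_over K TS \<subseteq> tt_variety n k r \<inter> points_over K TS"
    using open_reps_open by blast
  note tensor_dense_open[OF subset_refl this]
  moreover have "tt_domain \<inter> points_over K PS \<subseteq> tt_chart n k r \<inter> points_over K PS"
    unfolding tt_domain_def by blast
  ultimately show ?thesis
    unfolding birational_map_def using domain_dense_open tt_map_bij inverse_regular by blast
qed

end

section \<open>The complex parametrization and the real birational map\<close>

theorem theorem6p3:
  fixes n :: nat and k r :: "nat \<Rightarrow> nat"
  assumes "\<forall>i\<le>n. 0 < k i"
    and "\<forall>i\<in>{1..n}. 0 < r i"
    and "r 0 = 1" and "r (n + 1) = 1"
    and "\<forall>i\<in>{1..n}. r i \<le> r (i - 1) * k (i - 1)"
    and "\<forall>i\<in>{1..n}. r i \<le> r (i + 1) * k i"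
  shows
    "dense_open_in (zariski UNIV (param_space n k r)) (tt_parameters n k r) (tt_chart n k r) \<and>
     tt_map n k r ` tt_chart n k r \<subseteq> tt_variety n k r \<and>
     (\<forall>z\<in>tt_chart n k r. tt_map n k r z \<in> tt_manifold n k r \<longrightarrow> tt_map n k r z \<in> tt_open n k r) \<and>
     rational_map UNIV (param_space n k r) (tt_parameters n k r)
       (tensor_space n k) (tt_manifold n k r)
       {z \<in> tt_chart n k r. tt_map n k r z \<in> tt_open n k r} (tt_map n k r) \<and>
     bij_betw (tt_map n k r)
       {z \<in> tt_chart n k r. tt_map n k r z \<in> tt_open n k r} (tt_open n k r) \<and>
     dense_open_in (zariski UNIV (tensor_space n k)) (tt_manifold n k r) (tt_open n k r) \<and>
     birational_map \<real> (param_space n k r) (points_over \<real> (param_space n k r))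
       (tensor_space n k) (tt_variety n k r \<inter> points_over \<real> (tensor_space n k))
       (tt_chart n k r \<inter> points_over \<real> (param_space n k r)) (tt_map n k r)"
proof -
  interpret tensor_train n k r
  proof
    show pos: "0 < k i" if "i \<le> n" for i using assms(1) that by blast
    show r: "0 < r i" if "i \<le> n" for i using assms(2,3) that by (cases i) auto
    show "r 0 = 1" by fact
    \<comment> \<open>For \<open>n = 0\<close> the inequalities at indices from 1 to
      \<open>n\<close> are void, and \<open>r 0 = 1\<close> is used instead.\<close>
    show "r n \<le> k n"
      using assms(3,4) pos[of n] bspec[OF assms(6), of n] by (cases "n = 0") auto
    show "r (Suc i) \<le> r i * k i" if "i < n" for i using bspec[OF assms(5), of "Suc i"] that by simp
    show "r i \<le> k i * r (Suc i)" if "i < n" for i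
    proof (cases i)
      case 0 then show ?thesis using pos[of 0] r[of 1] that assms(3) by (simp add: Suc_leI)
    next
      case (Suc j) then show ?thesis using bspec[OF assms(6), of i] that by (simp add: mult.commute)
    qed
  qed
  \<comment> \<open>The complex instance provides the statements about the manifold, the real one
    the birational map.\<close>
  interpret C: tensor_train_scalars n k r UNIV by unfold_locales simp
  interpret R: tensor_train_scalars n k r \<real> by unfold_locales simp
  have params: "points_over UNIV PS = tt_parameters n k r" by (rule points_over_param_space)
  have domain: "{z \<in> tt_chart n k r. tt_map n k r z \<in> tt_open n k r} = tt_domain"
    by (simp add: tt_domain_def)
  have chart: "tt_chart n k r \<inter> points_over UNIV PS = tt_chart n k r" using chart_subset params by blast
  then have domain_points: "tt_domain \<inter> points_over UNIV PS = tt_domain" unfolding tt_domain_def by blast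
  have manifold_points: "tt_manifold n k r \<subseteq> tt_variety n k r \<inter> points_over UNIV TS"
    using manifold_subset_variety by (auto simp: tt_manifold_def points_over_def reps_over_def)
  have open_manifold: "tt_open n k r \<subseteq> tt_manifold n k r" by (auto simp: tt_open_def)
  then have open_points: "tt_open n k r \<inter> points_over UNIV TS = tt_open n k r" using manifold_points by blast
  have "rational_map UNIV PS (tt_parameters n k r) TS (tt_manifold n k r) tt_domain (tt_map n k r)"
    unfolding rational_map_def
  proof (intro conjI)
    show "dense_open_in (zariski UNIV PS) (tt_parameters n k r) tt_domain"
      using C.domain_dense_open[unfolded domain_points] unfolding params .
    show "tt_map n k r ` tt_domain \<subseteq> tt_manifold n k r" using open_manifold by (auto simp: tt_domain_def)
    show "regular_map UNIV PS tt_domain TS (tt_map n k r)"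
      by (rule C.tt_map_regular) (use chart in \<open>auto simp: tt_domain_def\<close>)
  qed
  moreover have "dense_open_in (zariski UNIV PS) (tt_parameters n k r) (tt_chart n k r)"
    using C.chart_dense_open[unfolded chart] unfolding params .
  moreover have "bij_betw (tt_map n k r) tt_domain (tt_open n k r)"
    using C.tt_map_bij unfolding domain_points open_points .
  moreover have "dense_open_in (zariski UNIV TS) (tt_manifold n k r) (tt_open n k r)"
    using C.tensor_dense_open[OF manifold_points] open_manifold unfolding open_points by blast
  ultimately show ?thesis
    unfolding domain using tt_map_variety chart_manifold_open R.tt_map_birational by blast
qed

end
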